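(* Let $V$ be a finite-dimensional complex vector space, let $Z \subset \mathbb{P} V$ be a linearly nondegenerate projective variety, and let $x \in Z$ be a general point, so that the system of fundamental forms of $Z$ at $x$ is a symbol system $S_x \subset \mathrm{Sym}\, T^*_x Z$ with $\dim S_x = \dim V$. Let $Z^{S_x} \subset \mathbb{P} V^{S_x}$ be the Euler-symmetric variety determined by $S_x$. Then $$\dim \mathfrak{aut}(\widehat{Z}) \ \leq \ \dim \mathfrak{aut}(\widehat{Z}^{S_x}),$$ and equality holds if and only if $Z \subset \mathbb{P} V$ is projectively equivalent to $Z^{S_x} \subset \mathbb{P} V^{S_x}$ by a linear isomorphism $V \cong V^{S_x}$.
   Context: Everything is over $\mathbb{C}$; $\mathbb{P}V$ is the set of one-dimensional subspaces of $V$; projective varieties are irreducible and reduced. $\widehat{Z} \subset V$ is the affine cone of $Z \subset \mathbb{P}V$. Linearly nondegenerate means not contained in a hyperplane. $\mathfrak{aut}(\widehat{Z}) \subset \mathfrak{gl}(V)$ is the Lie algebra of the group $\{g \in \mathrm{GL}(V) \mid g(\widehat{Z}) = \widehat{Z}\}$. Two subvarieties $Z \subset \mathbb{P}V$, $Z' \subset \mathbb{P}V'$ are projectively equivalent if some linear isomorphism $V \cong V'$ sends $Z$ to $Z'$. Symbol systems. For a finite-dimensional vector space $W$, put $\mathrm{Sym}\,W^* = \bigoplus_k \mathrm{Sym}^k W^*$ (zero for $k<0$), viewed as symmetric multilinear forms; for $w \in W$, $\zeta \in \mathrm{Sym}^k W^*$ put $\iota_w\zeta(w_1,\dots,w_{k-1})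 = \zeta(w,w_1,\dots,w_{k-1})$. A graded subspace $S = \bigoplus_k S^k$, $S^k \subset \mathrm{Sym}^k W^*$, is a symbol system of rank $r$ on $W$ if $\iota_w s \in S^{k-1}$ for all $k$, $w \in W$, $s \in S^k$, and $S^0 = \mathbb{C}$, $S^1 = W^*$, $S^r \neq 0$, $S^j = 0$ for $j>r$. System of fundamental forms. Let $M$ be the smooth locus of $Z$ and $\pi: L \to M$ the tautological line bundle, whose fiber over $x$ is the line $\widehat{x} \subset V$. For $x \in M$ let $\mathcal{F}_x$ be the space of germs at $x$ of holomorphic functions on $\pi^{-1}(U)$ ($U \ni x$ open) that are linear on the fibers of $\pi$; it is identified with $\mathcal{O}_{M,x} \otimes L_x^*$ by a local trivialization. Let $\mathcal{F}_x^k = \mathbf{m}_{M,x}^k \mathcal{F}_x$, where $\mathbf{m}^k_{M,x}$ is the ideal of germs vanishing at $x$ to order at least $k$ ($=\mathcal{O}_{M,x}$ for $k \le 0$). Then $\mathcal{F}_x^k/\mathcal{F}_x^{k+1} = \mathrm{Sym}^k T_x^*M \otimes L_x^*$. Each $\lambda \in V^*$ restricts to a fiberwise linear function $\lambda_L$ on $L$ with germ $\lambda_x \in \mathcal{F}_x$. Put $V_x^{*k} = \{\lambda \in V^* \mid \lambda_x \in \mathcal{F}_x^k\}$. The image of the induced map $V_x^{*k}/V_x^{*k+1} \to \mathrm{Sym}^k T_x^*M \otimes L_x^*$ equals $S_x^k \otimes L_x^*$ for a subspace $S_x^k \subset \mathrm{Sym}^k T_x^*M$, and $S_x = \bigoplus_k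 S_x^k$ is the system of fundamental forms at $x$. By a theorem of E. Cartan, for $x$ in a nonempty Zariski-open subset of $Z$ ("general $x$"), $S_x$ is a symbol system on $T_xZ$, and $\dim S_x = \dim V$ if $Z$ is linearly nondegenerate. Euler-symmetric variety. For a symbol system $S$ of rank $r$ on $W$, let $S^k_\bot = \{\xi \in \mathrm{Sym}^k W \mid f(\xi) = 0\ \forall f \in S^k\}$ and $V^S = \bigoplus_{k} \mathrm{Sym}^k W/S^k_\bot$, and write $[\xi]$ for the class of $\xi$. Define $\phi^S: \mathbb{C} \oplus W \to V^S$ by $\phi^S(t,v) = \sum_{k=0}^r [t^{r-k} v^k]$. The closure of the image of $\phi^S$ is denoted $\widehat{Z}^S \subset V^S$, and $Z^S \subset \mathbb{P}V^S$ is the projective variety with affine cone $\widehat{Z}^S$, called the Euler-symmetric variety determined by $S$. *)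

theory Defs
  imports "HOL-Analysis.Analysis" "HOL-Library.Multiset" "HOL-Library.Function_Algebras"
begin

section \<open>Complex vector spaces of functions and of matrices\<close>

definition fun_scale :: "complex \<Rightarrow> ('a \<Rightarrow> complex) \<Rightarrow> 'a \<Rightarrow> complex" where
  "fun_scale c f = (\<lambda>x. c * f x)"

global_interpretation cfun: vector_space "fun_scale :: complex \<Rightarrow> ('a \<Rightarrow> complex) \<Rightarrow> 'a \<Rightarrow> complex"
  by unfold_locales (auto simp: fun_scale_def fun_eq_iff algebra_simps)

definition mat_scale :: "complex \<Rightarrow> complex^'n^'m \<Rightarrow> complex^'n^'m" where
  "mat_scale c A = (\<chi> i j. c * A $ i $ j)"

global_interpretation cmat: vector_space "mat_scale :: complex \<Rightarrow> complex^'n^'m \<Rightarrow> complex^'n^'m"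
  by unfold_locales (auto simp: mat_scale_def vec_eq_iff algebra_simps)

abbreviation linear_form :: "(complex^'n \<Rightarrow> complex) \<Rightarrow> bool" where
  "linear_form \<equiv> Vector_Spaces.linear (*s) (*)"


section \<open>Projective varieties\<close>

text \<open>Vector spaces are \<open>complex^'n\<close>; a subset of the projective space is a set of lines.\<close>

definition proj_space :: "(complex^'n) set set" where
  "proj_space = {L. vec.subspace L \<and> vec.dim L = 1}"

inductive poly_fun :: "(complex^'n \<Rightarrow> complex) \<Rightarrow> bool" where
  poly_const: "poly_fun (\<lambda>v. c)"
| poly_coord: "poly_fun (\<lambda>v. v $ i)"
| poly_add: "poly_fun p \<Longrightarrow> poly_fun q \<Longrightarrow> poly_fun (\<lambda>v. p v + q v)"
| poly_mult: "poly_fun p \<Longrightarrow> poly_fun q \<Longrightarrow> poly_fun (\<lambda>v. p v * q v)"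

definition homogeneous :: "(complex^'n \<Rightarrow> complex) \<Rightarrow> bool" where
  "homogeneous p \<longleftrightarrow> (\<exists>d::nat. \<forall>c v. p (c *s v) = c ^ d * p v)"

definition proj_closed :: "(complex^'n) set set \<Rightarrow> bool" where
  "proj_closed Z \<longleftrightarrow> (\<exists>P. (\<forall>p\<in>P. poly_fun p \<and> homogeneous p) \<and>
     Z = {L \<in> proj_space. \<forall>p\<in>P. \<forall>v\<in>L. p v = 0})"

definition projective_variety :: "(complex^'n) set set \<Rightarrow> bool" where
  "projective_variety Z \<longleftrightarrow> proj_closed Z \<and> Z \<noteq> {} \<and>
     (\<forall>A B. proj_closed A \<and> proj_closed B \<and> Z = A \<union> B \<longrightarrow> Z = A \<or> Z = B)"

definition affine_cone :: "(complex^'n) set set \<Rightarrow> (complex^'n) set" where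
  "affine_cone Z = insert 0 (\<Union>Z)"

definition linearly_nondegenerate :: "(complex^'n) set set \<Rightarrow> bool" where
  "linearly_nondegenerate Z \<longleftrightarrow>
     \<not> (\<exists>l. linear_form l \<and> l \<noteq> (\<lambda>v. 0) \<and> affine_cone Z \<subseteq> {v. l v = 0})"

definition zariski_closure :: "(complex^'n) set \<Rightarrow> (complex^'n) set" where
  "zariski_closure A = {v. \<forall>p. poly_fun p \<and> (\<forall>a\<in>A. p a = 0) \<longrightarrow> p v = 0}"

definition projectively_equivalent :: "(complex^'n) set set \<Rightarrow> (complex^'m) set set \<Rightarrow> bool" where
  "projectively_equivalent Z Z' \<longleftrightarrow>
     (\<exists>f. Vector_Spaces.linear (*s) (*s) f \<and> bij f \<and> (\<lambda>L. f ` L) ` Z = Z')"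


section \<open>Infinitesimal linear automorphisms\<close>

definition mat_exp :: "complex^'n^'n \<Rightarrow> complex^'n^'n" where
  "mat_exp A = (\<Sum>k. (1 / fact k) *\<^sub>R (((**) A ^^ k) (mat 1)))"

definition linear_stabilizer :: "(complex^'n) set \<Rightarrow> (complex^'n^'n) set" where
  "linear_stabilizer C = {g. invertible g \<and> (\<lambda>v. g *v v) ` C = C}"

text \<open>Lie algebra of a closed subgroup of the general linear group.\<close>

definition lie_algebra :: "(complex^'n^'n) set \<Rightarrow> (complex^'n^'n) set" where
  "lie_algebra G = {X. \<forall>t::real. mat_exp (t *\<^sub>R X) \<in> G}"

definition aut_cone :: "(complex^'n) set \<Rightarrow> (complex^'n^'n) set" where
  "aut_cone C = lie_algebra (linear_stabilizer C)"


section \<open>Symbol systems\<close>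

text \<open>A \<open>k\<close>-linear form on \<open>W = complex^'d\<close> is a function on lists, extended by \<open>0\<close> to the
  lists whose length is not \<open>k\<close>. Symmetry reduces linearity in all arguments to the first one.\<close>

definition sym_forms :: "nat \<Rightarrow> ((complex^'d) list \<Rightarrow> complex) set" where
  "sym_forms k = {f. (\<forall>ws. length ws \<noteq> k \<longrightarrow> f ws = 0) \<and>
     (\<forall>ws ws'. mset ws = mset ws' \<longrightarrow> f ws = f ws') \<and>
     (\<forall>ws. Suc (length ws) = k \<longrightarrow> linear_form (\<lambda>w. f (w # ws)))}"

definition contract :: "complex^'d \<Rightarrow> ((complex^'d) list \<Rightarrow> complex) \<Rightarrow> (complex^'d) list \<Rightarrow> complex" where
  "contract w f = (\<lambda>ws. f (w # ws))"

definition symbol_system :: "nat \<Rightarrow> (nat \<Rightarrow> ((complex^'d) list \<Rightarrow> complex) set) \<Rightarrow> bool" where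
  "symbol_system r S \<longleftrightarrow>
     (\<forall>k. S k \<subseteq> sym_forms k \<and> cfun.subspace (S k)) \<and>
     (\<forall>k w. \<forall>s\<in>S (Suc k). contract w s \<in> S k) \<and>
     S 0 = sym_forms 0 \<and> S 1 = sym_forms 1 \<and>
     S r \<noteq> {0} \<and> (\<forall>j>r. S j = {0})"

definition symbol_dim :: "nat \<Rightarrow> (nat \<Rightarrow> ((complex^'d) list \<Rightarrow> complex) set) \<Rightarrow> nat" where
  "symbol_dim r S = (\<Sum>k\<le>r. cfun.dim (S k))"


section \<open>The system of fundamental forms\<close>

definition holomorphic_map :: "(complex^'d) set \<Rightarrow> (complex^'d \<Rightarrow> complex^'n) \<Rightarrow> bool" where
  "holomorphic_map U \<phi> \<longleftrightarrow> open U \<and>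
     (\<forall>w\<in>U. \<exists>D. (\<phi> has_derivative D) (at w) \<and> Vector_Spaces.linear (*s) (*s) D)"

text \<open>A local chart of the smooth locus \<open>M\<close> of \<open>Z\<close> centred at \<open>x\<close>, namely
  \<open>w \<mapsto> [\<phi> w]\<close>, together with the frame \<open>\<phi>\<close> of the tautological line bundle \<open>L\<close> over its image:
  \<open>(c, w) \<mapsto> c \<phi>(w)\<close> is a biholomorphic map onto the complement of the zero section of \<open>L\<close> over a
  neighbourhood of \<open>x\<close>, that complement being an open part of the affine cone minus the origin.
  Such a \<open>\<phi>\<close> exists iff \<open>x\<close> is a smooth point of \<open>Z\<close> (with \<open>dim Z = CARD('d)\<close>); its
  differential identifies \<open>complex^'d\<close> with the tangent space of \<open>Z\<close> at \<open>x\<close>.\<close>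

definition local_frame :: "(complex^'n) set set \<Rightarrow> (complex^'n) set \<Rightarrow> (complex^'d \<Rightarrow> complex^'n) \<Rightarrow> bool" where
  "local_frame Z x \<phi> \<longleftrightarrow> \<phi> 0 \<in> x \<and> (\<exists>U N g. 0 \<in> U \<and> holomorphic_map U \<phi> \<and>
     openin (top_of_set (affine_cone Z)) N \<and>
     homeomorphism ((- {0}) \<times> U) N (\<lambda>(c, w). c *s \<phi> w) g \<and>
     (\<forall>w\<in>U. \<forall>c h. c *s \<phi> w + frechet_derivative \<phi> (at w) h = 0 \<longrightarrow> c = 0 \<and> h = 0))"

definition dir_deriv :: "complex^'d \<Rightarrow> (complex^'d \<Rightarrow> complex) \<Rightarrow> complex^'d \<Rightarrow> complex" where
  "dir_deriv h f = (\<lambda>w. deriv (\<lambda>t. f (w + t *s h)) 0)"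

definition derivs_at_0 :: "(complex^'d \<Rightarrow> complex) \<Rightarrow> (complex^'d) list \<Rightarrow> complex" where
  "derivs_at_0 f hs = foldr dir_deriv hs f 0"

text \<open>In the frame \<open>\<phi>\<close>, the fibrewise linear function on \<open>L\<close> given by a linear form \<open>l\<close> is
  \<open>l \<circ> \<phi>\<close>. The following is the filtration of the dual space by vanishing order at \<open>x\<close>.\<close>

definition dual_filtration :: "(complex^'d \<Rightarrow> complex^'n) \<Rightarrow> nat \<Rightarrow> (complex^'n \<Rightarrow> complex) set" where
  "dual_filtration \<phi> k = {l. linear_form l \<and> (\<forall>hs. length hs < k \<longrightarrow> derivs_at_0 (l \<circ> \<phi>) hs = 0)}"

text \<open>The class of a germ \<open>f\<close> in \<open>m^k / m^(k+1) = Sym^k T*\<close> is its \<open>k\<close>-th derivative. The factor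
  \<open>k!\<close> by which this may differ from other normalisations does not affect the subspace.\<close>

definition fundamental_forms ::
    "(complex^'d \<Rightarrow> complex^'n) \<Rightarrow> nat \<Rightarrow> ((complex^'d) list \<Rightarrow> complex) set" where
  "fundamental_forms \<phi> k =
     (\<lambda>l hs. if length hs = k then derivs_at_0 (l \<circ> \<phi>) hs else 0) ` dual_filtration \<phi> k"


section \<open>Euler-symmetric varieties\<close>

text \<open>\<open>Sym^k W\<close> is modelled inside the dual of \<open>Sym^k W*\<close>: the product of \<open>w\<^sub>1, \<dots>, w\<^sub>k\<close> is the
  functional \<open>f \<mapsto> f(w\<^sub>1, \<dots>, w\<^sub>k)\<close>, so that the pairing of \<open>\<xi>\<close> with \<open>f\<close> is \<open>\<xi> f\<close>.\<close>

definition sym_prod :: "(complex^'d) list \<Rightarrow> ((complex^'d) list \<Rightarrow> complex) \<Rightarrow> complex" where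
  "sym_prod ws = (\<lambda>f. if f \<in> sym_forms (length ws) then f ws else 0)"

definition sym_power :: "nat \<Rightarrow> (((complex^'d) list \<Rightarrow> complex) \<Rightarrow> complex) set" where
  "sym_power k = cfun.span {sym_prod ws | ws. length ws = k}"

definition symbol_perp :: "(nat \<Rightarrow> ((complex^'d) list \<Rightarrow> complex) set) \<Rightarrow> nat
    \<Rightarrow> (((complex^'d) list \<Rightarrow> complex) \<Rightarrow> complex) set" where
  "symbol_perp S k = {\<xi> \<in> sym_power k. \<forall>f\<in>S k. \<xi> f = 0}"

text \<open>\<open>complex^'m\<close> is the direct sum over \<open>k\<close> of the quotients \<open>Sym^k W / S^k_perp\<close>, with
  \<open>cl k \<xi>\<close> the class of \<open>\<xi>\<close>. The values of \<open>cl k\<close> outside \<open>sym_power k\<close> are irrelevant, and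
  every linear map on that subspace extends linearly.\<close>

definition symbol_quotient :: "(nat \<Rightarrow> ((complex^'d) list \<Rightarrow> complex) set)
    \<Rightarrow> (nat \<Rightarrow> (((complex^'d) list \<Rightarrow> complex) \<Rightarrow> complex) \<Rightarrow> complex^'m) \<Rightarrow> bool" where
  "symbol_quotient S cl \<longleftrightarrow>
     (\<forall>k. Vector_Spaces.linear fun_scale (*s) (cl k) \<and>
          (\<forall>\<xi>\<in>sym_power k. cl k \<xi> = 0 \<longleftrightarrow> \<xi> \<in> symbol_perp S k)) \<and>
     (\<forall>u. \<exists>!c. (\<forall>k. c k \<in> cl k ` sym_power k) \<and> finite {k. c k \<noteq> 0} \<and>
               u = (\<Sum>k | c k \<noteq> 0. c k))"

definition euler_map :: "nat \<Rightarrow> (nat \<Rightarrow> (((complex^'d) list \<Rightarrow> complex) \<Rightarrow> complex) \<Rightarrow> complex^'m)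
    \<Rightarrow> complex \<times> (complex^'d) \<Rightarrow> complex^'m" where
  "euler_map r cl = (\<lambda>(t, v). \<Sum>k\<le>r. cl k (fun_scale (t ^ (r - k)) (sym_prod (replicate k v))))"

text \<open>The image of this polynomial map is constructible, so its closures in the Zariski and in the
  Euclidean topology coincide. It is stable under scalars because \<open>r > 0\<close> (as \<open>CARD('d) > 0\<close>).\<close>

definition euler_cone :: "nat \<Rightarrow> (nat \<Rightarrow> (((complex^'d) list \<Rightarrow> complex) \<Rightarrow> complex) \<Rightarrow> complex^'m)
    \<Rightarrow> (complex^'m) set" where
  "euler_cone r cl = zariski_closure (range (euler_map r cl))"

definition euler_variety :: "nat \<Rightarrow> (nat \<Rightarrow> (((complex^'d) list \<Rightarrow> complex) \<Rightarrow> complex) \<Rightarrow> complex^'m)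
    \<Rightarrow> (complex^'m) set set" where
  "euler_variety r cl = {L \<in> proj_space. L \<subseteq> euler_cone r cl}"

end

theory Submission
  imports Defs "HOL-Complex_Analysis.Complex_Analysis"
begin

text \<open>
  Linear forms adapted to the filtration of \<open>V*\<close> by vanishing order at \<open>x\<close> are coordinates \<open>i\<close> of degree
  \<open>d i\<close> in which the frame \<open>\<phi>\<close> of the cone has leading terms \<open>s i (w, \<dots>, w)\<close>, the forms \<open>s i\<close> being
  a basis of the symbol system. Rescaling coordinate \<open>i\<close> by \<open>t ^ (- d i)\<close> turns \<open>\<phi> (t w)\<close> in the limit
  \<open>t \<rightarrow> 0\<close> into the parametrization \<open>psi w\<close> of the Euler-symmetric variety. The condition that \<open>X\<close>
  be tangent to the cone along \<open>\<phi>\<close> survives the limit, so the highest-degree part of every \<open>X\<close> in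
  \<open>aut(Z)\<close> lies in the algebra of the Euler-symmetric cone. Hence the associated graded algebra of
  \<open>aut(Z)\<close> embeds there, which is the inequality.

  In case of equality, \<open>aut(Z)\<close> contains an element with leading part the degree matrix, and a unipotent
  change of the adapted coordinates makes it equal to the degree matrix. Then \<open>aut(Z)\<close> is graded and
  contains the multiplications by vectors of \<open>W\<close>, whose exponentials translate \<open>psi\<close>; so the cone
  contains the Euler-symmetric cone. Conversely, a point with non-zero coordinate of degree \<open>0\<close> is
  translated to one with vanishing coordinates of degree \<open>1\<close>, and then contracted by the degree flow into
  the chart, where such points are multiples of \<open>\<phi> 0\<close>. The rest of the cone lies in a hyperplane, and
  irreducibility concludes.
\<close>

text \<open>The algebra of the cone is defined by real one-parameter groups, while the model is
  given by a parametrization whose closure is not explicit. Both are therefore read through the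
  vanishing ideal: \<open>inf_aut\<close> asks that the linear vector field of \<open>X\<close>
  preserve the ideal, which does not change under Zariski closure. Conversely, tangency to the ideal
  must become tangency to the frame. The chart is known only as a homeomorphism onto an open part of
  the cone, so the orbit \<open>exp(X/n) \<phi>(w)\<close> is lifted through it and differentiated
  at its start.

  Limits of tangent vectors stay in the limiting tangent space only if that space does not collapse.
  As \<open>psi\<close> involves all forms of degree 0 and 1, its tangent map is injective and the
  coefficients stay bounded.

  Conjugation to the degree matrix meets no resonance: what remains of the automorphism strictly
  lowers degree, and the eigenvalue differences to be divided by are positive integers. The
  condition \<open>dim S = dim V\<close> provides as many adapted linear forms as there are
  coordinates.\<close>

no_notation fps_nth (infixl \<open>$\<close> 75)

section \<open>Polynomial functions\<close>

text \<open>One existential carries all three properties, because the induction must produce them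
  for the same \<open>D\<close>; uniqueness of the derivative then transfers them to
  \<open>poly_diff\<close>. The last one lets derivatives along a linear vector field be iterated
  within polynomials.\<close>

lemma poly_fun_derivative:
  assumes "poly_fun p"
  shows "\<exists>D. (\<forall>v. (p has_derivative D v) (at v)) \<and> (\<forall>v c u. D v (c *s u) = c * D v u) \<and>
           (\<forall>X. poly_fun (\<lambda>v. D v (X *v v)))"
  using assms
proof induction
  case (poly_const c)
  show ?case
    by (rule exI[of _ "\<lambda>v u. 0"]) (auto intro: poly_fun.intros)
next
  case (poly_coord i)
  have lin: "poly_fun (\<lambda>v. \<Sum>j\<in>J. (X $ i $ j) * v $ j)" if "finite J" for X :: "complex^'a^'a" and J
    using that by (induction J) (auto intro!: poly_fun.intros)
  have "poly_fun (\<lambda>v. (X *v v) $ i)" for X :: "complex^'a^'a"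
    unfolding matrix_vector_mult_def using lin[of UNIV X] by simp
  moreover have "((\<lambda>v. v $ i) has_derivative (\<lambda>u. u $ i)) (at v)" for v :: "complex^'a"
    by (rule bounded_linear_imp_has_derivative) (rule bounded_linear_vec_nth)
  ultimately show ?case
    by (intro exI[of _ "\<lambda>v u. u $ i"]) auto
next
  case (poly_add p q)
  from poly_add.IH(1) obtain D where D:
    "\<And>v. (p has_derivative D v) (at v)" "\<And>v c u. D v (c *s u) = c * D v u"
    "\<And>X. poly_fun (\<lambda>v. D v (X *v v))"
    by blast
  from poly_add.IH(2) obtain E where
    "\<And>v. (q has_derivative E v) (at v)" "\<And>v c u. E v (c *s u) = c * E v u"
    "\<And>X. poly_fun (\<lambda>v. E v (X *v v))"
    by blast
  with D show ?case
    by (intro exI[of _ "\<lambda>v u. D v u + E v u"])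
      (auto intro!: poly_fun.intros derivative_eq_intros simp: algebra_simps)
next
  case (poly_mult p q)
  from poly_mult.IH(1) obtain D where D:
    "\<And>v. (p has_derivative D v) (at v)" "\<And>v c u. D v (c *s u) = c * D v u"
    "\<And>X. poly_fun (\<lambda>v. D v (X *v v))"
    by blast
  from poly_mult.IH(2) obtain E where
    "\<And>v. (q has_derivative E v) (at v)" "\<And>v c u. E v (c *s u) = c * E v u"
    "\<And>X. poly_fun (\<lambda>v. E v (X *v v))"
    by blast
  with D show ?case using poly_mult.hyps
    by (intro exI[of _ "\<lambda>v u. p v * E v u + D v u * q v"])
      (auto intro!: poly_fun.intros derivative_eq_intros simp: algebra_simps)
qed

abbreviation poly_diff :: "(complex^'n \<Rightarrow> complex) \<Rightarrow> complex^'n \<Rightarrow> complex^'n \<Rightarrow> complex" where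
  "poly_diff p a \<equiv> frechet_derivative p (at a)"

lemma poly_diff_has_derivative:
  assumes "poly_fun p"
  shows "(p has_derivative poly_diff p v) (at v)"
  using poly_fun_derivative[OF assms] frechet_derivative_at by metis

lemma poly_diff_scale:
  assumes "poly_fun p"
  shows "poly_diff p v (c *s u) = c * poly_diff p v u"
  using poly_fun_derivative[OF assms] frechet_derivative_at by metis

lemma poly_diff_add:
  assumes "poly_fun p"
  shows "poly_diff p v (u + u') = poly_diff p v u + poly_diff p v u'"
  using has_derivative_linear[OF poly_diff_has_derivative[OF assms]] by (rule linear_add)

lemma poly_fun_poly_diff:
  assumes "poly_fun p"
  shows "poly_fun (\<lambda>v. poly_diff p v (X *v v))"
proof -
  obtain D where D: "\<forall>v. (p has_derivative D v) (at v)" "\<forall>X. poly_fun (\<lambda>v. D v (X *v v))"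
    using poly_fun_derivative[OF assms] by metis
  then have "D = (\<lambda>v. poly_diff p v)"
    using frechet_derivative_at by (metis (no_types, opaque_lifting) ext)
  then show ?thesis
    using D by simp
qed

lemma poly_fun_continuous_on: "poly_fun p \<Longrightarrow> continuous_on S p"
  by (meson continuous_at_imp_continuous_on has_derivative_continuous poly_diff_has_derivative)

lemma poly_fun_sum: "(\<And>i. i \<in> I \<Longrightarrow> poly_fun (p i)) \<Longrightarrow> poly_fun (\<lambda>v. \<Sum>i\<in>I. p i v)"
  by (induction I rule: infinite_finite_induct) (auto intro: poly_fun.intros)

lemma poly_fun_matrix_comp:
  fixes M :: "complex^'n^'m"
  assumes "poly_fun p"
  shows "poly_fun (\<lambda>v. p (M *v v))"
  using assms
proof induction
  case (poly_coord i)
  show ?case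
    unfolding matrix_vector_mult_def by (auto intro!: poly_fun_sum poly_fun.intros)
qed (auto intro: poly_fun.intros)

lemma has_derivative_vec:
  fixes f :: "'a::real_normed_vector \<Rightarrow> complex^'n"
  assumes "\<And>i. ((\<lambda>x. f x $ i) has_derivative (\<lambda>h. f' h $ i)) (at a)"
  shows "(f has_derivative f') (at a)"
  unfolding has_derivative_componentwise_within[of f]
  using assms by (auto simp: Basis_vec_def inner_axis intro!: has_derivative_inner_left)

lemma has_derivative_vec_complex:
  fixes y :: "complex \<Rightarrow> complex^'n"
  assumes "\<And>i. ((\<lambda>z. y z $ i) has_field_derivative y' $ i) (at z)"
  shows "(y has_derivative (\<lambda>h. h *s y')) (at z)"
  by (rule has_derivative_vec)
    (use assms in \<open>simp add: has_field_derivative_def mult_commute_abs mult.commute\<close>)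

lemma poly_fun_curve_derivative:
  fixes y :: "complex \<Rightarrow> complex^'n"
  assumes "poly_fun p" "\<And>i. ((\<lambda>z. y z $ i) has_field_derivative y' $ i) (at z)"
  shows "((\<lambda>z. p (y z)) has_field_derivative poly_diff p (y z) y') (at z)"
proof -
  have "((p \<circ> y) has_derivative (poly_diff p (y z) \<circ> (\<lambda>h. h *s y'))) (at z)"
    by (rule diff_chain_at[OF has_derivative_vec_complex poly_diff_has_derivative])
      (use assms in auto)
  then show ?thesis
    by (simp add: has_field_derivative_def o_def poly_diff_scale[OF assms(1)] mult.commute[of _ "poly_diff p (y z) y'"])
qed

section \<open>Zariski closure and linear isomorphisms\<close>

lemma zariski_closure_superset: "A \<subseteq> zariski_closure A"
  by (auto simp: zariski_closure_def)

lemma zariski_closure_minimal: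
  assumes "A \<subseteq> zariski_closure B"
  shows "zariski_closure A \<subseteq> zariski_closure B"
  using assms unfolding zariski_closure_def by (smt (verit) mem_Collect_eq subset_eq)

lemma zariski_closure_idem: "zariski_closure (zariski_closure A) = zariski_closure A"
  by (simp add: subset_antisym zariski_closure_minimal zariski_closure_superset)

lemma zariski_closure_matrix_image:
  fixes M :: "complex^'n^'m"
  assumes MN: "M ** N = mat 1" "N ** M = mat 1"
  shows "zariski_closure ((*v) M ` A) = (*v) M ` zariski_closure A"
proof
  have inv: "N *v (M *v v) = v" "M *v (N *v w) = w" for v w
    using MN by (simp_all add: matrix_vector_mul_assoc)
  show "zariski_closure ((*v) M ` A) \<subseteq> (*v) M ` zariski_closure A"
  proof
    fix w assume w: "w \<in> zariski_closure ((*v) M ` A)"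
    have "p (N *v w) = 0" if "poly_fun p" "\<forall>a\<in>A. p a = 0" for p
      using w poly_fun_matrix_comp[OF that(1), of N] that(2)
      by (auto simp: zariski_closure_def inv)
    then have "N *v w \<in> zariski_closure A"
      by (simp add: zariski_closure_def)
    then show "w \<in> (*v) M ` zariski_closure A"
      using inv(2) by (metis image_eqI)
  qed
  show "(*v) M ` zariski_closure A \<subseteq> zariski_closure ((*v) M ` A)"
  proof (clarsimp simp: zariski_closure_def)
    fix v p assume *: "\<forall>p. poly_fun p \<and> (\<forall>a\<in>A. p a = 0) \<longrightarrow> p v = 0"
      "poly_fun p" "\<forall>a\<in>A. p (M *v a) = 0"
    show "p (M *v v) = 0"
      using *(1)[rule_format, of "\<lambda>v. p (M *v v)"] *(2,3) poly_fun_matrix_comp by blast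
  qed
qed

section \<open>The matrix exponential\<close>

abbreviation mat_pow :: "complex^'n^'n \<Rightarrow> nat \<Rightarrow> complex^'n^'n" where
  "mat_pow X k \<equiv> ((**) X ^^ k) (mat 1)"

text \<open>The exponential exp(zX) with complex time. Working entrywise makes every entry an
  everywhere convergent scalar power series, to be differentiated term by term;
  \<open>mat_exp\<close> only sees real times.\<close>

definition cexp :: "complex^'n^'n \<Rightarrow> complex \<Rightarrow> complex^'n^'n" where
  "cexp X z = (\<chi> i j. \<Sum>k. (mat_pow X k $ i $ j / fact k) * z ^ k)"

text \<open>Multiplication by \<open>X\<close> enlarges entries at most by a row sum of norms, and
  the sum over all entries dominates every row sum. Exponential growth suffices against the
  factorials.\<close>

lemma mat_pow_bound: "norm (mat_pow X k $ i $ j) \<le> (1 + (\<Sum>i\<in>UNIV. \<Sum>j\<in>UNIV. norm (X $ i $ j))) ^ k"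
proof (induction k arbitrary: i)
  case 0
  then show ?case by (simp add: mat_def)
next
  case (Suc k)
  define K where "K = 1 + (\<Sum>i\<in>UNIV. \<Sum>j\<in>UNIV. norm (X $ i $ j))"
  have "norm (mat_pow X (Suc k) $ i $ j) \<le> (\<Sum>l\<in>UNIV. norm (X $ i $ l * mat_pow X k $ l $ j))"
    by (simp add: matrix_matrix_mult_def norm_sum)
  also have "\<dots> \<le> (\<Sum>l\<in>UNIV. norm (X $ i $ l) * K ^ k)"
    by (intro sum_mono) (simp add: norm_mult mult_left_mono Suc K_def)
  also have "\<dots> = (\<Sum>l\<in>UNIV. norm (X $ i $ l)) * K ^ k"
    by (simp add: sum_distrib_right)
  also have "(\<Sum>l\<in>UNIV. norm (X $ i $ l)) \<le> (\<Sum>i\<in>UNIV. \<Sum>j\<in>UNIV. norm (X $ i $ j))"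
    by (rule member_le_sum) (auto intro: sum_nonneg)
  also have "\<dots> \<le> K"
    by (simp add: K_def)
  finally show ?case
    by (simp add: K_def mult_right_mono sum_nonneg)
qed

lemma summable_cexp: "summable (\<lambda>k. (mat_pow X k $ i $ j / fact k) * z ^ k)"
proof (rule summable_comparison_test')
  define K where "K = 1 + (\<Sum>i\<in>UNIV. \<Sum>j\<in>UNIV. norm (X $ i $ j))"
  show "summable (\<lambda>k. (K * norm z) ^ k /\<^sub>R fact k)"
    by (rule summable_exp_generic)
  show "norm ((mat_pow X k $ i $ j / fact k) * z ^ k) \<le> (K * norm z) ^ k /\<^sub>R fact k" if "0 \<le> k" for k
    using mult_right_mono[OF mat_pow_bound[of k X i j, folded K_def], of "norm z ^ k / fact k"]
    by (simp add: norm_mult norm_divide norm_power power_mult_distrib divide_simps)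
qed

lemma mat_pow_Suc_right: "mat_pow X (Suc k) = mat_pow X k ** X"
  by (induction k) (simp_all add: matrix_mul_assoc)

lemma cexp_deriv_left:
  "((\<lambda>z. cexp X z $ i $ j) has_field_derivative (X ** cexp X z) $ i $ j) (at z)"
proof -
  define c where "c = (\<lambda>i k. mat_pow X k $ i $ j / fact k)"
  have sm: "summable (\<lambda>k. c i k * z ^ k)" for i z
    unfolding c_def by (rule summable_cexp)
  have cexp: "cexp X z $ i $ j = (\<Sum>k. c i k * z ^ k)" for i
    by (simp add: cexp_def c_def)
  \<comment> \<open>The factor \<open>Suc k\<close> produced by differentiation cancels in
    \<open>fact (Suc k)\<close>, leaving one more factor \<open>X\<close> on the left.\<close>
  have "diffs (c i) k = (\<Sum>l\<in>UNIV. X $ i $ l * c l k)" for k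
    by (simp add: diffs_def c_def matrix_matrix_mult_def sum_divide_distrib sum_distrib_left
        divide_simps del: of_nat_Suc)
  then have "(\<Sum>k. diffs (c i) k * z ^ k) = (\<Sum>k. \<Sum>l\<in>UNIV. X $ i $ l * (c l k * z ^ k))"
    by (simp add: sum_distrib_right mult.assoc)
  also have "\<dots> = (\<Sum>l\<in>UNIV. \<Sum>k. X $ i $ l * (c l k * z ^ k))"
    by (intro suminf_sum summable_mult sm)
  also have "\<dots> = (X ** cexp X z) $ i $ j"
    using suminf_mult[OF sm] by (simp add: cexp matrix_matrix_mult_def)
  finally show ?thesis
    using termdiffs_strong_converges_everywhere[of "c i" z, OF sm] by (simp add: cexp_def c_def)
qed

text \<open>The derivative of exp(zX) comes with \<open>X\<close> on the left, whereas
  differentiating \<open>exp(zX) y(z)\<close> needs \<open>X\<close> next to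
  \<open>y(z)\<close>.\<close>

lemma cexp_commute: "X ** cexp X z = cexp X z ** X"
proof -
  have "(X ** cexp X z) $ i $ j = (cexp X z ** X) $ i $ j" for i j
  proof -
    define c where "c = (\<lambda>i j k. (mat_pow X k $ i $ j / fact k) * z ^ k)"
    have sm: "summable (c i j)" for i j
      unfolding c_def by (rule summable_cexp)
    have cexp: "cexp X z $ i $ j = (\<Sum>k. c i j k)" for i j
      by (simp add: cexp_def c_def)
    have "(X ** cexp X z) $ i $ j = (\<Sum>l\<in>UNIV. \<Sum>k. X $ i $ l * c l j k)"
      using suminf_mult[OF sm] by (simp add: matrix_matrix_mult_def cexp)
    also have "\<dots> = (\<Sum>k. \<Sum>l\<in>UNIV. X $ i $ l * c l j k)"
      by (intro suminf_sum[symmetric] summable_mult sm)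
    also have "\<dots> = (\<Sum>k. (X ** mat_pow X k) $ i $ j / fact k * z ^ k)"
      by (simp add: c_def matrix_matrix_mult_def sum_distrib_right sum_divide_distrib mult.assoc)
    also have "\<dots> = (\<Sum>k. (mat_pow X k ** X) $ i $ j / fact k * z ^ k)"
      using mat_pow_Suc_right[of _ X] by simp
    also have "\<dots> = (\<Sum>k. \<Sum>l\<in>UNIV. c i l k * X $ l $ j)"
      by (simp add: c_def matrix_matrix_mult_def sum_distrib_right sum_distrib_left sum_divide_distrib mult_ac)
    also have "\<dots> = (\<Sum>l\<in>UNIV. \<Sum>k. c i l k * X $ l $ j)"
      by (intro suminf_sum summable_mult2 sm)
    also have "\<dots> = (cexp X z ** X) $ i $ j"
      using suminf_mult2[OF sm] by (simp add: matrix_matrix_mult_def cexp)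
    finally show ?thesis .
  qed
  then show ?thesis by (simp add: vec_eq_iff)
qed

lemma cexp_0 [simp]: "cexp X 0 = mat 1"
proof -
  have "(\<Sum>k. c k * 0 ^ k) = c 0" for c :: "nat \<Rightarrow> complex"
    using powser_sums_zero[of c] sums_unique by metis
  from this[of "\<lambda>k. mat_pow X k $ i $ j / fact k" for i j] show ?thesis
    by (simp add: cexp_def vec_eq_iff)
qed

lemma cexp_curve_derivative:
  assumes "\<And>i. ((\<lambda>z. y z $ i) has_field_derivative y' $ i) (at z)"
  shows "((\<lambda>z. (cexp X z *v y z) $ i) has_field_derivative
           (cexp X z *v (X *v y z + y')) $ i) (at z)"
proof -
  have "((\<lambda>z. \<Sum>j\<in>UNIV. cexp X z $ i $ j * y z $ j) has_field_derivative
      (\<Sum>j\<in>UNIV. (X ** cexp X z) $ i $ j * y z $ j + y' $ j * cexp X z $ i $ j)) (at z)"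
    by (intro DERIV_sum DERIV_mult' cexp_deriv_left assms)
      (auto intro!: derivative_eq_intros cexp_deriv_left assms)
  moreover have "(\<Sum>j\<in>UNIV. (X ** cexp X z) $ i $ j * y z $ j + y' $ j * cexp X z $ i $ j) =
      (cexp X z *v (X *v y z + y')) $ i"
  proof -
    have "(\<Sum>j\<in>UNIV. (X ** cexp X z) $ i $ j * y z $ j) = ((cexp X z ** X) *v y z) $ i"
      by (simp add: cexp_commute matrix_vector_mult_def)
    then show ?thesis
      by (simp add: sum.distrib matrix_vector_mul_assoc[symmetric] matrix_vector_right_distrib)
        (simp add: matrix_vector_mult_def mult.commute)
  qed
  ultimately show ?thesis
    by (simp add: matrix_vector_mult_def)
qed

lemma cexp_vec_derivative:
  "((\<lambda>z. (cexp X z *v v) $ i) has_field_derivative (X *v (cexp X z *v v)) $ i) (at z)"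
  using cexp_curve_derivative[of "\<lambda>_. v" 0 z X i]
  by (simp add: matrix_vector_mul_assoc cexp_commute)

lemma cexp_negative_derivative:
  assumes "((\<lambda>z. (cexp X z *v v) $ i) has_field_derivative d) (at (- z))"
  shows "((\<lambda>z. (cexp X (- z) *v v) $ i) has_field_derivative - d) (at z)"
proof -
  have "(uminus has_field_derivative - 1) (at z)"
    using DERIV_minus[OF DERIV_ident, of z] by simp
  then show ?thesis
    using DERIV_chain2[where g = uminus and x = z and Db = "- 1" and s = UNIV, OF assms] by simp
qed

text \<open>The curve \<open>exp(zX) y(z)\<close> has derivative zero.\<close>

lemma cexp_constant:
  assumes "\<And>z i. ((\<lambda>z. y z $ i) has_field_derivative (- (X *v y z)) $ i) (at z)"
  shows "cexp X z *v y z = y 0"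
proof -
  have "((\<lambda>z. (cexp X z *v y z) $ i) has_field_derivative 0) (at z)" for z i
    using cexp_curve_derivative[of y "- (X *v y z)" z X i, OF assms] by simp
  then have "\<exists>c. \<forall>z\<in>UNIV. (cexp X z *v y z) $ i = c" for i
    by (intro has_field_derivative_zero_constant) auto
  then have "(cexp X z *v y z) $ i = (cexp X 0 *v y 0) $ i" for i
    by (metis UNIV_I)
  then show ?thesis
    by (simp add: vec_eq_iff)
qed

text \<open>The curve \<open>exp(-zX) v\<close> solves \<open>y' = -Xy\<close>, so
  \<open>cexp_constant\<close> applies and no product of series has to be expanded.\<close>

lemma cexp_inverse: "cexp X z ** cexp X (- z) = mat 1"
proof -
  have "cexp X z *v (cexp X (- z) *v v) = v" for v
  proof -
    have "((\<lambda>z. (cexp X (- z) *v v) $ i) has_field_derivative (- (X *v (cexp X (- z) *v v))) $ i) (at z)"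
      for z i
      using cexp_negative_derivative[OF cexp_vec_derivative] by simp
    then show ?thesis
      using cexp_constant[of "\<lambda>z. cexp X (- z) *v v" X z] by simp
  qed
  then show ?thesis
    by (simp add: matrix_eq matrix_vector_mul_assoc)
qed

lemma mat_pow_scaleR: "mat_pow (t *\<^sub>R X) k = (t ^ k) *\<^sub>R mat_pow X k"
proof (induction k)
  case (Suc k)
  have "(t *\<^sub>R X) ** (s *\<^sub>R Y) = (t * s) *\<^sub>R (X ** Y)" for s and Y :: "complex^'a^'a"
    by (simp add: matrix_matrix_mult_def vec_eq_iff scaleR_conv_of_real[where 'a=complex] sum_distrib_left mult_ac)
  then show ?case
    using Suc by simp
qed simp

lemma mat_exp_eq_cexp: "mat_exp (t *\<^sub>R X) = cexp X (complex_of_real t)"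
proof -
  have "(\<lambda>k. (1 / fact k) *\<^sub>R mat_pow (t *\<^sub>R X) k) sums cexp X (complex_of_real t)"
    unfolding sums_def
  proof (intro vec_tendstoI)
    fix i j
    have "(\<lambda>k. (mat_pow X k $ i $ j / fact k) * complex_of_real t ^ k) sums
        (cexp X (complex_of_real t) $ i $ j)"
      using summable_sums[OF summable_cexp] by (simp add: cexp_def)
    moreover have "(mat_pow X k $ i $ j / fact k) * complex_of_real t ^ k =
       ((1 / fact k) *\<^sub>R mat_pow (t *\<^sub>R X) k) $ i $ j" for k
      by (simp add: mat_pow_scaleR scaleR_conv_of_real[where 'a=complex])
    ultimately show "(\<lambda>n. (\<Sum>k<n. (1 / fact k) *\<^sub>R mat_pow (t *\<^sub>R X) k) $ i $ j)
        \<longlonglongrightarrow> cexp X (complex_of_real t) $ i $ j"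
      by (simp add: sums_def)
  qed
  then show ?thesis
    by (simp add: mat_exp_def sums_unique[symmetric])
qed


section \<open>Infinitesimal automorphisms of a Zariski closed set\<close>

text \<open>The stabilizer of the vanishing ideal of \<open>A\<close> among linear vector fields. As
  only the ideal enters, it also makes sense for sets that are not closed, such as the parametrized
  \<open>model\<close>.\<close>

definition inf_aut :: "(complex^'n) set \<Rightarrow> (complex^'n^'n) set" where
  "inf_aut A = {X. \<forall>p. poly_fun p \<and> (\<forall>a\<in>A. p a = 0) \<longrightarrow> (\<forall>a\<in>A. poly_diff p a (X *v a) = 0)}"

text \<open>The derivative of \<open>p\<close> along \<open>X\<close> is again a polynomial, so its
  vanishing on \<open>A\<close> extends to the closure.\<close>

lemma inf_aut_zariski_closure: "inf_aut (zariski_closure A) = inf_aut A"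
proof -
  have *: "(\<forall>a\<in>zariski_closure A. p a = 0) \<longleftrightarrow> (\<forall>a\<in>A. p a = 0)" if "poly_fun p" for p
    using that by (auto simp: zariski_closure_def)
  show ?thesis
    unfolding inf_aut_def using * poly_fun_poly_diff by blast
qed

text \<open>All derivatives of \<open>z \<mapsto> p (exp(zX) v)\<close> vanish at \<open>0\<close>.\<close>

lemma inf_aut_cexp:
  assumes X: "X \<in> inf_aut A" and v: "v \<in> A"
  shows "cexp X z *v v \<in> zariski_closure A"
proof -
  have "p (cexp X z *v v) = 0" if p: "poly_fun p" "\<forall>a\<in>A. p a = 0" for p
  proof -
    define F where "F = (\<lambda>q z. q (cexp X z *v v) :: complex)"
    have der: "(F q has_field_derivative F (\<lambda>a. poly_diff q a (X *v a)) z) (at z)" if "poly_fun q" for q z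
      unfolding F_def by (rule poly_fun_curve_derivative[OF that cexp_vec_derivative])
    have "\<exists>q. (deriv ^^ n) (F p) = F q \<and> poly_fun q \<and> (\<forall>a\<in>A. q a = 0)" for n
    proof (induction n)
      case (Suc n)
      then obtain q where q: "(deriv ^^ n) (F p) = F q" "poly_fun q" "\<forall>a\<in>A. q a = 0"
        by blast
      have "deriv (F q) = F (\<lambda>a. poly_diff q a (X *v a))"
        using der[OF q(2)] DERIV_imp_deriv by blast
      then show ?case
        using q X poly_fun_poly_diff[OF q(2)] by (auto simp: inf_aut_def intro!: exI[of _ "\<lambda>a. poly_diff q a (X *v a)"])
    qed (use p in auto)
    then have "(deriv ^^ n) (F p) 0 = 0" for n
      by (metis F_def cexp_0 matrix_vector_mul_lid v)
    moreover have "F p holomorphic_on UNIV"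
      using der[OF p(1)] by (meson field_differentiable_def field_differentiable_at_within holomorphic_on_def)
    ultimately have "F p z = 0"
      by (intro holomorphic_fun_eq_0_on_connected[of "F p" UNIV 0 z]) auto
    then show ?thesis by (simp add: F_def)
  qed
  then show ?thesis by (simp add: zariski_closure_def)
qed

text \<open>A matrix preserving the ideal exponentiates into the stabilizer, where
  \<open>exp(-zX)\<close> provides surjectivity on \<open>C\<close>. Conversely, a real
  one-parameter group is differentiated at time 0.\<close>

lemma aut_cone_eq_inf_aut:
  assumes C: "zariski_closure C = C"
  shows "aut_cone C = inf_aut C"
proof (intro equalityI subsetI)
  fix X assume X: "X \<in> inf_aut C"
  have "cexp X z \<in> linear_stabilizer C" for z
  proof -
    have inv: "cexp X z ** cexp X (- z) = mat 1" "cexp X (- z) ** cexp X z = mat 1"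
      using cexp_inverse[of X z] cexp_inverse[of X "- z"] by simp_all
    have "cexp X w *v v \<in> C" if "v \<in> C" for v w
      using inf_aut_cexp[OF X that] C by simp
    moreover have "v = cexp X z *v (cexp X (- z) *v v)" for v
      by (simp add: inv matrix_vector_mul_assoc)
    ultimately have "(\<lambda>v. cexp X z *v v) ` C = C"
      by (metis (no_types, lifting) image_eqI image_subsetI subsetI subset_antisym)
    then show ?thesis
      using inv by (auto simp: linear_stabilizer_def invertible_def)
  qed
  then show "X \<in> aut_cone C"
    by (simp add: aut_cone_def lie_algebra_def mat_exp_eq_cexp)
next
  fix X assume "X \<in> aut_cone C"
  then have *: "cexp X (complex_of_real t) *v v \<in> C" if "v \<in> C" for t v
    using that by (auto simp: aut_cone_def lie_algebra_def mat_exp_eq_cexp linear_stabilizer_def)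
  have "poly_diff p v (X *v v) = 0" if p: "poly_fun p" "\<forall>a\<in>C. p a = 0" and v: "v \<in> C" for p v
  proof -
    have "((\<lambda>z. p (cexp X z *v v)) has_field_derivative poly_diff p v (X *v v)) (at 0)"
      using poly_fun_curve_derivative[OF p(1) cexp_vec_derivative, of X v 0] by simp
    \<comment> \<open>Only real times are known to preserve \<open>C\<close>; restriction to the
      real line leaves the derivative at 0 unchanged.\<close>
    then have "((\<lambda>t. p (cexp X (of_real t) *v v)) has_vector_derivative poly_diff p v (X *v v)) (at 0)"
      using has_vector_derivative_real_field[of "\<lambda>z. p (cexp X z *v v)" _ 0] by simp
    moreover have "(\<lambda>t. p (cexp X (of_real t) *v v)) = (\<lambda>t. 0)"
      using * p v by auto
    ultimately show ?thesis
      by (metis has_vector_derivative_const vector_derivative_unique_at)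
  qed
  then show "X \<in> inf_aut C"
    by (simp add: inf_aut_def)
qed

section \<open>Spaces of matrices\<close>

definition mat_unit :: "'m \<Rightarrow> 'n \<Rightarrow> complex^'n^'m" where
  "mat_unit a b = (\<chi> i j. if i = a \<and> j = b then 1 else 0)"

lemma span_mat_units: "cmat.span (range (\<lambda>(a, b). mat_unit a b)) = UNIV"
proof -
  have "X \<in> cmat.span (range (\<lambda>(a, b). mat_unit a b))" for X :: "complex^'n^'m"
  proof -
    have "X $ i $ j = (\<Sum>(a, b)\<in>UNIV. mat_scale (X $ a $ b) (mat_unit a b)) $ i $ j" for i j
    proof -
      have "(\<Sum>(a, b)\<in>UNIV. mat_scale (X $ a $ b) (mat_unit a b)) $ i $ j
          = (\<Sum>q\<in>UNIV. if q = (i, j) then X $ i $ j else 0)"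
        unfolding sum_component
        by (rule sum.cong) (auto simp: mat_scale_def mat_unit_def split: prod.splits)
      then show ?thesis by simp
    qed
    then have "X = (\<Sum>(a, b)\<in>UNIV. mat_scale (X $ a $ b) (mat_unit a b))"
      unfolding vec_eq_iff by blast
    also have "\<dots> \<in> cmat.span (range (\<lambda>(a, b). mat_unit a b))"
    proof (rule cmat.span_sum, clarify)
      show "mat_scale (X $ a $ b) (mat_unit a b) \<in> cmat.span (range (\<lambda>(a, b). mat_unit a b))" for a b
        by (rule cmat.span_scale, rule cmat.span_base) force
    qed
    finally show ?thesis .
  qed
  then show ?thesis by auto
qed

text \<open>Any basis will do; its finiteness is what opens the dimension theory for spaces of
  matrices.\<close>

definition cmat_basis :: "(complex^'n^'m) set" where
  "cmat_basis = cmat.extend_basis {}"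

interpretation cmat: finite_dimensional_vector_space "mat_scale :: complex \<Rightarrow> complex^'n^'m \<Rightarrow> _" cmat_basis
proof
  show ind: "cmat.independent (cmat_basis :: (complex^'n^'m) set)"
    unfolding cmat_basis_def by (rule cmat.independent_extend_basis) (rule cmat.independent_empty)
  show "cmat.span cmat_basis = (UNIV :: (complex^'n^'m) set)"
    unfolding cmat_basis_def by (rule cmat.span_extend_basis) (rule cmat.independent_empty)
  show "finite (cmat_basis :: (complex^'n^'m) set)"
    using cmat.independent_span_bound[OF _ ind, of "range (\<lambda>(a, b). mat_unit a b)"]
    by (simp add: span_mat_units)
qed

lemma mat_scale_nth [simp]: "mat_scale c X $ i $ j = c * X $ i $ j"
  by (simp add: mat_scale_def)

lemma mat_scale_mult_vec: "mat_scale c X *v v = c *s (X *v v)"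
  by (simp add: vec_eq_iff matrix_vector_mult_def sum_distrib_left mult.assoc)

lemma subspace_inf_aut: "cmat.subspace (inf_aut A)"
  unfolding cmat.subspace_def inf_aut_def
  by (auto simp: matrix_vector_mult_add_rdistrib poly_diff_add poly_diff_scale mat_scale_mult_vec
      linear_0[OF has_derivative_linear[OF poly_diff_has_derivative]])

section \<open>Linear changes of coordinates\<close>

lemma matrix_mult_add_left: "(X + Y) ** Z = X ** Z + Y ** (Z :: complex^'k^'n)"
  by (simp add: vec_eq_iff matrix_matrix_mult_def distrib_right sum.distrib)

lemma mat_scale_mult_left: "mat_scale c X ** Y = mat_scale c (X ** Y)"
  by (simp add: vec_eq_iff matrix_matrix_mult_def sum_distrib_left mult.assoc)

lemma mat_scale_mult_right: "X ** mat_scale c Y = mat_scale c (X ** Y)"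
  by (simp add: vec_eq_iff matrix_matrix_mult_def sum_distrib_left mult_ac)

lemma poly_diff_matrix_comp:
  fixes M :: "complex^'n^'m"
  assumes "poly_fun p"
  shows "poly_diff (\<lambda>v. p (M *v v)) a u = poly_diff p (M *v a) (M *v u)"
proof -
  have "((*v) M has_derivative (*v) M) (at a)"
    by (rule bounded_linear_imp_has_derivative) (rule matrix_vector_mul_bounded_linear)
  from diff_chain_at[OF this poly_diff_has_derivative[OF assms]]
  have "((\<lambda>v. p (M *v v)) has_derivative (\<lambda>u. poly_diff p (M *v a) (M *v u))) (at a)"
    by (simp add: o_def)
  from frechet_derivative_at[OF this] show ?thesis by metis
qed

text \<open>Polynomials vanishing on the image pull back along \<open>M\<close> to polynomials
  vanishing on \<open>A\<close>, and the chain rule intertwines the two vector fields.\<close>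

lemma inf_aut_conjugate:
  assumes "M ** N = mat 1" "N ** M = mat 1" "X \<in> inf_aut A"
  shows "M ** X ** N \<in> inf_aut ((*v) M ` A)"
proof -
  have "poly_diff p (M *v a) ((M ** X ** N) *v (M *v a)) = 0"
    if p: "poly_fun p" "\<forall>b\<in>(*v) M ` A. p b = 0" and a: "a \<in> A" for p a
  proof -
    have "(M ** X ** N) *v (M *v a) = M *v (X *v a)"
      using assms(2) by (metis matrix_mul_assoc matrix_mul_rid matrix_vector_mul_assoc)
    moreover have "poly_diff (\<lambda>v. p (M *v v)) a (X *v a) = 0"
      using assms(3) p a poly_fun_matrix_comp[OF p(1), of M] by (auto simp: inf_aut_def)
    ultimately show ?thesis
      by (simp add: poly_diff_matrix_comp[OF p(1)])
  qed
  then show ?thesis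
    by (auto simp: inf_aut_def)
qed

lemma inf_aut_matrix_image:
  fixes M :: "complex^'n^'m"
  assumes "M ** N = mat 1" "N ** M = mat 1"
  shows "inf_aut ((*v) M ` A) = (\<lambda>X. M ** X ** N) ` inf_aut A"
proof (intro equalityI subsetI)
  fix Y assume "Y \<in> inf_aut ((*v) M ` A)"
  then have "N ** Y ** M \<in> inf_aut ((*v) N ` (*v) M ` A)"
    by (rule inf_aut_conjugate[OF assms(2,1)])
  moreover have "(*v) N ` (*v) M ` A = A"
    by (simp add: image_image matrix_vector_mul_assoc assms)
  moreover have "Y = M ** (N ** Y ** M) ** N"
    using assms(1) by (metis matrix_mul_assoc matrix_mul_lid matrix_mul_rid)
  ultimately show "Y \<in> (\<lambda>X. M ** X ** N) ` inf_aut A"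
    by (metis image_eqI)
qed (use inf_aut_conjugate[OF assms] in auto)

lemma dim_inf_aut_matrix_image:
  fixes M :: "complex^'n^'m" and N :: "complex^'m^'n"
  assumes "M ** N = mat 1" "N ** M = mat 1"
  shows "cmat.dim (inf_aut ((*v) M ` A)) = cmat.dim (inf_aut A)"
proof -
  interpret pair: finite_dimensional_vector_space_pair
    "mat_scale :: complex \<Rightarrow> complex^'n^'n \<Rightarrow> _" cmat_basis
    "mat_scale :: complex \<Rightarrow> complex^'m^'m \<Rightarrow> _" cmat_basis ..
  have "Vector_Spaces.linear mat_scale mat_scale (\<lambda>X. M ** X ** N)"
    unfolding Vector_Spaces.linear_iff
    by (simp add: cmat.vector_space_axioms matrix_add_ldistrib matrix_mult_add_left mat_scale_mult_left mat_scale_mult_right)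
  moreover have "N ** (M ** X ** N) ** M = X" for X
  proof -
    have "N ** (M ** X ** N) ** M = (N ** M) ** X ** (N ** M)"
      by (simp only: matrix_mul_assoc)
    then show ?thesis
      by (simp add: assms)
  qed
  then have "inj_on (\<lambda>X. M ** X ** N) (cmat.span (inf_aut A))"
    by (intro inj_on_inverseI[where g = "\<lambda>Y. N ** Y ** M"])
  ultimately show ?thesis
    by (simp add: inf_aut_matrix_image[OF assms] pair.dim_image_eq)
qed


section \<open>The filtration of matrices by degree\<close>

text \<open>Entry \<open>(i, j)\<close> sends coordinate \<open>j\<close> to coordinate
  \<open>i\<close> and so shifts degree by \<open>d i - d j\<close>, which may be negative; hence
  matrices have integer degrees.\<close>

definition mat_part :: "('n \<Rightarrow> nat) \<Rightarrow> int \<Rightarrow> complex^'n^'n \<Rightarrow> complex^'n^'n" where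
  "mat_part d k X = (\<chi> i j. if int (d i) - int (d j) = k then X $ i $ j else 0)"

definition mat_fil :: "('n \<Rightarrow> nat) \<Rightarrow> int \<Rightarrow> (complex^'n^'n) set" where
  "mat_fil d k = {X. \<forall>i j. k < int (d i) - int (d j) \<longrightarrow> X $ i $ j = 0}"

lemma mat_part_nth [simp]:
  "mat_part d k X $ i $ j = (if int (d i) - int (d j) = k then X $ i $ j else 0)"
  by (simp add: mat_part_def)

lemma subspace_mat_fil: "cmat.subspace (mat_fil d k)"
  by (simp add: cmat.subspace_def mat_fil_def)

lemma subspace_image_mat_part:
  assumes "cmat.subspace G"
  shows "cmat.subspace (mat_part d k ` G)"
proof -
  have "0 = mat_part d k 0" "mat_part d k X + mat_part d k Y = mat_part d k (X + Y)"
    "mat_scale c (mat_part d k X) = mat_part d k (mat_scale c X)" for X Y c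
    by (simp_all add: vec_eq_iff)
  then show ?thesis
    using assms unfolding cmat.subspace_def by (auto intro!: image_eqI)
qed

lemma mat_fil_mono: "k \<le> l \<Longrightarrow> mat_fil d k \<subseteq> mat_fil d l"
  by (auto simp: mat_fil_def)

lemma mat_fil_minus_part: "X \<in> mat_fil d k \<Longrightarrow> X - mat_part d k X \<in> mat_fil d (k - 1)"
  by (auto simp: mat_fil_def)

text \<open>Rank-nullity for \<open>mat_part d k\<close>, whose kernel on step \<open>k\<close> of
  the filtration is step \<open>k - 1\<close>. The count comes from \<open>A + F = T + F\<close>
  with \<open>T \<inter> F\<close> trivial, by the dimension formula for sums applied to both
  sides.\<close>

lemma dim_mat_fil_step:
  assumes G: "cmat.subspace G"
  shows "cmat.dim (G \<inter> mat_fil d k) =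
    cmat.dim (G \<inter> mat_fil d (k - 1)) + cmat.dim (mat_part d k ` (G \<inter> mat_fil d k))"
proof -
  define A where "A = G \<inter> mat_fil d k"
  define T where "T = mat_part d k ` A"
  define F where "F = mat_fil d (k - 1)"
  have sub: "cmat.subspace A" "cmat.subspace T" "cmat.subspace F"
    unfolding A_def T_def F_def
    by (simp_all add: G subspace_mat_fil cmat.subspace_inter subspace_image_mat_part)
  have "{x + y |x y. x \<in> A \<and> y \<in> F} = {x + y |x y. x \<in> T \<and> y \<in> F}"
  proof (intro equalityI subsetI; clarify)
    fix x y assume "x \<in> A" "y \<in> F"
    then have "x - mat_part d k x + y \<in> F"
      unfolding A_def F_def
      by (intro cmat.subspace_add subspace_mat_fil mat_fil_minus_part) auto
    then show "\<exists>x' y'. x + y = x' + y' \<and> x' \<in> T \<and> y' \<in> F"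
      using \<open>x \<in> A\<close> unfolding T_def
      by (intro exI[of _ "mat_part d k x"] exI[of _ "x - mat_part d k x + y"]) auto
  next
    fix x y assume "x \<in> T" "y \<in> F"
    then obtain z where z: "x = mat_part d k z" "z \<in> A"
      by (auto simp: T_def)
    have "y - (z - mat_part d k z) \<in> F"
      using z \<open>y \<in> F\<close> unfolding A_def F_def
      by (intro cmat.subspace_diff subspace_mat_fil mat_fil_minus_part) auto
    then show "\<exists>x' y'. x + y = x' + y' \<and> x' \<in> A \<and> y' \<in> F"
      using z by (intro exI[of _ z] exI[of _ "y - (z - mat_part d k z)"]) auto
  qed
  moreover have "A \<inter> F = G \<inter> mat_fil d (k - 1)"
    using mat_fil_mono[of "k - 1" k d] by (auto simp: A_def F_def)
  moreover have "T \<inter> F \<subseteq> {0}"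
  proof (clarsimp simp: T_def F_def vec_eq_iff)
    fix X i j assume "mat_part d (int (d i) - int (d j)) X \<in> mat_fil d (int (d i) - int (d j) - 1)"
    then show "X $ i $ j = 0"
      by (auto simp: mat_fil_def dest: spec2[of _ i j])
  qed
  then have "cmat.dim (T \<inter> F) = 0"
    by (simp only: cmat.dim_eq_0)
  ultimately have "cmat.dim A = cmat.dim (G \<inter> mat_fil d (k - 1)) + cmat.dim T"
    using cmat.dim_sums_Int[OF sub(1,3)] cmat.dim_sums_Int[OF sub(2,3)] by (simp del: cmat.dim_eq_0)
  then show ?thesis
    by (simp add: A_def T_def)
qed

text \<open>The associated graded space of \<open>G\<close> lies in \<open>H\<close> and has the dimension of \<open>G\<close>.\<close>

lemma
  assumes G: "cmat.subspace G" and H: "cmat.subspace H"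
    and lead: "\<And>k X. X \<in> G \<Longrightarrow> X \<in> mat_fil d k \<Longrightarrow> mat_part d k X \<in> H"
  shows dim_le_of_leading_parts: "cmat.dim G \<le> cmat.dim H"
    and leading_parts_of_dim_eq: "cmat.dim G = cmat.dim H \<Longrightarrow> Y \<in> H \<Longrightarrow> Y \<in> mat_fil d k \<Longrightarrow>
      \<exists>X\<in>G \<inter> mat_fil d k. mat_part d k X = mat_part d k Y"
proof -
  define T where "T = (\<lambda>G k. mat_part d k ` (G \<inter> mat_fil d k))"
  \<comment> \<open>The excess of \<open>H\<close> over \<open>G\<close> up to degree
    \<open>k\<close>. It is 0 for very negative \<open>k\<close>, never decreases, and ends at the
    difference of the dimensions; if that is 0, it vanishes throughout and every graded piece of
    \<open>H\<close> is attained.\<close>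
  define \<delta> where "\<delta> = (\<lambda>k. int (cmat.dim (H \<inter> mat_fil d k)) - int (cmat.dim (G \<inter> mat_fil d k)))"
  define D where "D = int (Max (range d))"
  have D: "int (d i) \<le> D" for i
    by (simp add: D_def)
  have T: "T G k \<subseteq> T H k" for k
  proof
    fix Z assume "Z \<in> T G k"
    then obtain X where X: "X \<in> G" "X \<in> mat_fil d k" "Z = mat_part d k X"
      by (auto simp: T_def)
    \<comment> \<open>A leading part is homogeneous, hence its own leading part.\<close>
    have "Z = mat_part d k Z" "Z \<in> mat_fil d k" "Z \<in> H"
      using lead[OF X(1,2)] unfolding X(3) by (simp_all add: vec_eq_iff mat_fil_def)
    then show "Z \<in> T H k"
      unfolding T_def by blast
  qed
  have step: "\<delta> k = \<delta> (k - 1) + (int (cmat.dim (T H k)) - int (cmat.dim (T G k)))" for k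
    using dim_mat_fil_step[OF G, of d k] dim_mat_fil_step[OF H, of d k] by (simp add: \<delta>_def T_def)
  have mono1: "\<delta> (k - 1) \<le> \<delta> k" for k
    using step[of k] cmat.dim_subset[OF T[of k]] by linarith
  have mono: "\<delta> k \<le> \<delta> l" if "k \<le> l" for k l
    using that
  proof (induction l rule: int_ge_induct)
    case (step l)
    then show ?case
      using mono1[of "l + 1"] by simp
  qed simp
  have "mat_fil d k = {0}" if "k < - D" for k
  proof -
    have "k < int (d i) - int (d j)" for i j
      using D[of j] that by linarith
    then show ?thesis
      by (auto simp: mat_fil_def vec_eq_iff)
  qed
  note low = this
  have high: "mat_fil d k = UNIV" if "D \<le> k" for k
  proof -
    have "\<not> k < int (d i) - int (d j)" for i j
      using D[of i] that by linarith
    then show ?thesis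
      by (auto simp: mat_fil_def)
  qed
  have zero: "0 \<in> G" "0 \<in> H"
    using G H by (auto simp: cmat.subspace_0)
  have low0: "\<delta> k = 0" if "k < - D" for k
    using low[OF that] zero by (simp add: \<delta>_def Int_absorb1)
  have top: "\<delta> D = int (cmat.dim H) - int (cmat.dim G)"
    by (simp add: \<delta>_def high)
  have "0 \<le> D"
    by (simp add: D_def)
  show "cmat.dim G \<le> cmat.dim H"
    using mono[of "- D - 1" D] low0[of "- D - 1"] top \<open>0 \<le> D\<close> by linarith
  assume eq: "cmat.dim G = cmat.dim H" and Y: "Y \<in> H" "Y \<in> mat_fil d k"
  have \<delta>0: "\<delta> k = 0" for k
  proof -
    have "\<delta> D = 0" using eq top by simp
    have "\<delta> (min k (- D - 1)) \<le> \<delta> k" by (rule mono) simp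
    moreover have "\<delta> k \<le> \<delta> (max k D)" by (rule mono) simp
    moreover have "\<delta> (max k D) = \<delta> D"
      by (simp add: \<delta>_def high)
    moreover have "\<delta> (min k (- D - 1)) = 0"
      by (rule low0) simp
    ultimately show ?thesis using \<open>\<delta> D = 0\<close> by linarith
  qed
  have "cmat.dim (T H k) = cmat.dim (T G k)"
    using step[of k] \<delta>0[of k] \<delta>0[of "k - 1"] by linarith
  then have "T G k = T H k"
    by (intro cmat.subspace_dim_equal T)
      (simp_all add: T_def G H subspace_mat_fil cmat.subspace_inter subspace_image_mat_part)
  then have "mat_part d k Y \<in> T G k"
    using Y by (auto simp: T_def)
  then show "\<exists>X\<in>G \<inter> mat_fil d k. mat_part d k X = mat_part d k Y"
    by (auto simp: T_def)
qed

section \<open>Leading terms of holomorphic functions of several variables\<close>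

definition cdiff_on :: "(complex^'d) set \<Rightarrow> (complex^'d \<Rightarrow> complex) \<Rightarrow> bool" where
  "cdiff_on U f \<longleftrightarrow> open U \<and>
     (\<forall>w\<in>U. \<exists>D. (f has_derivative D) (at w) \<and> (\<forall>c h. D (c *s h) = c * D h))"

lemma continuous_on_smult [continuous_intros]:
  assumes "continuous_on S f" "continuous_on S g"
  shows "continuous_on S (\<lambda>x. f x *s (g x :: complex^'n))"
  unfolding vector_scalar_mult_def using assms by (auto intro!: continuous_intros)

lemma cdiff_on_line:
  assumes "cdiff_on U f" "a + t *s h \<in> U"
  shows "((\<lambda>t. f (a + t *s h)) has_field_derivative frechet_derivative f (at (a + t *s h)) h) (at t)"
proof -
  obtain D where D: "(f has_derivative D) (at (a + t *s h))" "\<And>c h. D (c *s h) = c * D h"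
    using assms by (auto simp: cdiff_on_def)
  have "((\<lambda>t. a + t *s h) has_derivative (\<lambda>c. c *s h)) (at t)"
    by (rule has_derivative_vec_complex) (auto intro!: derivative_eq_intros)
  from diff_chain_at[OF this D(1)] have "((\<lambda>t. f (a + t *s h)) has_derivative (\<lambda>c. c * D h)) (at t)"
    by (simp add: o_def D(2))
  then show ?thesis
    using frechet_derivative_at[OF D(1)]
    by (simp add: has_field_derivative_def mult_commute_abs)
qed

lemma dir_deriv_eq:
  assumes "cdiff_on U f" "w \<in> U"
  shows "dir_deriv h f w = frechet_derivative f (at w) h"
  using DERIV_imp_deriv[OF cdiff_on_line[OF assms(1), of w 0 h]] assms(2)
  by (simp add: dir_deriv_def)

lemma cdiff_on_continuous: "cdiff_on U f \<Longrightarrow> continuous_on U f"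
  unfolding cdiff_on_def
  by (meson continuous_at_imp_continuous_on has_derivative_continuous)

lemma dir_deriv_line: "dir_deriv w F (t *s w) = deriv (\<lambda>u. F (u *s w)) t"
  unfolding dir_deriv_def by (subst (2) deriv_shift_0) (simp add: o_def vec.scale_left_distrib)

text \<open>Repeated differentiation along the line through \<open>w\<close> is a one-variable
  matter, valid for any function because \<open>deriv\<close> is total.\<close>

lemma dir_deriv_replicate:
  "(dir_deriv w ^^ j) F (t *s w) = (deriv ^^ j) (\<lambda>u. F (u *s w)) t"
proof (induction j arbitrary: t)
  case (Suc j)
  show ?case
    by (simp add: dir_deriv_line Suc)
qed simp

text \<open>The derivative in direction \<open>h\<close> is on the line a uniform limit of difference quotients.\<close>

lemma dir_deriv_line_holomorphic:
  assumes f: "cdiff_on U f" and "0 \<in> U"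
  obtains e where "e > 0" "\<And>t. t \<in> ball 0 e \<Longrightarrow> t *s w \<in> U"
    "(\<lambda>t. dir_deriv h f (t *s w)) holomorphic_on ball 0 e"
proof -
  define y where "y = (\<lambda>q::complex \<times> complex. fst q *s w + snd q *s h)"
  have y_cont: "continuous_on S y" for S
    unfolding y_def by (auto intro!: continuous_intros)
  have "open (y -` U)"
    using f by (intro open_vimage y_cont) (simp add: cdiff_on_def)
  moreover have "(0, 0) \<in> y -` U"
    using \<open>0 \<in> U\<close> by (simp add: y_def)
  ultimately obtain \<epsilon> where \<epsilon>: "\<epsilon> > 0" "ball (0, 0) \<epsilon> \<subseteq> y -` U"
    using open_contains_ball_eq by blast
  \<comment> \<open>If \<open>t\<close> and \<open>s\<close> have norm at most \<open>e\<close>, the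
    pair has norm at most \<open>2 * e\<close>, which stays below \<open>\<epsilon>\<close>.\<close>
  define e where "e = \<epsilon> / 3"
  have e: "e > 0" using \<epsilon> by (simp add: e_def)
  have in_U: "t *s w + s *s h \<in> U" if "t \<in> cball 0 e" "s \<in> cball 0 e" for t s
  proof -
    have "norm (t, s) \<le> norm t + norm s"
      by (rule norm_Pair_le)
    then have "(t, s) \<in> ball (0, 0) \<epsilon>"
      using that \<epsilon>(1) by (simp add: e_def flip: zero_prod_def)
    then show ?thesis
      using \<epsilon>(2) by (auto simp: y_def)
  qed
  have "continuous_on (cball 0 e \<times> cball 0 e) (f \<circ> y)"
    by (intro continuous_on_compose y_cont continuous_on_subset[OF cdiff_on_continuous[OF f]])
      (auto simp: y_def in_U)
  then have "bounded ((f \<circ> y) ` (cball 0 e \<times> cball 0 e))"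
    by (intro compact_imp_bounded compact_continuous_image compact_Times compact_cball)
  then obtain B where B: "\<And>t s. t \<in> cball 0 e \<Longrightarrow> s \<in> cball 0 e \<Longrightarrow> norm (f (t *s w + s *s h)) < B"
    unfolding bounded_pos_less by (force simp: y_def)
  define F where "F = (\<lambda>t s. f (t *s w + s *s h))"
  define G where "G = (\<lambda>t. dir_deriv h f (t *s w))"
  \<comment> \<open>Cauchy's bound for the second derivative: discs of radius \<open>e / 2\<close>
    about points of \<open>ball 0 (e / 2)\<close> stay where \<open>F t\<close> is bounded by
    \<open>B\<close>. It does not depend on \<open>t\<close>, which makes the convergence below
    uniform.\<close>
  define C where "C = fact 2 * B / (e / 2)\<^sup>2"
  have F_der: "(F t has_field_derivative frechet_derivative f (at (t *s w + s *s h)) h) (at s)"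
    if "t \<in> cball 0 e" "s \<in> cball 0 e" for t s
    unfolding F_def by (rule cdiff_on_line[OF f in_U[OF that]])
  have F_hol: "F t holomorphic_on cball 0 e" if "t \<in> cball 0 e" for t
    using F_der[OF that] by (meson field_differentiable_at_within field_differentiable_def holomorphic_on_def)
  have F_hol': "(\<lambda>t. F t s) holomorphic_on cball 0 e" if "s \<in> cball 0 e" for s
  proof -
    have "((\<lambda>t. f (s *s h + t *s w)) has_field_derivative
        frechet_derivative f (at (s *s h + t *s w)) w) (at t)" if "t \<in> cball 0 e" for t
      by (rule cdiff_on_line[OF f]) (use in_U[OF that \<open>s \<in> cball 0 e\<close>] in \<open>simp add: add.commute\<close>)
    then show ?thesis
      unfolding F_def holomorphic_on_def field_differentiable_def add.commute[of "_ *s w"]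
      by (meson has_field_derivative_at_within)
  qed
  have G: "deriv (F t) 0 = G t" for t
    by (simp add: G_def F_def dir_deriv_def)
  have rem: "norm (F t s - F t 0 - G t * s) \<le> C * norm s ^ 2"
    if t: "t \<in> cball 0 e" and s: "s \<in> ball 0 (e / 2)" for t s
  proof -
    have hol: "F t holomorphic_on ball 0 e"
      using F_hol[OF t] holomorphic_on_subset ball_subset_cball by blast
    have bd: "norm ((deriv ^^ 2) (F t) z) \<le> C" if z: "z \<in> ball 0 (e / 2)" for z
      unfolding C_def
    proof (rule Cauchy_higher_deriv_bound)
      have sub: "cball z (e / 2) \<subseteq> cball 0 e"
        using z cball_subset_cball_iff[of z "e / 2" 0 e] by (simp add: dist_norm)
      then show "continuous_on (cball z (e / 2)) (F t)" "F t holomorphic_on ball z (e / 2)"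
        using F_hol[OF t] holomorphic_on_subset holomorphic_on_imp_continuous_on
          ball_subset_cball by (metis, metis (no_types, lifting) subset_trans)
      show "F t u \<in> ball 0 B" if "u \<in> ball z (e / 2)" for u
      proof -
        have "u \<in> cball 0 e"
          using sub that ball_subset_cball by blast
        then show ?thesis
          using B[OF t, of u] unfolding F_def by simp
      qed
    qed (use e in auto)
    have "norm ((deriv ^^ 0) (F t) s - (\<Sum>i\<le>1. (deriv ^^ i) (F t) 0 * (s - 0) ^ i / fact i))
        \<le> C * norm (s - 0) ^ Suc 1 / fact 1"
    proof (rule complex_Taylor[of "ball 0 (e / 2)"])
      show "((deriv ^^ i) (F t) has_field_derivative (deriv ^^ Suc i) (F t) x) (at x within ball 0 (e / 2))"
        if "x \<in> ball 0 (e / 2)" for i x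
      proof -
        have "(deriv ^^ i) (F t) holomorphic_on ball 0 e"
          by (intro holomorphic_higher_deriv hol) simp
        then show ?thesis
          using that e holomorphic_derivI[of "(deriv ^^ i) (F t)" "ball 0 e" x]
          by (simp add: has_field_derivative_at_within)
      qed
      show "cmod ((deriv ^^ Suc 1) (F t) x) \<le> C" if "x \<in> ball 0 (e / 2)" for x
        using bd[OF that] by (simp add: numeral_2_eq_2)
    qed (use e s in auto)
    then show ?thesis
      by (simp add: G power2_eq_square diff_diff_eq)
  qed
  have "uniform_limit (cball 0 e) (\<lambda>s t. (F t s - F t 0) / s) G (at 0)"
  proof (rule uniform_limitI)
    fix \<eta> :: real assume "\<eta> > 0"
    have "((\<lambda>s::complex. C * norm s) \<longlongrightarrow> C * norm (0::complex)) (at 0)"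
      by (intro tendsto_intros)
    then have "\<forall>\<^sub>F s in at 0. C * norm (s::complex) < \<eta>"
      using \<open>\<eta> > 0\<close> by (simp add: order_tendstoD(2))
    moreover have "\<forall>\<^sub>F s in at 0. s \<in> ball (0::complex) (e / 2) \<and> s \<noteq> 0"
      using e by (intro eventually_conj eventually_at_in_open' eventually_neq_at_within) auto
    ultimately show "\<forall>\<^sub>F s in at 0. \<forall>t\<in>cball 0 e. dist ((F t s - F t 0) / s) (G t) < \<eta>"
    proof eventually_elim
      case (elim s)
      show ?case
      proof
        fix t :: complex assume t: "t \<in> cball 0 e"
        have "dist ((F t s - F t 0) / s) (G t) = norm ((F t s - F t 0 - G t * s) / s)"
          using elim by (simp add: dist_norm diff_divide_distrib)
        also have "\<dots> \<le> C * norm s ^ 2 / norm s"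
          using rem[OF t] elim by (simp add: norm_divide divide_right_mono)
        also have "\<dots> < \<eta>"
          using elim by (simp add: power2_eq_square)
        finally show "dist ((F t s - F t 0) / s) (G t) < \<eta>" .
      qed
    qed
  qed
  moreover have "\<forall>\<^sub>F s in at 0. continuous_on (cball 0 e) (\<lambda>t. (F t s - F t 0) / s) \<and>
      (\<lambda>t. (F t s - F t 0) / s) holomorphic_on ball 0 e"
  proof -
    have "\<forall>\<^sub>F s in at 0. s \<in> ball (0::complex) e \<and> s \<noteq> 0"
      using e by (intro eventually_conj eventually_at_in_open' eventually_neq_at_within) auto
    then show ?thesis
    proof eventually_elim
      case (elim s)
      then have "(\<lambda>t. (F t s - F t 0) / s) holomorphic_on cball 0 e"
        using e by (intro holomorphic_intros F_hol') auto
      then show ?case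
        by (metis ball_subset_cball holomorphic_on_imp_continuous_on holomorphic_on_subset)
    qed
  qed
  ultimately have "G holomorphic_on ball 0 e"
    by (elim holomorphic_uniform_limit[rotated]) auto
  moreover have "t *s w \<in> U" if "t \<in> ball 0 e" for t
    using in_U[of t 0] that e by simp
  ultimately show thesis
    using that e unfolding G_def by blast
qed

lemma leading_coefficient_limit:
  fixes f :: "complex \<Rightarrow> complex"
  assumes "f holomorphic_on ball 0 e" "e > 0" "\<And>j. j < k \<Longrightarrow> (deriv ^^ j) f 0 = 0"
  shows "((\<lambda>t. f t / t ^ k) \<longlongrightarrow> (deriv ^^ k) f 0 / fact k) (at 0)"
proof -
  define a where "a = (\<lambda>n. (deriv ^^ n) f 0 / fact n)"
  have "((\<lambda>t. f t / t ^ k) \<longlongrightarrow> a (0 + k)) (at 0)"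
  proof (rule powser_limit_0_strong[OF assms(2), of "\<lambda>n. a (n + k)"])
    fix t :: complex assume t: "t \<noteq> 0" "norm t < e"
    have "(\<lambda>n. a n * t ^ n) sums f t"
      using holomorphic_power_series[OF assms(1), of t] t by (simp add: a_def)
    then have "(\<lambda>n. a (n + k) * t ^ (n + k)) sums f t"
      using assms(3) by (subst sums_iff_shift) (simp add: a_def)
    then have "(\<lambda>n. a (n + k) * t ^ (n + k) / t ^ k) sums (f t / t ^ k)"
      by (rule sums_divide)
    then show "(\<lambda>n. a (n + k) * t ^ n) sums (f t / t ^ k)"
      using t by (simp add: power_add)
  qed
  then show ?thesis
    by (simp add: a_def)
qed

text \<open>Both limits concern functions of one variable, the restrictions of \<open>f\<close> and
  of its derivative in direction \<open>h\<close> to the line through \<open>w\<close>. In the list,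
  \<open>h\<close> comes last since \<open>foldr\<close> differentiates by the last entry first. The
  extra \<open>t\<close> raises the vanishing order \<open>k - 1\<close> of the derivative to
  \<open>k\<close>, and for \<open>k = 0\<close> it forces the limit 0.\<close>

lemma
  assumes f: "cdiff_on U f" "0 \<in> U" and van: "\<And>hs. length hs < k \<Longrightarrow> derivs_at_0 f hs = 0"
  shows leading_term_limit:
    "((\<lambda>t. f (t *s w) / t ^ k) \<longlongrightarrow> derivs_at_0 f (replicate k w) / fact k) (at 0)"
  and leading_term_derivative_limit:
    "((\<lambda>t. t * dir_deriv h f (t *s w) / t ^ k) \<longlongrightarrow>
        (if k = 0 then 0 else derivs_at_0 f (replicate (k - 1) w @ [h]) / fact (k - 1))) (at 0)"
proof -
  obtain e where e: "e > 0" "\<And>t. t \<in> ball 0 e \<Longrightarrow> t *s w \<in> U"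
    "(\<lambda>t. dir_deriv h f (t *s w)) holomorphic_on ball 0 e"
    using dir_deriv_line_holomorphic[OF f] by metis
  have d1: "(deriv ^^ j) (\<lambda>t. f (t *s w)) 0 = derivs_at_0 f (replicate j w)" for j
    using dir_deriv_replicate[of j w f 0] by (simp add: derivs_at_0_def)
  have d2: "(deriv ^^ j) (\<lambda>t. dir_deriv h f (t *s w)) 0 = derivs_at_0 f (replicate j w @ [h])" for j
    using dir_deriv_replicate[of j w "dir_deriv h f" 0] by (simp add: derivs_at_0_def)
  have "((\<lambda>t. f (t *s w)) has_field_derivative frechet_derivative f (at (t *s w)) w) (at t)"
    if "t \<in> ball 0 e" for t
    using cdiff_on_line[OF f(1), of 0 t w] e(2)[OF that] by simp
  then have "(\<lambda>t. f (t *s w)) holomorphic_on ball 0 e"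
    by (meson field_differentiable_at_within field_differentiable_def holomorphic_on_def)
  from leading_coefficient_limit[OF this e(1), of k]
  show "((\<lambda>t. f (t *s w) / t ^ k) \<longlongrightarrow> derivs_at_0 f (replicate k w) / fact k) (at 0)"
    by (simp add: d1 van)
  show "((\<lambda>t. t * dir_deriv h f (t *s w) / t ^ k) \<longlongrightarrow>
        (if k = 0 then 0 else derivs_at_0 f (replicate (k - 1) w @ [h]) / fact (k - 1))) (at 0)"
  proof (cases k)
    case 0
    have "isCont (\<lambda>t. dir_deriv h f (t *s w)) 0"
      using holomorphic_on_imp_continuous_on[OF e(3)] e(1)
      by (simp add: continuous_on_eq_continuous_at)
    then have "isCont (\<lambda>t. t * dir_deriv h f (t *s w)) 0"
      by (intro continuous_intros)
    then show ?thesis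
      by (simp add: 0 isCont_def)
  next
    case (Suc m)
    have "((\<lambda>t. dir_deriv h f (t *s w) / t ^ m) \<longlongrightarrow> derivs_at_0 f (replicate m w @ [h]) / fact m) (at 0)"
      using leading_coefficient_limit[OF e(3,1), of m] by (simp add: d2 van Suc)
    moreover have "\<forall>\<^sub>F t in at 0. dir_deriv h f (t *s w) / t ^ m = t * dir_deriv h f (t *s w) / t ^ k"
      unfolding eventually_at_filter by (simp add: Suc)
    ultimately show ?thesis
      by (simp add: Suc cong: filterlim_cong)
        (use tendsto_cong in \<open>force simp: Suc\<close>)
  qed
qed


section \<open>Symmetric forms\<close>

lemma sym_form_mset: "s \<in> sym_forms k \<Longrightarrow> mset us = mset vs \<Longrightarrow> s us = s vs"
  unfolding sym_forms_def by blast

lemma sym_form_length: "s \<in> sym_forms k \<Longrightarrow> length us \<noteq> k \<Longrightarrow> s us = 0"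
  unfolding sym_forms_def by blast

lemma sym_form_linear: "s \<in> sym_forms k \<Longrightarrow> Suc (length us) = k \<Longrightarrow> linear_form (\<lambda>w. s (w # us))"
  unfolding sym_forms_def by blast

lemma
  assumes "s \<in> sym_forms k" "Suc (length us) = k"
  shows sym_form_add: "s ((u + v) # us) = s (u # us) + s (v # us)"
    and sym_form_scale: "s (c *s v # us) = c * s (v # us)"
proof -
  interpret Vector_Spaces.linear "(*s)" "(*)" "\<lambda>w. s (w # us)"
    by (rule sym_form_linear[OF assms])
  show "s ((u + v) # us) = s (u # us) + s (v # us)" "s (c *s v # us) = c * s (v # us)"
    by (rule add, rule scale)
qed

lemma contract_sym_forms:
  assumes "s \<in> sym_forms (Suc k)"
  shows "contract h s \<in> sym_forms k"
  unfolding sym_forms_def mem_Collect_eq contract_def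
proof (intro conjI allI impI)
  fix us :: "(complex^'a) list" assume us: "Suc (length us) = k"
  have "(\<lambda>w. s (h # w # us)) = (\<lambda>w. s (w # h # us))"
    by (rule ext, rule sym_form_mset[OF assms]) simp
  moreover have "linear_form (\<lambda>w. s (w # h # us))"
    by (rule sym_form_linear[OF assms]) (simp add: us)
  ultimately show "linear_form (\<lambda>w. s (h # w # us))"
    by simp
next
  fix us vs :: "(complex^'a) list" assume "mset us = mset vs"
  then show "s (h # us) = s (h # vs)"
    by (intro sym_form_mset[OF assms]) simp
qed (use sym_form_length[OF assms] in simp)

lemma sym_form_replicate_scale:
  assumes "s \<in> sym_forms k" "j + length us = k"
  shows "s (replicate j (c *s v) @ us) = c ^ j * s (replicate j v @ us)"
  using assms(2)
proof (induction j arbitrary: us)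
  case (Suc j)
  have "s (replicate (Suc j) (c *s v) @ us) = c * s (v # replicate j (c *s v) @ us)"
    using sym_form_scale[OF assms(1)] Suc.prems by simp
  also have "s (v # replicate j (c *s v) @ us) = s (replicate j (c *s v) @ v # us)"
    by (rule sym_form_mset[OF assms(1)]) simp
  also have "\<dots> = c ^ j * s (replicate j v @ v # us)"
    using Suc by simp
  also have "s (replicate j v @ v # us) = s (replicate (Suc j) v @ us)"
    by (rule sym_form_mset[OF assms(1)]) simp
  finally show ?case by simp
qed simp

lemma sym_form_power_derivative:
  assumes s: "s \<in> sym_forms k"
  shows "((\<lambda>z. s (replicate k (w + z *s h))) has_field_derivative
           of_nat k * s (h # replicate (k - 1) (w + z *s h))) (at z)"
proof -
  \<comment> \<open>Strengthened by a fixed tail \<open>us\<close>: each induction step splits one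
    factor into \<open>w\<close> and \<open>z *s h\<close> and moves the constant vector to the
    tail.\<close>
  have "((\<lambda>z. s (replicate j (w + z *s h) @ us)) has_field_derivative
      of_nat j * s (h # replicate (j - 1) (w + z *s h) @ us)) (at z)"
    if "j + length us = k" for j us
    using that
  proof (induction j arbitrary: us)
    case (Suc j)
    define y where "y = (\<lambda>z. w + z *s h)"
    have perm: "s (v # replicate i u @ us) = s (replicate i u @ v # us)" for u v i
      by (rule sym_form_mset[OF s]) simp
    have split: "s (y z # vs) = s (w # vs) + z * s (h # vs)" if "Suc (length vs) = k" for vs z
      using that by (simp add: y_def sym_form_add[OF s] sym_form_scale[OF s])
    have "(\<lambda>z. s (replicate (Suc j) (y z) @ us)) =
        (\<lambda>z. s (replicate j (y z) @ w # us) + z * s (replicate j (y z) @ h # us))"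
    proof
      fix z
      have "s (y z # replicate j (y z) @ us) =
          s (w # replicate j (y z) @ us) + z * s (h # replicate j (y z) @ us)"
        using Suc.prems by (intro split) simp
      then show "s (replicate (Suc j) (y z) @ us) =
          s (replicate j (y z) @ w # us) + z * s (replicate j (y z) @ h # us)"
        by (simp only: replicate_Suc append_Cons perm)
    qed
    moreover have "((\<lambda>z. s (replicate j (y z) @ w # us) + z * s (replicate j (y z) @ h # us))
        has_field_derivative of_nat j * s (h # replicate (j - 1) (y z) @ w # us)
          + (z * (of_nat j * s (h # replicate (j - 1) (y z) @ h # us)) + s (replicate j (y z) @ h # us))) (at z)"
      unfolding y_def using Suc.prems
      by (auto intro!: derivative_eq_intros Suc.IH)
    moreover have "of_nat j * s (h # replicate (j - 1) (y z) @ w # us)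
          + (z * (of_nat j * s (h # replicate (j - 1) (y z) @ h # us)) + s (replicate j (y z) @ h # us))
        = of_nat (Suc j) * s (h # replicate j (y z) @ us)"
    proof (cases j)
      case (Suc i)
      define Q where "Q = s (h # replicate j (y z) @ us)"
      have 1: "s (h # replicate (j - 1) (y z) @ v # us) = s (v # h # replicate i (y z) @ us)" for v
        by (rule sym_form_mset[OF s]) (simp add: Suc)
      have 2: "s (replicate j (y z) @ h # us) = Q"
        unfolding Q_def by (rule sym_form_mset[OF s]) simp
      have "Q = s (y z # h # replicate i (y z) @ us)"
        unfolding Q_def by (rule sym_form_mset[OF s]) (simp add: Suc)
      also have "\<dots> = s (w # h # replicate i (y z) @ us) + z * s (h # h # replicate i (y z) @ us)"
        using Suc.prems Suc by (intro split) simp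
      finally have "of_nat j * Q = of_nat j * s (w # h # replicate i (y z) @ us) +
          z * (of_nat j * s (h # h # replicate i (y z) @ us))"
        by (simp add: algebra_simps)
      then show ?thesis
        unfolding 1 2 Q_def[symmetric] by (simp add: algebra_simps)
    qed simp
    ultimately show ?case
      by (simp add: y_def)
  qed (simp add: DERIV_const)
  from this[of k "[]"] show ?thesis
    by simp
qed

text \<open>Polarization by differentiation: the derivative of the vanishing diagonal in direction
  \<open>h\<close> is a multiple of the diagonal of \<open>contract h s\<close>, which has one
  argument fewer.\<close>

lemma sym_form_eq_0:
  assumes "s \<in> sym_forms k" "\<And>w. s (replicate k w) = 0"
  shows "s = (\<lambda>_. 0)"
  using assms
proof (induction k arbitrary: s)
  case 0
  then have "s us = 0" for us
    by (cases us) (use sym_form_length in force)+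
  then show ?case
    by blast
next
  case (Suc k)
  have "contract h s = (\<lambda>_. 0)" for h
  proof (rule Suc.IH[OF contract_sym_forms[OF Suc.prems(1)]])
    fix w
    have "((\<lambda>z. s (replicate (Suc k) (w + z *s h))) has_field_derivative
        of_nat (Suc k) * s (h # replicate k (w + 0 *s h))) (at 0)"
      using sym_form_power_derivative[OF Suc.prems(1), of w h 0] by simp
    moreover have "(\<lambda>z. s (replicate (Suc k) (w + z *s h))) = (\<lambda>z. 0)"
      using Suc.prems(2) by simp
    ultimately have "of_nat (Suc k) * s (h # replicate k (w + 0 *s h)) = 0"
      by (metis DERIV_const DERIV_unique)
    then show "contract h s (replicate k w) = 0"
      by (simp add: contract_def del: of_nat_Suc)
  qed
  then have "s (h # us) = 0" for h us
    by (metis contract_def)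
  moreover have "s [] = 0"
    by (rule sym_form_length[OF Suc.prems(1)]) simp
  ultimately show ?case
    by (metis (no_types, opaque_lifting) list.exhaust)
qed

section \<open>Limits of vectors in the ranges of injective linear maps\<close>

lemma closed_range_linear:
  fixes L :: "'a::euclidean_space \<Rightarrow> 'b::euclidean_space"
  assumes "linear L"
  shows "closed (range L)"
  using linear_subspace_image[OF assms subspace_UNIV] by (rule closed_subspace)

text \<open>The sequence \<open>q\<close> comes without a velocity of its own. Injectivity of
  \<open>L\<close> bounds \<open>n (q n - q0)\<close> by the bounded difference quotients of
  \<open>F\<close>, so \<open>n\<close> times the linearization error tends to 0, and the closed
  range of \<open>L\<close> contains the limit.\<close>

lemma tangent_vector_in_range:
  fixes F :: "'a::euclidean_space \<Rightarrow> 'b::euclidean_space"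
  assumes F: "(F has_derivative L) (at q0)" and "inj L"
    and q: "q \<longlonglongrightarrow> q0" and v: "(\<lambda>n. real n *\<^sub>R (F (q n) - F q0)) \<longlonglongrightarrow> v"
  shows "v \<in> range L"
proof -
  have L: "linear L"
    using F by (rule has_derivative_linear)
  obtain m where m: "m > 0" "\<And>x. m * norm x \<le> norm (L x)"
    using linear_inj_bounded_below_pos[OF L \<open>inj L\<close>] by metis
  obtain K where K: "K > 0" "\<And>n. norm (real n *\<^sub>R (F (q n) - F q0)) \<le> K"
    using convergent_imp_bounded[OF v] unfolding bounded_pos by auto
  have err: "\<forall>\<^sub>F n in sequentially. norm (F (q n) - F q0 - L (q n - q0)) \<le> e * norm (q n - q0)"
    if "e > 0" for e
  proof -
    obtain \<delta> where "\<delta> > 0"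
      "\<And>y. norm (y - q0) < \<delta> \<Longrightarrow> norm (F y - F q0 - L (y - q0)) \<le> e * norm (y - q0)"
      using F \<open>e > 0\<close> unfolding has_derivative_at_alt by blast
    then show ?thesis
      using tendstoD[OF q \<open>\<delta> > 0\<close>] by (auto simp: dist_norm elim!: eventually_mono)
  qed
  \<comment> \<open>With tolerance \<open>m / 2\<close> the linearization error is absorbed by half
    of the lower bound \<open>m\<close>.\<close>
  have bound: "\<forall>\<^sub>F n in sequentially. norm (real n *\<^sub>R (q n - q0)) \<le> 2 * K / m"
    using err[OF half_gt_zero[OF m(1)]]
  proof eventually_elim
    case (elim n)
    have "m * norm (q n - q0) \<le> norm (L (q n - q0))"
      by (rule m)
    also have "\<dots> \<le> norm (F (q n) - F q0) + norm (F (q n) - F q0 - L (q n - q0))"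
      using norm_triangle_ineq4[of "F (q n) - F q0" "F (q n) - F q0 - L (q n - q0)"] by simp
    also have "\<dots> \<le> norm (F (q n) - F q0) + m / 2 * norm (q n - q0)"
      using elim m(1) by simp
    finally have "m * norm (q n - q0) \<le> 2 * norm (F (q n) - F q0)"
      by simp
    then have "m * (n * norm (q n - q0)) \<le> 2 * (n * norm (F (q n) - F q0))"
      using mult_left_mono[of "m * norm (q n - q0)" "2 * norm (F (q n) - F q0)" "real n"] by (simp add: mult_ac)
    also have "\<dots> \<le> 2 * K"
      using K(2)[of n] by simp
    finally have "real n * norm (q n - q0) \<le> 2 * K / m"
      using m(1) by (simp add: field_simps)
    then show ?case by simp
  qed
  have "(\<lambda>n. real n *\<^sub>R (F (q n) - F q0) - L (real n *\<^sub>R (q n - q0))) \<longlonglongrightarrow> 0"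
  proof (rule tendstoI)
    fix e :: real assume "e > 0"
    define e' where "e' = e / (2 * (2 * K / m))"
    have "e' > 0"
      using \<open>e > 0\<close> K m by (simp add: e'_def)
    show "\<forall>\<^sub>F n in sequentially.
        dist (real n *\<^sub>R (F (q n) - F q0) - L (real n *\<^sub>R (q n - q0))) 0 < e"
      using err[OF \<open>e' > 0\<close>] bound
    proof eventually_elim
      case (elim n)
      have "norm (real n *\<^sub>R (F (q n) - F q0) - L (real n *\<^sub>R (q n - q0)))
          = real n * norm (F (q n) - F q0 - L (q n - q0))"
        by (simp only: linear_scale[OF L] scaleR_right_diff_distrib[symmetric] norm_scaleR abs_of_nat)
      also have "\<dots> \<le> real n * (e' * norm (q n - q0))"
        by (intro mult_left_mono elim) (use \<open>e' > 0\<close> in auto)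
      also have "\<dots> = e' * norm (real n *\<^sub>R (q n - q0))"
        by (simp only: norm_scaleR abs_of_nat mult.left_commute)
      also have "\<dots> \<le> e' * (2 * K / m)"
        using elim \<open>e' > 0\<close> by (intro mult_left_mono) auto
      also have "\<dots> = e / 2"
        using K m by (simp add: e'_def)
      also have "\<dots> < e"
        using \<open>e > 0\<close> by simp
      finally show ?case
        by (simp only: dist_norm diff_zero)
    qed
  qed
  from tendsto_diff[OF v this] have "(\<lambda>n. L (real n *\<^sub>R (q n - q0))) \<longlonglongrightarrow> v"
    by simp
  then show ?thesis
    by (intro Lim_in_closed_set[OF closed_range_linear[OF L]]) auto
qed

text \<open>If the limit map had a kernel, ranges could collapse while the coefficients
  \<open>c t\<close> escape to infinity. The lower bound for the injective \<open>L\<close> keeps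
  them bounded, since pointwise convergence in finite dimension is convergence of operators.\<close>

lemma limit_in_range:
  fixes M :: "'t \<Rightarrow> 'a::euclidean_space \<Rightarrow> 'b::euclidean_space"
  assumes M: "\<forall>\<^sub>F t in F. linear (M t)" and L: "linear L" "inj L"
    and conv: "\<And>x. ((\<lambda>t. M t x) \<longlongrightarrow> L x) F"
    and v: "((\<lambda>t. M t (c t)) \<longlongrightarrow> v) F" and F: "F \<noteq> bot"
  shows "v \<in> range L"
proof -
  \<comment> \<open>A bound for the operator norm of \<open>M t - L\<close>, tending to 0 because it
    is a finite sum over the basis.\<close>
  define \<epsilon> where "\<epsilon> = (\<lambda>t. \<Sum>b\<in>Basis. norm (M t b - L b))"
  obtain m where m: "m > 0" "\<And>x. m * norm x \<le> norm (L x)"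
    using linear_inj_bounded_below_pos[OF L] by metis
  have "(\<epsilon> \<longlongrightarrow> (\<Sum>b\<in>Basis. norm (L b - L b))) F"
    unfolding \<epsilon>_def by (intro tendsto_intros conv)
  then have \<epsilon>0: "(\<epsilon> \<longlongrightarrow> 0) F"
    by simp
  have err: "norm (M t x - L x) \<le> \<epsilon> t * norm x" if "linear (M t)" for t x
  proof -
    have lin: "linear (\<lambda>x. M t x - L x)"
      by (rule linear_compose_sub[OF that L(1)])
    have "M t x - L x = (\<Sum>b\<in>Basis. (x \<bullet> b) *\<^sub>R (M t b - L b))"
      using linear_sum[OF lin] linear_scale[OF lin] euclidean_representation[of x]
      by (metis (no_types, lifting) sum.cong)
    also have "norm \<dots> \<le> (\<Sum>b\<in>Basis. norm x * norm (M t b - L b))"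
      by (intro norm_sum[THEN order_trans] sum_mono) (simp add: Basis_le_norm mult_right_mono)
    finally show ?thesis
      by (simp add: \<epsilon>_def sum_distrib_left mult.commute)
  qed
  have "\<forall>\<^sub>F t in F. norm (M t (c t)) < norm v + 1"
    using tendsto_norm[OF v] by (rule order_tendstoD) simp
  moreover have "\<forall>\<^sub>F t in F. \<epsilon> t < m / 2"
    using \<epsilon>0 m(1) by (intro order_tendstoD) auto
  ultimately have bd: "\<forall>\<^sub>F t in F. norm (M t (c t) - L (c t)) \<le> \<epsilon> t * (2 * (norm v + 1) / m)"
    using M
  proof eventually_elim
    case (elim t)
    have "m * norm (c t) \<le> norm (L (c t))"
      by (rule m)
    also have "\<dots> \<le> norm (M t (c t)) + norm (M t (c t) - L (c t))"
      using norm_triangle_ineq4[of "M t (c t)" "M t (c t) - L (c t)"] by simp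
    also have "\<dots> \<le> (norm v + 1) + m / 2 * norm (c t)"
      using err[OF elim(3), of "c t"] elim(1,2) mult_right_mono[of "\<epsilon> t" "m / 2" "norm (c t)"] by simp
    finally have "norm (c t) \<le> 2 * (norm v + 1) / m"
      using m(1) by (simp add: field_simps)
    moreover have "0 \<le> \<epsilon> t"
      unfolding \<epsilon>_def by (simp add: sum_nonneg)
    ultimately show ?case
      using err[OF elim(3), of "c t"] mult_left_mono[of "norm (c t)" _ "\<epsilon> t"] by fastforce
  qed
  have "((\<lambda>t. M t (c t) - L (c t)) \<longlongrightarrow> 0) F"
    by (rule Lim_null_comparison[OF bd tendsto_mult_left_zero[OF \<epsilon>0]])
  from tendsto_diff[OF v this] have "((\<lambda>t. L (c t)) \<longlongrightarrow> v) F"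
    by simp
  then show ?thesis
    by (intro Lim_in_closed_set[OF closed_range_linear[OF L(1)] _ F]) auto
qed


section \<open>Graded rescaling\<close>

text \<open>Entry \<open>(i, j)\<close> contributes with the factor
  \<open>t ^ (k - d i + d j)\<close>. Membership in \<open>mat_fil d k\<close> makes the exponent
  nonnegative for nonzero entries, and it is 0 exactly for those kept by
  \<open>mat_part d k\<close>.\<close>

lemma mat_fil_limit:
  fixes f :: "complex \<Rightarrow> complex^'n"
  assumes X: "X \<in> mat_fil d k" and f: "\<And>j. ((\<lambda>t. f t $ j / t ^ d j) \<longlongrightarrow> L $ j) (at 0)"
  shows "((\<lambda>t. t powi k * (X *v f t) $ i / t ^ d i) \<longlongrightarrow> (mat_part d k X *v L) $ i) (at 0)"
proof -
  have lim: "((\<lambda>t. t powi k * (X $ i $ j * f t $ j) / t ^ d i) \<longlongrightarrow> mat_part d k X $ i $ j * L $ j) (at 0)" for j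
  proof (cases "X $ i $ j = 0")
    case False
    then have "int (d i) - int (d j) \<le> k"
      using X by (auto simp: mat_fil_def not_less[symmetric])
    then obtain e where e: "k = int (d i) - int (d j) + int e"
      by (metis add.commute diff_add_cancel zle_iff_zadd)
    have "((\<lambda>t::complex. t ^ e) \<longlongrightarrow> 0 ^ e) (at 0)"
      by (intro tendsto_intros)
    then have "((\<lambda>t. X $ i $ j * (t ^ e * (f t $ j / t ^ d j))) \<longlongrightarrow> X $ i $ j * (0 ^ e * L $ j)) (at 0)"
      by (intro tendsto_intros f)
    moreover have "X $ i $ j * (0 ^ e * L $ j) = mat_part d k X $ i $ j * L $ j"
      by (simp add: e power_0_left)
    ultimately have "((\<lambda>t. X $ i $ j * (t ^ e * (f t $ j / t ^ d j))) \<longlongrightarrow>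
        mat_part d k X $ i $ j * L $ j) (at 0)"
      by (simp only:)
    moreover have "\<forall>\<^sub>F t in at 0. X $ i $ j * (t ^ e * (f t $ j / t ^ d j)) =
        t powi k * (X $ i $ j * f t $ j) / t ^ d i"
      unfolding eventually_at_filter
    proof (intro always_eventually allI impI)
      fix t :: complex assume t: "t \<noteq> 0"
      have "t powi k = t ^ d i / t ^ d j * t ^ e"
        using t by (simp add: e power_int_add power_int_diff)
      then show "X $ i $ j * (t ^ e * (f t $ j / t ^ d j)) = t powi k * (X $ i $ j * f t $ j) / t ^ d i"
        using t by (simp add: field_simps)
    qed
    ultimately show ?thesis
      by (rule Lim_transform_eventually)
  qed simp
  have "((\<lambda>t. \<Sum>j\<in>UNIV. t powi k * (X $ i $ j * f t $ j) / t ^ d i) \<longlongrightarrow>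
      (\<Sum>j\<in>UNIV. mat_part d k X $ i $ j * L $ j)) (at 0)"
    by (intro tendsto_sum lim)
  then show ?thesis
    by (simp add: matrix_vector_mult_def sum_distrib_left sum_divide_distrib del: mat_part_nth)
qed

text \<open>The grading element: its commutator with a matrix of pure degree \<open>k\<close> is
  \<open>k\<close> times that matrix, and it generates the scalings \<open>rescale\<close>.\<close>

definition degree_mat :: "('n \<Rightarrow> nat) \<Rightarrow> complex^'n^'n" where
  "degree_mat d = (\<chi> i j. if i = j then of_nat (d i) else 0)"

lemma degree_mat_mult: "degree_mat d *v y = (\<chi> i. of_nat (d i) * y $ i)"
  by (simp add: degree_mat_def vec_eq_iff matrix_vector_mult_def if_distrib[of "\<lambda>x. x * _"] cong: if_cong)

text \<open>The right-hand side is recognised as the flow through its differential equation, instead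
  of through powers of the matrix.\<close>

lemma cexp_degree_mat: "cexp (degree_mat d) z *v y = (\<chi> i. exp (of_nat (d i) * z) * y $ i)"
proof -
  define x where "x = (\<chi> i. exp (of_nat (d i) * z) * y $ i)"
  have "cexp (degree_mat d) z *v (\<chi> i. exp (- (of_nat (d i) * z)) * x $ i)
      = (\<chi> i. exp (- (of_nat (d i) * 0)) * x $ i)"
    by (rule cexp_constant[where y = "\<lambda>z. \<chi> i. exp (- (of_nat (d i) * z)) * x $ i"])
      (auto simp: degree_mat_mult intro!: derivative_eq_intros)
  moreover have "(\<chi> i. exp (- (of_nat (d i) * z)) * x $ i) = y"
    by (simp add: x_def vec_eq_iff mult.assoc[symmetric] exp_add[symmetric])
  ultimately show ?thesis
    by (simp add: x_def)
qed

definition rescale :: "('n \<Rightarrow> nat) \<Rightarrow> complex \<Rightarrow> complex^'n^'n" where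
  "rescale d c = (\<chi> i j. if i = j then c ^ d i else 0)"

lemma rescale_mult: "rescale d c *v y = (\<chi> i. c ^ d i * y $ i)"
  by (simp add: rescale_def vec_eq_iff matrix_vector_mult_def if_distrib[of "\<lambda>x. x * _"] cong: if_cong)

lemma rescale_inverse:
  assumes "c \<noteq> 0"
  shows "rescale d c ** rescale d (inverse c) = mat 1"
  unfolding matrix_eq
  by (simp add: matrix_vector_mul_assoc[symmetric] rescale_mult vec_eq_iff power_mult_distrib[symmetric]
      mult.assoc[symmetric] assms)

lemma rescale_mem:
  assumes "degree_mat d \<in> inf_aut C" "zariski_closure C = C" "y \<in> C" "c \<noteq> 0"
  shows "rescale d c *v y \<in> C"
proof -
  have "rescale d c *v y = cexp (degree_mat d) (Ln c) *v y"
    using assms(4) by (simp add: rescale_mult cexp_degree_mat exp_of_nat_mult)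
  then show ?thesis
    using inf_aut_cexp[OF assms(1,3)] assms(2) by simp
qed

lemma rescale_image:
  assumes "degree_mat d \<in> inf_aut C" "zariski_closure C = C" "c \<noteq> 0"
  shows "(*v) (rescale d c) ` C = C"
proof
  show "C \<subseteq> (*v) (rescale d c) ` C"
  proof
    fix y assume "y \<in> C"
    then have "rescale d (inverse c) *v y \<in> C"
      using assms by (intro rescale_mem) auto
    moreover have "rescale d c *v (rescale d (inverse c) *v y) = y"
      by (simp add: matrix_vector_mul_assoc rescale_inverse[OF assms(3)])
    ultimately show "y \<in> (*v) (rescale d c) ` C"
      by (metis image_eqI)
  qed
qed (use rescale_mem[OF assms(1,2) _ assms(3)] in auto)

lemma inf_aut_closed:
  assumes "\<And>n. X n \<in> inf_aut C" "\<And>i j. (\<lambda>n. X n $ i $ j) \<longlonglongrightarrow> Y $ i $ j"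
  shows "Y \<in> inf_aut C"
proof -
  have "poly_diff p a (Y *v a) = 0" if "poly_fun p" "\<forall>a\<in>C. p a = 0" "a \<in> C" for p a
  proof -
    have "(\<lambda>n. X n *v a) \<longlonglongrightarrow> Y *v a"
      unfolding matrix_vector_mult_def by (intro tendsto_vec_lambda tendsto_intros assms(2))
    from bounded_linear.tendsto[OF has_derivative_bounded_linear[OF poly_diff_has_derivative[OF that(1)]] this]
    have "(\<lambda>n. poly_diff p a (X n *v a)) \<longlonglongrightarrow> poly_diff p a (Y *v a)" .
    moreover have "(\<lambda>n. poly_diff p a (X n *v a)) = (\<lambda>n. 0)"
      using assms(1) that by (auto simp: inf_aut_def)
    ultimately show ?thesis
      using LIMSEQ_unique tendsto_const by metis
  qed
  then show ?thesis
    by (auto simp: inf_aut_def)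
qed

text \<open>Conjugation by \<open>rescale\<close> multiplies the part of degree \<open>m\<close> by
  \<open>c ^ (- m)\<close>. After multiplication by \<open>c ^ k\<close> all degrees below
  \<open>k\<close> die as \<open>c\<close> tends to 0, and the space is closed and invariant under
  these conjugations.\<close>

lemma inf_aut_leading_part:
  assumes E: "degree_mat d \<in> inf_aut C" and C: "zariski_closure C = C"
    and X: "X \<in> inf_aut C" "X \<in> mat_fil d k"
  shows "mat_part d k X \<in> inf_aut C"
proof (rule inf_aut_closed)
  define c :: "nat \<Rightarrow> complex" where "c = (\<lambda>n. inverse (of_nat (Suc n)))"
  have c0: "c n \<noteq> 0" for n
    unfolding c_def by (simp del: of_nat_Suc)
  define R where "R = (\<lambda>n. rescale d (inverse (c n)) ** X ** rescale d (c n))"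
  define Y where "Y = (\<lambda>n. mat_scale (c n powi k) (R n))"
  show "Y n \<in> inf_aut C" for n
  proof -
    have "R n \<in> inf_aut ((*v) (rescale d (inverse (c n))) ` C)"
      unfolding R_def using c0[of n] rescale_inverse[of "c n" d] rescale_inverse[of "inverse (c n)" d]
      by (intro inf_aut_conjugate X(1)) auto
    then have "R n \<in> inf_aut C"
      using rescale_image[OF E C, of "inverse (c n)"] c0[of n] by simp
    then show ?thesis
      unfolding Y_def by (rule cmat.subspace_scale[OF subspace_inf_aut])
  qed
  have c_lim: "filterlim c (at 0) sequentially"
  proof -
    have "c \<longlonglongrightarrow> 0"
      unfolding c_def by (rule lim_inverse_n[THEN LIMSEQ_Suc])
    then show ?thesis
      by (simp add: filterlim_at c0)
  qed
  fix i j
  \<comment> \<open>Applying \<open>mat_fil_limit\<close> to the vector with \<open>t ^ d j\<close>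
    in position \<open>j\<close> reads off column \<open>j\<close>.\<close>
  have "((\<lambda>t. t powi k * (X *v (\<chi> l. if l = j then t ^ d j else 0)) $ i / t ^ d i) \<longlongrightarrow>
      (mat_part d k X *v axis j 1) $ i) (at 0)"
  proof (rule mat_fil_limit[OF X(2)])
    fix l
    have "((\<lambda>t. (axis j 1 :: complex^'a) $ l) \<longlongrightarrow> axis j 1 $ l) (at (0::complex))"
      by simp
    moreover have "\<forall>\<^sub>F t in at (0::complex). (axis j 1 :: complex^'a) $ l = (\<chi> l. if l = j then t ^ d j else 0) $ l / t ^ d l"
      unfolding eventually_at_filter by (auto simp: axis_def)
    ultimately show "((\<lambda>t. (\<chi> l. if l = j then t ^ d j else 0) $ l / t ^ d l) \<longlongrightarrow> (axis j 1 :: complex^'a) $ l) (at (0::complex))"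
      by (rule Lim_transform_eventually)
  qed
  from filterlim_compose[OF this c_lim]
  have "(\<lambda>n. c n powi k * (X *v (\<chi> l. if l = j then c n ^ d j else 0)) $ i / c n ^ d i) \<longlonglongrightarrow>
      (mat_part d k X *v axis j 1) $ i" .
  moreover have "c n powi k * (X *v (\<chi> l. if l = j then c n ^ d j else 0)) $ i / c n ^ d i = Y n $ i $ j" for n
  proof -
    have "R n $ i $ j = inverse (c n) ^ d i * (X $ i $ j * c n ^ d j)"
      unfolding R_def rescale_def matrix_matrix_mult_def
      by (simp add: if_distrib[of "\<lambda>x. x * _"] if_distrib[of "\<lambda>x. _ * x"] cong: if_cong)
    then show ?thesis
      by (simp add: Y_def matrix_vector_mult_def if_distrib[of "\<lambda>x. _ * x"] field_simps cong: if_cong)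
  qed
  moreover have "(Z *v axis j 1) $ i = Z $ i $ j" for Z :: "complex^'a^'a"
    by (simp add: matrix_vector_mult_def axis_def if_distrib[of "\<lambda>x. _ * x"] cong: if_cong)
  ultimately show "(\<lambda>n. Y n $ i $ j) \<longlonglongrightarrow> mat_part d k X $ i $ j"
    by (simp only:)
qed

section \<open>Unipotent conjugation to the degree matrix\<close>

text \<open>\<open>u - mat 1\<close> strictly lowers degree, so it leaves the nonzero coordinates of
  highest degree of a vector unaltered, and a nonzero vector cannot be mapped to 0.\<close>

lemma unipotent_invertible:
  fixes u :: "complex^'n^'n"
  assumes "u - mat 1 \<in> mat_fil d (- 1)"
  obtains N where "u ** N = mat 1" "N ** u = mat 1"
proof -
  have "x = 0" if "u *v x = 0" for x
  proof (rule ccontr)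
    assume "x \<noteq> 0"
    then have ne: "{i. x $ i \<noteq> 0} \<noteq> {}"
      by (auto simp: vec_eq_iff)
    then have "Max (d ` {i. x $ i \<noteq> 0}) \<in> d ` {i. x $ i \<noteq> 0}"
      by (intro Max_in) auto
    then obtain i where i: "x $ i \<noteq> 0" "d i = Max (d ` {i. x $ i \<noteq> 0})"
      by auto
    have d_le: "d j \<le> d i" if "x $ j \<noteq> 0" for j
      unfolding i(2) using that by (intro Max_ge) auto
    have "(u - mat 1) $ i $ j * x $ j = 0" for j
    proof (cases "x $ j = 0")
      case False
      then have "- 1 < int (d i) - int (d j)"
        using d_le[of j] by simp
      then show ?thesis
        using assms by (auto simp: mat_fil_def)
    qed simp
    then have "((u - mat 1) *v x) $ i = 0"
      unfolding matrix_vector_mult_def by (simp only: vec_lambda_beta sum.neutral_const)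
    then have "(u *v x) $ i = x $ i"
      by (simp add: matrix_vector_mult_diff_rdistrib)
    then show False
      using that i by simp
  qed
  then obtain N where "N ** u = mat 1"
    using matrix_left_invertible_ker[of u] by blast
  then show thesis
    using that matrix_left_right_inverse by blast
qed

text \<open>Row \<open>i\<close> of \<open>u\<close> is sought as a left eigenvector of
  \<open>X\<close> with eigenvalue \<open>d i\<close> and leading term \<open>axis i 1\<close>. On
  row vectors, multiplied from the left, \<open>X - degree_mat d\<close> raises the degree, and the
  corrections are found degree by degree.\<close>

lemma degree_mat_conjugation:
  fixes X :: "complex^'n^'n"
  assumes X: "X - degree_mat d \<in> mat_fil d (- 1)"
  obtains u where "u - mat 1 \<in> mat_fil d (- 1)" "u ** X = degree_mat d ** u"
proof -
  \<comment> \<open>Row vectors supported in degrees at least \<open>k\<close>. With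
    \<open>T\<close> as below, \<open>T a v = 0\<close> says that \<open>v\<close> satisfies the
    left eigenvector equation for \<open>a\<close>.\<close>
  define W where "W = (\<lambda>k. {v::complex^'n. \<forall>j. d j < k \<longrightarrow> v $ j = 0})"
  define T where "T = (\<lambda>(a::nat) (v::complex^'n). (\<chi> j. (\<Sum>i\<in>UNIV. v $ i * X $ i $ j) - of_nat a * v $ j))"
  have T_W: "T k v \<in> W (Suc k)" if "v \<in> W k" for k v
  proof -
    have "T k v $ j = 0" if j: "d j \<le> k" for j
    proof -
      have "v $ i * X $ i $ j = (if i = j then of_nat (d j) * v $ j else 0)" for i
      proof (cases "v $ i = 0")
        case False
        then have "\<not> d i < k"
          using \<open>v \<in> W k\<close> by (auto simp: W_def)
        then have "- 1 < int (d i) - int (d j)"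
          using j by simp
        then have "(X - degree_mat d) $ i $ j = 0"
          using X by (auto simp: mat_fil_def)
        then show ?thesis
          by (simp add: degree_mat_def split: if_splits)
      qed auto
      then show ?thesis
        using \<open>v \<in> W k\<close> j by (cases "d j = k") (auto simp: T_def W_def)
    qed
    then show ?thesis
      by (simp add: W_def)
  qed
  \<comment> \<open>Here \<open>m\<close> counts the corrections made; each pushes the defect
    \<open>T k z\<close> one degree higher.\<close>
  have "\<exists>z. z - v \<in> W (Suc k) \<and> T k z \<in> W (Suc (k + m))" if v: "v \<in> W k" for v k m
  proof (induction m)
    case 0
    then show ?case
      using T_W[OF v] by (intro exI[of _ v]) (simp add: W_def)
  next
    case (Suc m)
    then obtain z where z: "z - v \<in> W (Suc k)" "T k z \<in> W (Suc (k + m))"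
      by blast
    define y where "y = T k z"
    \<comment> \<open>Modulo higher degree, \<open>T k\<close> acts on the defect as multiplication
      by \<open>Suc m\<close>, a nonzero number, so this subtraction removes the lowest term of the
      defect.\<close>
    define z' where "z' = z - (1 / of_nat (Suc m)) *s y"
    have "T (Suc (k + m)) y \<in> W (Suc (Suc (k + m)))"
      using T_W z(2) by (simp add: y_def)
    moreover have "T k z' = - (1 / of_nat (Suc m)) *s T (Suc (k + m)) y"
    proof -
      have "T k (a - c *s b) = T k a - c *s T k b" for a b c
        by (simp add: vec_eq_iff T_def algebra_simps sum_subtractf sum_distrib_left)
      then have "T k z' = y - (1 / of_nat (Suc m)) *s T k y"
        by (simp only: z'_def y_def)
      moreover have "T k y = T (Suc (k + m)) y + of_nat (Suc m) *s y"
        by (simp add: vec_eq_iff T_def algebra_simps)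
      ultimately show ?thesis
        by (simp add: vec_eq_iff field_simps del: of_nat_Suc)
    qed
    moreover have "z' - v \<in> W (Suc k)"
      using z by (auto simp: W_def z'_def y_def)
    ultimately show ?case
      by (intro exI[of _ z']) (auto simp: W_def)
  qed
  moreover have "axis i 1 \<in> W (d i)" for i
    by (auto simp: W_def axis_def)
  ultimately have "\<forall>i. \<exists>z. z - axis i 1 \<in> W (Suc (d i)) \<and> T (d i) z \<in> W (Suc (d i + Max (range d)))"
    by blast
  then obtain R where R: "\<And>i. R i - axis i 1 \<in> W (Suc (d i))"
    "\<And>i. T (d i) (R i) \<in> W (Suc (d i + Max (range d)))"
    by metis
  \<comment> \<open>Beyond the largest degree \<open>W\<close> is trivial, so the defect has
    disappeared.\<close>
  have "d j < Suc (d i + Max (range d))" for i j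
    using Max_ge[of "range d" "d j"] by (simp add: le_imp_less_Suc trans_le_add2)
  then have TR: "T (d i) (R i) $ j = 0" for i j
    using R(2)[of i] unfolding W_def by blast
  define u where "u = (\<chi> i. R i)"
  have "(u - mat 1) $ i $ j = 0" if "- 1 < int (d i) - int (d j)" for i j
    using R(1)[of i] that by (auto simp: W_def u_def mat_def axis_def)
  moreover have "(u ** X) $ i $ j = (degree_mat d ** u) $ i $ j" for i j
    using TR[of i j]
    by (simp add: T_def u_def matrix_matrix_mult_def degree_mat_def if_distrib[of "\<lambda>x. x * _"] cong: if_cong)
  ultimately show thesis
    by (intro that[of u]) (auto simp: mat_fil_def vec_eq_iff)
qed


section \<open>The model cone\<close>

text \<open>Coordinates of the model space are indexed by \<open>'n\<close>; the coordinate \<open>i\<close> has degree \<open>d i\<close> and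
  the forms \<open>s i\<close> with \<open>d i = k\<close> form a basis of \<open>S^k\<close>.\<close>

locale graded_symbol =
  fixes d :: "'n::finite \<Rightarrow> nat"
    and s :: "'n \<Rightarrow> (complex^'d::finite) list \<Rightarrow> complex"
    and i0 :: 'n
  assumes sym: "s i \<in> sym_forms (d i)"
    and contraction: "d i = Suc k \<Longrightarrow> \<exists>c. \<forall>us. s i (v # us) = (\<Sum>j | d j = k. c j * s j us)"
    and degree_0: "d i = 0 \<longleftrightarrow> i = i0"
    and s_i0: "s i0 [] \<noteq> 0"
    and separating: "(\<And>i. d i = 1 \<Longrightarrow> s i [v] = 0) \<Longrightarrow> v = 0"
    and interpolating: "\<exists>v. \<forall>i. d i = 1 \<longrightarrow> s i [v] = a i"
begin

text \<open>The Euler map at \<open>t = 1\<close>, in adapted coordinates.\<close>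

definition psi :: "complex^'d \<Rightarrow> complex^'n" where
  "psi w = (\<chi> i. s i (replicate (d i) w))"

text \<open>The derivative of \<open>psi\<close>. For \<open>d i = 0\<close> the truncated
  \<open>d i - 1\<close> is harmless because of the factor \<open>of_nat (d i)\<close>.\<close>

definition dpsi :: "complex^'d \<Rightarrow> complex^'d \<Rightarrow> complex^'n" where
  "dpsi w h = (\<chi> i. of_nat (d i) * s i (h # replicate (d i - 1) w))"

text \<open>In general not closed; its Zariski closure is the Euler cone in these
  coordinates.\<close>

definition model :: "(complex^'n) set" where
  "model = {c *s psi w | c w. True}"

lemma psi_derivative:
  "((\<lambda>z. psi (w + z *s h) $ i) has_field_derivative dpsi (w + z *s h) h $ i) (at z)"
  unfolding psi_def dpsi_def using sym_form_power_derivative[OF sym] by simp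

lemma
  shows dpsi_add: "dpsi w (g + h) = dpsi w g + dpsi w h"
    and dpsi_scale: "dpsi w (c *s h) = c *s dpsi w h"
proof -
  have "of_nat (d i) * s i ((g + h) # replicate (d i - 1) w) =
      of_nat (d i) * s i (g # replicate (d i - 1) w) + of_nat (d i) * s i (h # replicate (d i - 1) w)"
    "of_nat (d i) * s i (c *s h # replicate (d i - 1) w) = c * (of_nat (d i) * s i (h # replicate (d i - 1) w))" for i
    using sym_form_add[OF sym[of i], of "replicate (d i - 1) w"]
      sym_form_scale[OF sym[of i], of "replicate (d i - 1) w"]
    by (cases "d i = 0"; simp add: algebra_simps)+
  then show "dpsi w (g + h) = dpsi w g + dpsi w h" "dpsi w (c *s h) = c *s dpsi w h"
    by (simp_all add: dpsi_def vec_eq_iff)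
qed

text \<open>The curve \<open>(1 + a z) psi(w + z b)\<close> stays in the model and has velocity
  \<open>X psi(w)\<close> at 0; polynomials vanishing on the model are differentiated along its
  multiples.\<close>

lemma tangent_imp_inf_aut:
  assumes "\<And>w. \<exists>a b. X *v psi w = a *s psi w + dpsi w b"
  shows "X \<in> inf_aut model"
proof -
  have "poly_diff p (c *s psi w) (X *v (c *s psi w)) = 0"
    if p: "poly_fun p" "\<forall>y\<in>model. p y = 0" for p c w
  proof -
    obtain a b where ab: "X *v psi w = a *s psi w + dpsi w b"
      using assms by blast
    define y where "y = (\<lambda>z. (c * (1 + a * z)) *s psi (w + z *s b))"
    have "((\<lambda>z. (c * (1 + a * z)) * psi (w + z *s b) $ i) has_field_derivative
        c * a * psi w $ i + c * dpsi w b $ i) (at 0)" for i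
      using psi_derivative[of w b i 0] by (auto intro!: derivative_eq_intros)
    then have "((\<lambda>z. y z $ i) has_field_derivative (X *v (c *s psi w)) $ i) (at 0)" for i
      by (simp add: y_def vec.scale ab algebra_simps)
    then have "((\<lambda>z. p (y z)) has_field_derivative poly_diff p (y 0) (X *v (c *s psi w))) (at 0)"
      by (rule poly_fun_curve_derivative[OF p(1)])
    moreover have "(\<lambda>z. p (y z)) = (\<lambda>z. 0)"
      using p(2) unfolding y_def model_def by blast
    ultimately have "poly_diff p (y 0) (X *v (c *s psi w)) = 0"
      by (metis DERIV_const DERIV_unique)
    then show ?thesis
      by (simp add: y_def)
  qed
  then show ?thesis
    unfolding inf_aut_def model_def by blast
qed

text \<open>Degree 0 determines \<open>a\<close>, and degree 1 then determines \<open>b\<close>.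
  This injectivity keeps limits of tangent spaces from collapsing.\<close>

lemma psi_dpsi_independent:
  assumes "a *s psi w + dpsi w b = 0"
  shows "a = 0 \<and> b = 0"
proof -
  have eq: "a * psi w $ i + dpsi w b $ i = 0" for i
    using assms by (simp add: vec_eq_iff)
  have "d i0 = 0"
    using degree_0 by simp
  then have "a = 0"
    using eq[of i0] s_i0 by (simp add: psi_def dpsi_def)
  moreover have "s i [b] = 0" if "d i = 1" for i
    using eq[of i] that \<open>a = 0\<close> by (simp add: dpsi_def)
  ultimately show ?thesis
    using separating by blast
qed

lemma psi_0: "psi 0 = s i0 [] *s axis i0 1"
proof -
  have "s i (replicate (d i) 0) = (if i = i0 then s i0 [] else 0)" for i
    using sym_form_replicate_scale[OF sym[of i], of "d i" "[]" 0 0] degree_0[of i]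
    by (auto simp: power_0_left)
  then show ?thesis
    by (auto simp: psi_def vec_eq_iff axis_def)
qed

text \<open>Euler's identity: the degree matrix acts on \<open>psi w\<close> as the derivative in
  direction \<open>w\<close>.\<close>

lemma degree_mat_inf_aut: "degree_mat d \<in> inf_aut model"
proof (rule tangent_imp_inf_aut)
  fix w
  have "of_nat (d i) * s i (replicate (d i) w) = of_nat (d i) * s i (w # replicate (d i - 1) w)" for i
    by (cases "d i") auto
  then have "degree_mat d *v psi w = 0 *s psi w + dpsi w w"
    by (simp add: degree_mat_mult psi_def dpsi_def vec_eq_iff)
  then show "\<exists>a b. degree_mat d *v psi w = a *s psi w + dpsi w b"
    by blast
qed

definition coef :: "'n \<Rightarrow> complex^'d \<Rightarrow> 'n \<Rightarrow> complex" where
  "coef i v = (SOME c. \<forall>us. s i (v # us) = (\<Sum>j | Suc (d j) = d i. c j * s j us))"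

lemma coef:
  assumes "d i \<noteq> 0"
  shows "s i (v # us) = (\<Sum>j | Suc (d j) = d i. coef i v j * s j us)"
proof -
  obtain k where k: "d i = Suc k"
    using assms not0_implies_Suc by blast
  have "\<exists>c. \<forall>us. s i (v # us) = (\<Sum>j | Suc (d j) = d i. c j * s j us)"
    using contraction[OF k, of v] by (simp add: k)
  from someI_ex[OF this] show ?thesis
    unfolding coef_def by blast
qed

text \<open>The nilpotent matrix of multiplication by \<open>v\<close>; its exponential translates \<open>psi\<close>.\<close>

definition mult_mat :: "complex^'d \<Rightarrow> complex^'n^'n" where
  "mult_mat v = (\<chi> i j. if Suc (d j) = d i then of_nat (d i) * coef i v j else 0)"

lemma mult_mat_mult: "(mult_mat v *v y) $ i = of_nat (d i) * (\<Sum>j | Suc (d j) = d i. coef i v j * y $ j)"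
proof -
  have "(mult_mat v *v y) $ i = (\<Sum>j\<in>UNIV. if Suc (d j) = d i then of_nat (d i) * (coef i v j * y $ j) else 0)"
    by (simp add: mult_mat_def matrix_vector_mult_def if_distrib[of "\<lambda>x. x * _"] mult.assoc cong: if_cong)
  then show ?thesis
    by (simp add: sum.If_cases sum_distrib_left)
qed

lemma mult_mat_psi: "mult_mat v *v psi w = dpsi w v"
proof -
  have "(mult_mat v *v psi w) $ i = dpsi w v $ i" for i
  proof (cases "d i")
    case (Suc k)
    then show ?thesis
      using coef[of i v "replicate k w"] by (simp add: mult_mat_mult dpsi_def psi_def)
  qed (simp add: mult_mat_mult dpsi_def)
  then show ?thesis
    by (simp add: vec_eq_iff)
qed

lemma mult_mat_inf_aut: "mult_mat v \<in> inf_aut model"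
  by (rule tangent_imp_inf_aut) (metis add_0 mult_mat_psi vec.scale_zero_left)

lemma mult_mat_degree: "mult_mat v \<in> mat_fil d 1" "mat_part d 1 (mult_mat v) = mult_mat v"
  by (auto simp: mat_fil_def mult_mat_def vec_eq_iff)

text \<open>By \<open>mult_mat_psi\<close> the curve \<open>psi (w - z v)\<close> solves
  \<open>y' = -Xy\<close> for \<open>X = mult_mat v\<close>.\<close>

lemma cexp_mult_mat: "cexp (mult_mat v) z *v psi (w - z *s v) = psi w"
proof -
  have "((\<lambda>z. psi (w - z *s v) $ i) has_field_derivative (- (mult_mat v *v psi (w - z *s v))) $ i) (at z)" for z i
    using psi_derivative[of w "- v" i z] dpsi_scale[of "w - z *s v" "- 1" v]
    by (simp add: mult_mat_psi vec.scale_minus_right)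
  from cexp_constant[of "\<lambda>z. psi (w - z *s v)" "mult_mat v", OF this] show ?thesis
    by simp
qed

text \<open>Degree 0 stays fixed and degree 1 moves at a constant rate, which can be prescribed
  through \<open>v\<close> once \<open>y $ i0\<close> is nonzero.\<close>

lemma cexp_mult_mat_low:
  shows "(cexp (mult_mat v) z *v y) $ i0 = y $ i0"
    and "d i = 1 \<Longrightarrow> (cexp (mult_mat v) z *v y) $ i = y $ i + z * (y $ i0 * s i [v] / s i0 [])"
proof -
  define x where "x = (\<lambda>z. cexp (mult_mat v) z *v y)"
  have der: "((\<lambda>z. x z $ i) has_field_derivative (mult_mat v *v x z) $ i) (at z)" for i z
    unfolding x_def by (rule cexp_vec_derivative)
  have const: "f z = f 0" if "\<And>z. (f has_field_derivative 0) (at z)" for f :: "complex \<Rightarrow> complex" and z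
  proof -
    have "\<exists>c. \<forall>z\<in>UNIV. f z = c"
      by (intro has_field_derivative_zero_constant) (use that in auto)
    then show ?thesis by auto
  qed
  have x0: "x 0 = y"
    by (simp add: x_def)
  have "(mult_mat v *v x z) $ i0 = 0" for z
    using degree_0[of i0] by (simp add: mult_mat_mult)
  then have "((\<lambda>z. x z $ i0) has_field_derivative 0) (at z)" for z
    using der[of i0 z] by simp
  from const[OF this] have i0: "x z $ i0 = y $ i0" for z
    by (simp add: x0)
  then show "(cexp (mult_mat v) z *v y) $ i0 = y $ i0"
    by (simp add: x_def)
  assume i: "d i = 1"
  have only: "{j. Suc (d j) = d i} = {i0}"
    using degree_0 i by auto
  have "s i [v] = coef i v i0 * s i0 []"
    using coef[of i v "[]"] i unfolding only by simp
  then have "(mult_mat v *v x z) $ i = y $ i0 * s i [v] / s i0 []" for z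
    using s_i0 i unfolding mult_mat_mult only by (simp add: i0)
  \<comment> \<open>The expected linear term is subtracted, so that the rest is constant.\<close>
  then have "((\<lambda>z. x z $ i - z * (y $ i0 * s i [v] / s i0 [])) has_field_derivative 0) (at z)" for z
    using der[of i z] s_i0 by (auto intro!: derivative_eq_intros)
  from const[OF this, of z] show "(cexp (mult_mat v) z *v y) $ i = y $ i + z * (y $ i0 * s i [v] / s i0 [])"
    by (simp add: x_def algebra_simps)
qed

end


section \<open>Cones with a local frame\<close>

text \<open>\<open>lifting\<close> is the sequential form of the chart being open in the cone with
  continuous inverse. It survives linear changes of coordinates and fits the limit arguments
  directly.\<close>

locale cone_frame =
  fixes C :: "(complex^'n::finite) set" and \<phi> :: "complex^'d::finite \<Rightarrow> complex^'n"
    and \<phi>' :: "complex^'d \<Rightarrow> complex^'d \<Rightarrow> complex^'n" and U :: "(complex^'d) set"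
  assumes closed: "zariski_closure C = C"
    and cone: "y \<in> C \<Longrightarrow> c *s y \<in> C"
    and frame_mem: "w \<in> U \<Longrightarrow> \<phi> w \<in> C"
    and lifting: "w \<in> U \<Longrightarrow> c \<noteq> 0 \<Longrightarrow> (\<And>n. x n \<in> C) \<Longrightarrow> x \<longlonglongrightarrow> c *s \<phi> w \<Longrightarrow>
      \<exists>a v. a \<longlonglongrightarrow> c \<and> v \<longlonglongrightarrow> w \<and> (\<forall>\<^sub>F n in sequentially. x n = a n *s \<phi> (v n) \<and> v n \<in> U)"
    and frame_derivative: "w \<in> U \<Longrightarrow> (\<phi> has_derivative \<phi>' w) (at w)"
    and frame_derivative_scale: "w \<in> U \<Longrightarrow> \<phi>' w (c *s h) = c *s \<phi>' w h"
    and frame_immersion: "w \<in> U \<Longrightarrow> c *s \<phi> w + \<phi>' w h = 0 \<Longrightarrow> c = 0 \<and> h = 0"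
    and U: "open U" "0 \<in> U"
begin

lemma frame_derivative_add: "w \<in> U \<Longrightarrow> \<phi>' w (g + h) = \<phi>' w g + \<phi>' w h"
  using has_derivative_linear[OF frame_derivative] linear_add by blast

lemma linear_frame_tangent:
  assumes "w \<in> U"
  shows "linear (\<lambda>(c, h). c *s \<phi> w + \<phi>' w h)" "inj (\<lambda>(c, h). c *s \<phi> w + \<phi>' w h)"
proof -
  have smult: "r *\<^sub>R y = complex_of_real r *s y" for r and y :: "complex^'k"
    by (simp add: vec_eq_iff scaleR_conv_of_real[where 'a = complex])
  show lin: "linear (\<lambda>(c, h). c *s \<phi> w + \<phi>' w h)"
    by (rule linearI)
      (auto simp: frame_derivative_add[OF assms] frame_derivative_scale[OF assms] smult
        scaleR_conv_of_real[where 'a = complex] vec.scale_left_distrib vec.scale_right_distrib algebra_simps)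
  show "inj (\<lambda>(c, h). c *s \<phi> w + \<phi>' w h)"
    unfolding linear_injective_0[OF lin] using frame_immersion[OF assms] by (auto simp: zero_prod_def)
qed

text \<open>The points \<open>exp(X/n) \<phi>(w)\<close> lie in the cone and converge to
  \<open>\<phi>(w)\<close>, so they lift to the chart. Their difference quotients converge to
  \<open>X \<phi>(w)\<close>, which the immersion property places in the tangent space.\<close>

lemma inf_aut_tangent:
  assumes X: "X \<in> inf_aut C" and w: "w \<in> U"
  shows "\<exists>a b. X *v \<phi> w = a *s \<phi> w + \<phi>' w b"
proof -
  define y where "y = (\<lambda>n. cexp X (inverse (of_nat n)) *v \<phi> w)"
  define F where "F = (\<lambda>q. fst q *s \<phi> (snd q))"
  define L where "L = (\<lambda>(c, h). c *s \<phi> w + \<phi>' w h)"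
  have y_C: "y n \<in> C" for n
    unfolding y_def using inf_aut_cexp[OF X frame_mem[OF w]] closed by simp
  have der: "((\<lambda>z. cexp X z *v \<phi> w) has_derivative (\<lambda>c. c *s (X *v \<phi> w))) (at 0)"
    by (rule has_derivative_vec_complex) (use cexp_vec_derivative[of X "\<phi> w" _ 0] in simp)
  have inv: "(\<lambda>n. inverse (of_nat n) :: complex) \<longlonglongrightarrow> 0"
    by (rule lim_inverse_n)
  have "isCont (\<lambda>z. cexp X z *v \<phi> w) 0"
    using der by (rule has_derivative_continuous)
  from isCont_tendsto_compose[OF this inv] have y_lim: "y \<longlonglongrightarrow> 1 *s \<phi> w"
    by (simp add: y_def)
  obtain a v where av: "a \<longlonglongrightarrow> 1" "v \<longlonglongrightarrow> w"
    "\<forall>\<^sub>F n in sequentially. y n = a n *s \<phi> (v n) \<and> v n \<in> U"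
    using lifting[OF w _ y_C y_lim] by auto
  define q where "q = (\<lambda>n. (a n, v n))"
  have F_der: "(F has_derivative L) (at (1, w))"
  proof (rule has_derivative_vec)
    fix i
    have "((\<lambda>q. \<phi> (snd q) $ i) has_derivative (\<lambda>h. \<phi>' w (snd h) $ i)) (at (1, w))"
      by (rule bounded_linear.has_derivative[OF bounded_linear_vec_nth])
        (rule has_derivative_compose[OF has_derivative_snd[OF has_derivative_ident]], use frame_derivative[OF w] in simp)
    then show "((\<lambda>q. F q $ i) has_derivative (\<lambda>h. L h $ i)) (at (1, w))"
      unfolding F_def L_def by (auto intro!: derivative_eq_intros simp: case_prod_unfold fun_eq_iff)
  qed
  have "X *v \<phi> w \<in> range L"
  proof (rule tangent_vector_in_range[OF F_der])
    show "inj L"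
      unfolding L_def by (rule linear_frame_tangent[OF w])
    show "q \<longlonglongrightarrow> (1, w)"
      unfolding q_def by (intro tendsto_Pair av)
    have "(\<lambda>n. of_nat n * (y n $ i - \<phi> w $ i)) \<longlonglongrightarrow> (X *v \<phi> w) $ i" for i
    proof -
      have "(\<lambda>h. ((cexp X h *v \<phi> w) $ i - \<phi> w $ i) / h) \<midarrow>0\<rightarrow> (X *v \<phi> w) $ i"
        using cexp_vec_derivative[of X "\<phi> w" i 0] by (simp add: has_field_derivative_def DERIV_def[symmetric] field_has_derivative_at)
      moreover have "filterlim (\<lambda>n. inverse (of_nat n) :: complex) (at 0) sequentially"
        using inv by (auto simp: filterlim_at intro: eventually_sequentiallyI[of 1])
      ultimately have "(\<lambda>n. ((cexp X (inverse (of_nat n)) *v \<phi> w) $ i - \<phi> w $ i) / inverse (of_nat n)) \<longlonglongrightarrow> (X *v \<phi> w) $ i"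
        by (rule filterlim_compose)
      then show ?thesis
        by (simp add: y_def field_simps)
    qed
    then have "(\<lambda>n. real n *\<^sub>R (y n - \<phi> w)) \<longlonglongrightarrow> X *v \<phi> w"
      by (intro vec_tendstoI) (simp add: scaleR_conv_of_real[where 'a = complex])
    moreover have "\<forall>\<^sub>F n in sequentially. real n *\<^sub>R (y n - \<phi> w) = real n *\<^sub>R (F (q n) - F (1, w))"
      using av(3) by eventually_elim (simp add: F_def q_def)
    ultimately show "(\<lambda>n. real n *\<^sub>R (F (q n) - F (1, w))) \<longlonglongrightarrow> X *v \<phi> w"
      by (rule Lim_transform_eventually)
  qed
  then show ?thesis
    by (auto simp: L_def)
qed

lemma transport:
  fixes M N :: "complex^'n^'n"
  assumes MN: "M ** N = mat 1" "N ** M = mat 1"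
  shows "cone_frame ((*v) M ` C) (\<lambda>w. M *v \<phi> w) (\<lambda>w h. M *v \<phi>' w h) U"
proof
  have NM: "N *v (M *v y) = y" "M *v (N *v y) = y" for y
    by (simp_all add: matrix_vector_mul_assoc MN)
  show "zariski_closure ((*v) M ` C) = (*v) M ` C"
    by (simp add: zariski_closure_matrix_image[OF MN] closed)
  show "c *s y \<in> (*v) M ` C" if "y \<in> (*v) M ` C" for y c
    using that cone by (auto simp: vec.scale[symmetric])
  show "M *v \<phi> w \<in> (*v) M ` C" if "w \<in> U" for w
    using frame_mem[OF that] by blast
  show "\<exists>a v. a \<longlonglongrightarrow> c \<and> v \<longlonglongrightarrow> w \<and> (\<forall>\<^sub>F n in sequentially. y n = a n *s (M *v \<phi> (v n)) \<and> v n \<in> U)"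
    if w: "w \<in> U" "c \<noteq> 0" and y: "\<And>n. y n \<in> (*v) M ` C" "y \<longlonglongrightarrow> c *s (M *v \<phi> w)" for w c y
  proof -
    have "N *v y n \<in> C" for n
      using y(1)[of n] by (auto simp: NM)
    moreover have "(\<lambda>n. N *v y n) \<longlonglongrightarrow> N *v (c *s (M *v \<phi> w))"
      by (rule bounded_linear.tendsto[OF matrix_vector_mul_bounded_linear y(2)])
    then have "(\<lambda>n. N *v y n) \<longlonglongrightarrow> c *s \<phi> w"
      by (simp add: vec.scale NM)
    ultimately obtain a v where av: "a \<longlonglongrightarrow> c" "v \<longlonglongrightarrow> w"
      "\<forall>\<^sub>F n in sequentially. N *v y n = a n *s \<phi> (v n) \<and> v n \<in> U"
      using lifting[OF w, of "\<lambda>n. N *v y n"] by blast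
    have "\<forall>\<^sub>F n in sequentially. y n = a n *s (M *v \<phi> (v n)) \<and> v n \<in> U"
      using av(3) by eventually_elim (metis NM(2) vec.scale)
    then show ?thesis
      using av by blast
  qed
  show "((\<lambda>w. M *v \<phi> w) has_derivative (\<lambda>h. M *v \<phi>' w h)) (at w)" if "w \<in> U" for w
    by (rule bounded_linear.has_derivative[OF matrix_vector_mul_bounded_linear frame_derivative[OF that]])
  show "M *v \<phi>' w (c *s h) = c *s (M *v \<phi>' w h)" if "w \<in> U" for w c h
    by (simp add: frame_derivative_scale[OF that] vec.scale)
  show "c = 0 \<and> h = 0" if "w \<in> U" "c *s (M *v \<phi> w) + M *v \<phi>' w h = 0" for w c h
  proof -
    have "M *v (c *s \<phi> w + \<phi>' w h) = 0"
      using that(2) by (simp add: vec.add vec.scale)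
    then have "c *s \<phi> w + \<phi>' w h = 0"
      by (metis NM(1) vec.zero)
    then show ?thesis
      using frame_immersion[OF that(1)] by blast
  qed
qed (fact U)+

end

section \<open>Adapted frames\<close>

text \<open>The factor \<open>t\<close> in \<open>leading_derivative\<close> comes from
  differentiating the rescaled frame, in which \<open>w\<close> is replaced by
  \<open>t *s w\<close>.\<close>

locale adapted_frame = graded_symbol d s i0 + cone_frame C \<phi> \<phi>' U
  for d :: "'n::finite \<Rightarrow> nat" and s :: "'n \<Rightarrow> (complex^'d::finite) list \<Rightarrow> complex" and i0 :: 'n
    and C :: "(complex^'n) set" and \<phi> :: "complex^'d \<Rightarrow> complex^'n"
    and \<phi>' :: "complex^'d \<Rightarrow> complex^'d \<Rightarrow> complex^'n" and U :: "(complex^'d) set" +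
  assumes leading: "((\<lambda>t. \<phi> (t *s w) $ i / t ^ d i) \<longlongrightarrow> psi w $ i) (at 0)"
    and leading_derivative: "((\<lambda>t. t * \<phi>' (t *s w) h $ i / t ^ d i) \<longlongrightarrow> dpsi w h $ i) (at 0)"
begin

lemma tangent_leading_part:
  assumes X: "X \<in> inf_aut C" "X \<in> mat_fil d k"
  shows "\<exists>a b. mat_part d k X *v psi w = a *s psi w + dpsi w b"
proof -
  define L where "L = (\<lambda>(a, b). a *s psi w + dpsi w b)"
  \<comment> \<open>\<open>M t\<close> is the tangent map of the rescaled frame at \<open>w\<close>;
    it converges to the tangent map \<open>L\<close> of \<open>psi\<close>.\<close>
  define M where "M = (\<lambda>t (a, b). \<chi> i. (a * \<phi> (t *s w) $ i + t * \<phi>' (t *s w) b $ i) / t ^ d i)"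
  have smult: "r *\<^sub>R y = complex_of_real r *s y" for r and y :: "complex^'k"
    by (simp add: vec_eq_iff scaleR_conv_of_real[where 'a = complex])
  have "open ((\<lambda>t. t *s w) -` U)"
    by (intro open_vimage U continuous_intros)
  then have inU: "\<forall>\<^sub>F t in at 0. t *s w \<in> U \<and> t \<noteq> 0"
    using U(2) eventually_at_in_open'[of "(\<lambda>t. t *s w) -` U" 0]
    by (intro eventually_conj eventually_neq_at_within) auto
  have L: "linear L"
    unfolding L_def by (rule linearI)
      (auto simp: dpsi_add dpsi_scale smult scaleR_conv_of_real[where 'a = complex]
        vec.scale_left_distrib vec.scale_right_distrib algebra_simps)
  have "inj L"
    unfolding linear_injective_0[OF L] using psi_dpsi_independent by (auto simp: L_def zero_prod_def)
  have M: "linear (M t)" if "t *s w \<in> U" for t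
    unfolding M_def by (rule linearI)
      (auto simp: vec_eq_iff frame_derivative_add[OF that] frame_derivative_scale[OF that] smult
        scaleR_conv_of_real[where 'a = complex] add_divide_distrib algebra_simps)
  have "\<forall>t. \<exists>c. t *s w \<in> U \<and> t \<noteq> 0 \<longrightarrow>
      M t c = (\<chi> i. t powi k * (X *v \<phi> (t *s w)) $ i / t ^ d i)"
  proof (intro allI)
    fix t
    show "\<exists>c. t *s w \<in> U \<and> t \<noteq> 0 \<longrightarrow> M t c = (\<chi> i. t powi k * (X *v \<phi> (t *s w)) $ i / t ^ d i)"
    proof (cases "t *s w \<in> U \<and> t \<noteq> 0")
      case True
      then obtain a b where "X *v \<phi> (t *s w) = a *s \<phi> (t *s w) + \<phi>' (t *s w) b"
        using inf_aut_tangent[OF X(1)] by blast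
      \<comment> \<open>The vector \<open>b\<close> loses one power of \<open>t\<close>, because
        \<open>M t\<close> already contains the factor \<open>t\<close> of the chain rule.\<close>
      then have "M t (t powi k * a, (t powi k / t) *s b) = (\<chi> i. t powi k * (X *v \<phi> (t *s w)) $ i / t ^ d i)"
        using True by (simp add: M_def frame_derivative_scale vec_eq_iff algebra_simps)
      then show ?thesis by blast
    qed blast
  qed
  then obtain c where c: "\<And>t. t *s w \<in> U \<Longrightarrow> t \<noteq> 0 \<Longrightarrow>
      M t (c t) = (\<chi> i. t powi k * (X *v \<phi> (t *s w)) $ i / t ^ d i)"
    by metis
  have "mat_part d k X *v psi w \<in> range L"
  proof (rule limit_in_range[OF _ L \<open>inj L\<close>])
    show "\<forall>\<^sub>F t in at 0. linear (M t)"
      using inU by eventually_elim (simp add: M)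
    show "((\<lambda>t. M t x) \<longlongrightarrow> L x) (at 0)" for x
    proof (rule vec_tendstoI)
      fix i
      obtain a b where x: "x = (a, b)" by (cases x)
      have "((\<lambda>t. a * (\<phi> (t *s w) $ i / t ^ d i) + t * \<phi>' (t *s w) b $ i / t ^ d i) \<longlongrightarrow>
          a * psi w $ i + dpsi w b $ i) (at 0)"
        by (intro tendsto_intros leading leading_derivative)
      then show "((\<lambda>t. M t x $ i) \<longlongrightarrow> L x $ i) (at 0)"
        by (simp add: M_def L_def x add_divide_distrib)
    qed
    have "((\<lambda>t. \<chi> i. t powi k * (X *v \<phi> (t *s w)) $ i / t ^ d i) \<longlongrightarrow> mat_part d k X *v psi w) (at 0)"
      by (rule vec_tendstoI) (simp add: mat_fil_limit[OF X(2) leading])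
    moreover have "\<forall>\<^sub>F t in at 0. (\<chi> i. t powi k * (X *v \<phi> (t *s w)) $ i / t ^ d i) = M t (c t)"
      using inU by eventually_elim (simp add: c)
    ultimately show "((\<lambda>t. M t (c t)) \<longlongrightarrow> mat_part d k X *v psi w) (at 0)"
      by (rule Lim_transform_eventually)
  qed simp
  then show ?thesis
    by (auto simp: L_def)
qed

lemma inf_aut_leading_part_model:
  "X \<in> inf_aut C \<Longrightarrow> X \<in> mat_fil d k \<Longrightarrow> mat_part d k X \<in> inf_aut model"
  using tangent_leading_part by (intro tangent_imp_inf_aut) blast

lemmas dim_inf_aut_le =
  dim_le_of_leading_parts[OF subspace_inf_aut subspace_inf_aut inf_aut_leading_part_model]

lemmas leading_parts_onto =
  leading_parts_of_dim_eq[OF subspace_inf_aut subspace_inf_aut inf_aut_leading_part_model]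

text \<open>For positive \<open>d i\<close>, a constant divided by \<open>t ^ d i\<close> can
  converge only if it is 0.\<close>

lemma frame_0: "\<phi> 0 = psi 0"
proof -
  have "\<phi> 0 $ i = psi 0 $ i" for i
  proof -
    have lim: "((\<lambda>t. \<phi> 0 $ i / t ^ d i) \<longlongrightarrow> psi 0 $ i) (at 0)"
      using leading[of 0 i] by simp
    have "((\<lambda>t::complex. t ^ d i) \<longlongrightarrow> 0 ^ d i) (at 0)"
      by (intro tendsto_intros)
    from tendsto_mult[OF lim this]
    have "((\<lambda>t. \<phi> 0 $ i / t ^ d i * t ^ d i) \<longlongrightarrow> psi 0 $ i * 0 ^ d i) (at 0)" .
    moreover have "\<forall>\<^sub>F t in at 0. \<phi> 0 $ i / t ^ d i * t ^ d i = \<phi> 0 $ i"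
      unfolding eventually_at_filter by simp
    ultimately have "((\<lambda>t::complex. \<phi> 0 $ i) \<longlongrightarrow> psi 0 $ i * 0 ^ d i) (at 0)"
      by (rule Lim_transform_eventually)
    then have "\<phi> 0 $ i = psi 0 $ i * 0 ^ d i"
      by (simp add: tendsto_const_iff)
    moreover have "psi 0 $ i * 0 ^ d i = psi 0 $ i"
      using degree_0[of i] by (auto simp: psi_0 axis_def power_0_left)
    ultimately show ?thesis by simp
  qed
  then show ?thesis by (simp add: vec_eq_iff)
qed

lemma leading_derivative_1:
  assumes "d i = 1"
  shows "\<phi>' 0 h $ i = s i [h]"
proof -
  have "((\<lambda>t. t * \<phi>' 0 h $ i / t) \<longlongrightarrow> s i [h]) (at 0)"
    using leading_derivative[of 0 h i] assms by (simp add: dpsi_def)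
  moreover have "\<forall>\<^sub>F t in at 0. t * \<phi>' 0 h $ i / t = \<phi>' 0 h $ i"
    unfolding eventually_at_filter by simp
  ultimately have "((\<lambda>t::complex. \<phi>' 0 h $ i) \<longlongrightarrow> s i [h]) (at 0)"
    by (rule Lim_transform_eventually)
  then show ?thesis
    by (simp add: tendsto_const_iff)
qed

text \<open>The degree 1 coordinates of the frame have injective derivative at 0 by
  \<open>separating\<close>. The lower bound \<open>m\<close> beats a linearization error of
  \<open>m / 2\<close>, so no other zero lies nearby.\<close>

lemma frame_degree_1:
  "\<forall>\<^sub>F w in nhds 0. (\<forall>i. d i = 1 \<longrightarrow> \<phi> w $ i = 0) \<longrightarrow> w = 0"
proof -
  define P :: "complex^'n \<Rightarrow> complex^'n" where "P = (\<lambda>y. \<chi> i. if d i = 1 then y $ i else 0)"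
  have P: "bounded_linear P"
    unfolding P_def by (rule linear_conv_bounded_linear[THEN iffD1], rule linearI) (auto simp: vec_eq_iff)
  have der: "((\<lambda>w. P (\<phi> w)) has_derivative (\<lambda>h. P (\<phi>' 0 h))) (at 0)"
    by (rule bounded_linear.has_derivative[OF P frame_derivative[OF U(2)]])
  have lin: "linear (\<lambda>h. P (\<phi>' 0 h))"
    using der by (rule has_derivative_linear)
  have "inj (\<lambda>h. P (\<phi>' 0 h))"
    unfolding linear_injective_0[OF lin]
  proof (intro allI impI)
    fix h assume "P (\<phi>' 0 h) = 0"
    then have "s i [h] = 0" if "d i = 1" for i
      using leading_derivative_1[OF that, of h] that by (auto simp: P_def vec_eq_iff split: if_splits)
    then show "h = 0"
      by (rule separating)
  qed
  then obtain m where m: "m > 0" "\<And>h. m * norm h \<le> norm (P (\<phi>' 0 h))"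
    using linear_inj_bounded_below_pos[OF lin] by metis
  have P0: "P (\<phi> 0) = 0"
    using degree_0[of i0] by (auto simp: P_def frame_0 psi_0 vec_eq_iff axis_def)
  have "\<forall>e>0. \<exists>\<delta>>0. \<forall>w. norm w < \<delta> \<longrightarrow> norm (P (\<phi> w) - P (\<phi>' 0 w)) \<le> e * norm w"
    using der unfolding has_derivative_at_alt by (simp add: P0)
  from this[rule_format, OF half_gt_zero[OF m(1)]] obtain \<delta> where \<delta>: "\<delta> > 0"
    "\<And>w. norm w < \<delta> \<Longrightarrow> norm (P (\<phi> w) - P (\<phi>' 0 w)) \<le> m / 2 * norm w"
    by blast
  have "w = 0" if "norm w < \<delta>" "\<forall>i. d i = 1 \<longrightarrow> \<phi> w $ i = 0" for w
  proof -
    have "P (\<phi> w) = 0"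
      using that(2) by (auto simp: P_def vec_eq_iff)
    then have "m * norm w \<le> m / 2 * norm w"
      using \<delta>(2)[OF that(1)] m(2)[of w] by simp
    then show "w = 0"
      using m(1) by simp
  qed
  then show ?thesis
    using \<delta>(1) unfolding eventually_nhds_metric dist_norm by auto
qed

text \<open>Rescaling by \<open>t\<close> tending to 0 moves \<open>y\<close> towards a nonzero
  multiple of \<open>\<phi> 0\<close> and keeps its degree 1 coordinates 0. By
  \<open>frame_degree_1\<close> the lifted chart points are eventually 0, so some rescaled copy of
  \<open>y\<close> is already a multiple of \<open>psi 0\<close>, a vector that rescaling back
  leaves fixed.\<close>

lemma model_superset:
  assumes E: "degree_mat d \<in> inf_aut C"
    and y: "y \<in> C" "y $ i0 \<noteq> 0" and low: "\<And>i. d i = 1 \<Longrightarrow> y $ i = 0"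
  shows "y \<in> model"
proof -
  define c where "c = y $ i0 / s i0 []"
  define t :: "nat \<Rightarrow> complex" where "t = (\<lambda>n. inverse (of_nat (Suc n)))"
  have t0: "t n \<noteq> 0" for n
    unfolding t_def by (simp del: of_nat_Suc)
  have t_lim: "t \<longlonglongrightarrow> 0"
    unfolding t_def by (rule lim_inverse_n[THEN LIMSEQ_Suc])
  define x where "x = (\<lambda>n. rescale d (t n) *v y)"
  have c: "c \<noteq> 0"
    using y s_i0 by (simp add: c_def)
  have c0: "c *s \<phi> 0 = y $ i0 *s axis i0 1"
    using s_i0 by (simp add: frame_0 psi_0 c_def)
  have "x \<longlonglongrightarrow> c *s \<phi> 0"
  proof (rule vec_tendstoI)
    fix i
    have "(\<lambda>n. t n ^ d i * y $ i) \<longlonglongrightarrow> 0 ^ d i * y $ i"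
      by (intro tendsto_intros t_lim)
    moreover have "0 ^ d i * y $ i = (c *s \<phi> 0) $ i"
      using degree_0[of i] unfolding c0 by (auto simp: axis_def power_0_left)
    ultimately show "(\<lambda>n. x n $ i) \<longlonglongrightarrow> (c *s \<phi> 0) $ i"
      by (simp add: x_def rescale_mult)
  qed
  moreover have "x n \<in> C" for n
    unfolding x_def by (rule rescale_mem[OF E closed y(1) t0])
  ultimately obtain a v where av: "v \<longlonglongrightarrow> 0" "\<forall>\<^sub>F n in sequentially. x n = a n *s \<phi> (v n) \<and> v n \<in> U"
    "a \<longlonglongrightarrow> c"
    using lifting[OF U(2) c, of x] by blast
  have "\<forall>\<^sub>F n in sequentially. x n = a n *s \<phi> 0"
    using av(2) eventually_compose_filterlim[OF frame_degree_1 av(1)] tendsto_imp_eventually_ne[OF av(3) c]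
  proof eventually_elim
    case (elim n)
    have "\<phi> (v n) $ i = 0" if "d i = 1" for i
    proof -
      have "a n * \<phi> (v n) $ i = x n $ i"
        using elim(1) by simp
      also have "\<dots> = 0"
        using low[OF that] by (simp add: x_def rescale_mult)
      finally show ?thesis
        using elim(3) by simp
    qed
    then have "v n = 0"
      using elim(2) by blast
    then show ?case
      using elim(1) by simp
  qed
  then obtain n where n: "x n = a n *s \<phi> 0"
    using eventually_happens'[OF sequentially_bot] by blast
  have "y = rescale d (inverse (t n)) *v x n"
    using rescale_inverse[of "inverse (t n)" d] t0[of n] by (simp add: x_def matrix_vector_mul_assoc)
  also have "\<dots> = (a n * s i0 []) *s (rescale d (inverse (t n)) *v axis i0 1)"
    by (simp add: n frame_0 psi_0 vec.scale)
  also have "rescale d (inverse (t n)) *v axis i0 1 = axis i0 1"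
    using degree_0[of i0] by (auto simp: rescale_mult vec_eq_iff axis_def)
  finally have "y = a n *s psi 0"
    by (simp add: psi_0)
  then show ?thesis
    unfolding model_def by blast
qed

text \<open>Once the ideal of the cone is graded, translations reduce a general point to a point without
  coordinates of degree \<open>1\<close>.\<close>

lemma open_orbit:
  assumes E: "degree_mat d \<in> inf_aut C"
    and eq: "cmat.dim (inf_aut C) = cmat.dim (inf_aut model)"
  shows "model \<subseteq> C" and "y \<in> C \<Longrightarrow> y $ i0 \<noteq> 0 \<Longrightarrow> y \<in> model"
proof -
  \<comment> \<open>Equality of dimensions yields an element with leading part
    \<open>mult_mat v\<close>; since the grading element is present, the leading part itself belongs
    to the algebra.\<close>
  have mult_mat: "mult_mat v \<in> inf_aut C" for v
  proof -
    obtain X where X: "X \<in> inf_aut C" "X \<in> mat_fil d 1" "mat_part d 1 X = mult_mat v"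
      using leading_parts_onto[OF _ _ eq mult_mat_inf_aut[of v] mult_mat_degree(1)[of v]] mult_mat_degree(2)[of v] by auto
    then show ?thesis
      using inf_aut_leading_part[OF E closed X(1,2)] by simp
  qed
  have exp_mem: "cexp (mult_mat v) z *v y \<in> C" if "y \<in> C" for y v z
    using inf_aut_cexp[OF mult_mat that] closed by simp
  have "psi v \<in> C" for v
    using exp_mem[of "psi 0" v 1] frame_mem[OF U(2)] cexp_mult_mat[of v 1 v] by (simp add: frame_0)
  then show "model \<subseteq> C"
    using cone by (auto simp: model_def)
  assume y: "y \<in> C" "y $ i0 \<noteq> 0"
  \<comment> \<open>Chosen so that translation by \<open>v\<close> cancels every degree 1
    coordinate; this is where \<open>y $ i0\<close> has to be nonzero.\<close>
  obtain v where v: "\<And>i. d i = 1 \<Longrightarrow> s i [v] = - (y $ i * s i0 [] / y $ i0)"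
    using interpolating[of "\<lambda>i. - (y $ i * s i0 [] / y $ i0)"] by blast
  define z where "z = cexp (mult_mat v) 1 *v y"
  have "z \<in> model"
  proof (rule model_superset[OF E])
    show "z \<in> C"
      unfolding z_def by (rule exp_mem[OF y(1)])
    show "z $ i0 \<noteq> 0"
      using y(2) by (simp add: z_def cexp_mult_mat_low)
    show "z $ i = 0" if "d i = 1" for i
      using that y(2) s_i0 by (simp add: z_def cexp_mult_mat_low v)
  qed
  then obtain c w where "z = c *s psi w"
    by (auto simp: model_def)
  then have "cexp (mult_mat v) (- 1) *v z = c *s (cexp (mult_mat v) (- 1) *v psi w)"
    by (simp add: vec.scale)
  moreover have "cexp (mult_mat v) (- 1) *v z = y"
    using cexp_inverse[of "mult_mat v" "- 1"] by (simp add: z_def matrix_vector_mul_assoc)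
  ultimately have "y = c *s (cexp (mult_mat v) (- 1) *v psi w)"
    by simp
  also have "cexp (mult_mat v) (- 1) *v psi w = psi (w - v)"
    using cexp_mult_mat[of v "- 1" "w - v"] by (simp add: vec.scale_minus_left)
  finally show "y \<in> model"
    unfolding model_def by blast
qed

text \<open>The degree 0 part of \<open>u\<close> is the identity, so the leading terms of the frame
  are unchanged.\<close>

lemma unipotent_transport:
  assumes u: "u - mat 1 \<in> mat_fil d (- 1)" and uN: "u ** N = mat 1" "N ** u = mat 1"
  shows "adapted_frame d s i0 ((*v) u ` C) (\<lambda>w. u *v \<phi> w) (\<lambda>w h. u *v \<phi>' w h) U"
proof -
  interpret frame': cone_frame "(*v) u ` C" "\<lambda>w. u *v \<phi> w" "\<lambda>w h. u *v \<phi>' w h" U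
    by (rule transport[OF uN])
  have fil: "u \<in> mat_fil d 0"
    unfolding mat_fil_def mem_Collect_eq
  proof (intro allI impI)
    fix i j assume ij: "0 < int (d i) - int (d j)"
    then have "(u - mat 1) $ i $ j = 0"
      using u by (auto simp: mat_fil_def)
    then show "u $ i $ j = 0"
      using ij by (auto simp: mat_def split: if_splits)
  qed
  have "(u - mat 1) $ i $ j = 0" if "d i = d j" for i j
    using u that by (auto simp: mat_fil_def)
  then have "mat_part d 0 u = mat 1"
    by (auto simp: vec_eq_iff mat_def)
  then have lim: "((\<lambda>t. (u *v f t) $ i / t ^ d i) \<longlongrightarrow> L $ i) (at 0)"
    if "\<And>j. ((\<lambda>t. f t $ j / t ^ d j) \<longlongrightarrow> L $ j) (at 0)" for f :: "complex \<Rightarrow> complex^'n" and L i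
    using mat_fil_limit[OF fil, of f L i] that by simp
  show ?thesis
  proof
    show "((\<lambda>t. (u *v \<phi> (t *s w)) $ i / t ^ d i) \<longlongrightarrow> psi w $ i) (at 0)" for w i
      by (rule lim) (rule leading)
    show "((\<lambda>t. t * (u *v \<phi>' (t *s w) h) $ i / t ^ d i) \<longlongrightarrow> dpsi w h $ i) (at 0)" for w h i
      using lim[of "\<lambda>t. t *s \<phi>' (t *s w) h" "dpsi w h" i] leading_derivative by (simp add: vec.scale)
  qed
qed

text \<open>Equality of dimensions is used twice: in degree 0 to find an element with leading part
  the degree matrix and, since conjugation preserves dimension, in degree 1 after the change of
  coordinates.\<close>

theorem equality_case:
  assumes eq: "cmat.dim (inf_aut C) = cmat.dim (inf_aut model)"
  obtains M N :: "complex^'n^'n" where "M ** N = mat 1" "N ** M = mat 1"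
    "model \<subseteq> (*v) M ` C" "\<And>y. y \<in> (*v) M ` C \<Longrightarrow> y $ i0 \<noteq> 0 \<Longrightarrow> y \<in> model"
    "(M *v \<phi> 0) $ i0 \<noteq> 0"
proof -
  have E: "degree_mat d \<in> mat_fil d 0" "mat_part d 0 (degree_mat d) = degree_mat d"
    by (auto simp: mat_fil_def degree_mat_def vec_eq_iff)
  obtain X where X: "X \<in> inf_aut C" "X \<in> mat_fil d 0" "mat_part d 0 X = degree_mat d"
    using leading_parts_onto[OF _ _ eq degree_mat_inf_aut E(1)] E(2) by auto
  then have "X - degree_mat d \<in> mat_fil d (- 1)"
    using mat_fil_minus_part[OF X(2)] by simp
  then obtain u where u: "u - mat 1 \<in> mat_fil d (- 1)" "u ** X = degree_mat d ** u"
    by (rule degree_mat_conjugation)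
  obtain N where N: "u ** N = mat 1" "N ** u = mat 1"
    using unipotent_invertible[OF u(1)] by blast
  interpret conj: adapted_frame d s i0 "(*v) u ` C" "\<lambda>w. u *v \<phi> w" "\<lambda>w h. u *v \<phi>' w h" U
    by (rule unipotent_transport[OF u(1) N])
  have "u ** X ** N = degree_mat d"
    by (simp add: u(2) matrix_mul_assoc[symmetric] N)
  then have "degree_mat d \<in> inf_aut ((*v) u ` C)"
    using inf_aut_conjugate[OF N X(1)] by simp
  moreover have "cmat.dim (inf_aut ((*v) u ` C)) = cmat.dim (inf_aut model)"
    by (simp add: dim_inf_aut_matrix_image[OF N] eq)
  ultimately have "model \<subseteq> (*v) u ` C" "\<And>y. y \<in> (*v) u ` C \<Longrightarrow> y $ i0 \<noteq> 0 \<Longrightarrow> y \<in> model"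
    using conj.open_orbit by blast+
  \<comment> \<open>This point will show that the cone does not lie in the hyperplane.\<close>
  moreover have "(u *v \<phi> 0) $ i0 \<noteq> 0"
    unfolding conj.frame_0 using s_i0 by (simp add: psi_0)
  ultimately show thesis
    using that N by blast
qed

end

section \<open>Projective varieties and their cones\<close>

lemma proj_space_iff: "L \<in> proj_space \<longleftrightarrow> (\<exists>v. v \<noteq> 0 \<and> L = range (\<lambda>c. c *s v))"
proof
  assume "L \<in> proj_space"
  then have L: "vec.subspace L" "vec.dim L = 1"
    by (simp_all add: proj_space_def)
  obtain B where B: "B \<subseteq> L" "vec.independent B" "L \<subseteq> vec.span B" "card B = 1"
    using vec.basis_exists[of L] L(2) by metis
  then obtain v where v: "B = {v}"
    using card_1_singletonE by metis
  then have "v \<noteq> 0" "L = vec.span {v}"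
    using B L(1) vec.span_minimal[of B L] by (auto simp: vec.dependent_single)
  then show "\<exists>v. v \<noteq> 0 \<and> L = range (\<lambda>c. c *s v)"
    by (auto simp: vec.span_singleton)
next
  assume "\<exists>v. v \<noteq> 0 \<and> L = range (\<lambda>c. c *s v)"
  then obtain v where v: "v \<noteq> 0" "L = vec.span {v}"
    by (auto simp: vec.span_singleton)
  then have "vec.dim L = 1"
    using vec.dim_span_eq_card_independent[of "{v}"] by (simp add: vec.dependent_single)
  then show "L \<in> proj_space"
    using v vec.subspace_span[of "{v}"] by (simp add: proj_space_def)
qed

lemma proj_space_eq_line:
  assumes "L \<in> proj_space" "v \<in> L" "v \<noteq> 0"
  shows "L = range (\<lambda>c. c *s v)"
proof -
  obtain w where w: "L = range (\<lambda>c. c *s w)"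
    using assms(1) proj_space_iff by blast
  then obtain a where a: "v = a *s w"
    using assms(2) by blast
  then have "a \<noteq> 0"
    using assms(3) by auto
  then have "c *s w = (c / a) *s v" for c
    by (simp add: a)
  moreover have "c *s v = (c * a) *s w" for c
    by (simp add: a)
  ultimately show ?thesis
    unfolding w by blast
qed

lemma line_image:
  fixes M :: "complex^'n^'m"
  shows "(*v) M ` range (\<lambda>c. c *s v) = range (\<lambda>c. c *s (M *v v))"
  by (simp add: image_image vec.scale)

lemma proj_space_image:
  fixes M :: "complex^'n^'m"
  assumes "N ** M = mat 1" "L \<in> proj_space"
  shows "(*v) M ` L \<in> proj_space"
proof -
  obtain v where v: "v \<noteq> 0" "L = range (\<lambda>c. c *s v)"
    using assms(2) proj_space_iff by blast
  have "N *v (M *v v) = v"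
    by (simp add: matrix_vector_mul_assoc assms(1))
  then have "M *v v \<noteq> 0"
    using v(1) by auto
  then show ?thesis
    using v(2) by (auto simp: proj_space_iff line_image)
qed

lemma proj_space_in_variety:
  assumes "Z \<subseteq> proj_space" "L \<in> proj_space" "L \<subseteq> affine_cone Z"
  shows "L \<in> Z"
proof -
  obtain v where v: "v \<noteq> 0" "L = range (\<lambda>c. c *s v)"
    using assms(2) proj_space_iff by blast
  then have "v \<in> L"
    by (auto intro: range_eqI[of _ _ 1])
  then obtain L' where "L' \<in> Z" "v \<in> L'"
    using assms(3) v(1) by (auto simp: affine_cone_def)
  moreover from this have "L' = L"
    using proj_space_eq_line[of L' v] assms(1) v by auto
  ultimately show ?thesis
    by simp
qed

lemma affine_cone_lines:
  assumes "\<And>c v. v \<in> K \<Longrightarrow> c *s v \<in> K" "0 \<in> K"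
  shows "affine_cone {L \<in> proj_space. L \<subseteq> K} = K"
proof
  show "K \<subseteq> affine_cone {L \<in> proj_space. L \<subseteq> K}"
  proof
    fix v assume v: "v \<in> K"
    show "v \<in> affine_cone {L \<in> proj_space. L \<subseteq> K}"
    proof (cases "v = 0")
      case False
      then have "range (\<lambda>c. c *s v) \<in> proj_space" "range (\<lambda>c. c *s v) \<subseteq> K" "v \<in> range (\<lambda>c. c *s v)"
        using assms(1)[OF v] by (auto simp: proj_space_iff intro: range_eqI[of _ _ 1])
      then show ?thesis
        unfolding affine_cone_def by blast
    qed (simp add: affine_cone_def)
  qed
qed (use assms(2) in \<open>auto simp: affine_cone_def\<close>)

lemma affine_cone_linear_image:
  assumes "f 0 = 0"
  shows "affine_cone ((\<lambda>L. f ` L) ` Z) = f ` affine_cone Z"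
  using assms by (auto simp: affine_cone_def)

lemma variety_image_eq:
  fixes M :: "complex^'n^'m"
  assumes MN: "M ** N = mat 1" "N ** M = mat 1"
    and Z: "Z \<subseteq> proj_space" and K: "(*v) M ` affine_cone Z = K"
  shows "(\<lambda>L. (*v) M ` L) ` Z = {L \<in> proj_space. L \<subseteq> K}"
proof (intro equalityI subsetI)
  fix L assume "L \<in> (\<lambda>L. (*v) M ` L) ` Z"
  then obtain L' where L': "L' \<in> Z" "L = (*v) M ` L'"
    by blast
  then have "L' \<subseteq> affine_cone Z"
    by (auto simp: affine_cone_def)
  then show "L \<in> {L \<in> proj_space. L \<subseteq> K}"
    using L' proj_space_image[OF MN(2), of L'] Z K by auto
next
  fix L assume L: "L \<in> {L \<in> proj_space. L \<subseteq> K}"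
  have NM: "N *v (M *v y) = y" "M *v (N *v z) = z" for y z
    by (simp_all add: matrix_vector_mul_assoc MN)
  have "(*v) N ` L \<subseteq> affine_cone Z"
    using L K by (auto simp: NM)
  moreover have "(*v) N ` L \<in> proj_space"
    using L proj_space_image[OF MN(1)] by blast
  ultimately have "(*v) N ` L \<in> Z"
    by (intro proj_space_in_variety[OF Z])
  moreover have "L = (*v) M ` (*v) N ` L"
    by (simp add: image_image NM)
  ultimately show "L \<in> (\<lambda>L. (*v) M ` L) ` Z"
    by blast
qed

section \<open>Homogeneous polynomials and cones\<close>

lemma homogeneous_scale:
  assumes "homogeneous p" "p v = 0" "c \<noteq> 0 \<or> p 0 = 0"
  shows "p (c *s v) = 0"
proof -
  obtain k where "\<And>c v. p (c *s v) = c ^ k * p v"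
    using assms(1) by (auto simp: homogeneous_def)
  then show ?thesis
    using assms by simp
qed

lemma homogeneous_matrix_comp:
  assumes "homogeneous p"
  shows "homogeneous (\<lambda>v. p (M *v v))"
proof -
  obtain k where "\<And>c v. p (c *s v) = c ^ k * p v"
    using assms by (auto simp: homogeneous_def)
  then have "p (M *v (c *s v)) = c ^ k * p (M *v v)" for c v
    by (simp add: vec.scale)
  then show ?thesis
    by (auto simp: homogeneous_def)
qed

text \<open>Nonemptiness of \<open>Z\<close> forces every \<open>p\<close> in \<open>P\<close> to
  vanish at the origin, which \<open>affine_cone\<close> contains by definition; a nonzero constant
  in \<open>P\<close> would cut out the empty set.\<close>

lemma affine_cone_zero_set:
  fixes Z :: "(complex^'n) set set"
  assumes Z: "Z = {L \<in> proj_space. \<forall>p\<in>P. \<forall>v\<in>L. p v = 0}" "Z \<noteq> {}"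
    and P: "\<And>p. p \<in> P \<Longrightarrow> homogeneous p"
  shows "affine_cone Z = {v. \<forall>p\<in>P. p v = 0}"
proof -
  obtain L where L: "L \<in> Z"
    using Z(2) by blast
  then have "L \<in> proj_space"
    unfolding Z(1) by simp
  then obtain w where w: "L = range (\<lambda>c. c *s w)"
    unfolding proj_space_iff by blast
  then have "0 \<in> L"
    by (auto intro: range_eqI[of _ _ 0])
  then have zero: "p 0 = 0" if "p \<in> P" for p
    using L that unfolding Z(1) by blast
  have "affine_cone {L \<in> proj_space. L \<subseteq> {v. \<forall>p\<in>P. p v = 0}} = {v. \<forall>p\<in>P. p v = 0}"
    by (rule affine_cone_lines) (use homogeneous_scale[OF P] zero in auto)
  moreover have "{L \<in> proj_space. L \<subseteq> {v. \<forall>p\<in>P. p v = 0}} = Z"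
    unfolding Z(1) by blast
  ultimately show ?thesis
    by (simp only:)
qed

lemma proj_closed_cone:
  fixes Z :: "(complex^'n) set set"
  assumes "proj_closed Z" "Z \<noteq> {}"
  shows "zariski_closure (affine_cone Z) = affine_cone Z"
    and "v \<in> affine_cone Z \<Longrightarrow> c *s v \<in> affine_cone Z"
    and "Z \<subseteq> proj_space"
proof -
  obtain P where P: "\<And>p. p \<in> P \<Longrightarrow> poly_fun p" "\<And>p. p \<in> P \<Longrightarrow> homogeneous p"
    "Z = {L \<in> proj_space. \<forall>p\<in>P. \<forall>v\<in>L. p v = 0}"
    using assms(1) unfolding proj_closed_def by blast
  have cone: "affine_cone Z = {v. \<forall>p\<in>P. p v = 0}"
    by (rule affine_cone_zero_set[OF P(3) assms(2)]) (rule P(2))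
  have "zariski_closure (affine_cone Z) \<subseteq> affine_cone Z"
    unfolding cone zariski_closure_def using P(1) by auto
  then show "zariski_closure (affine_cone Z) = affine_cone Z"
    using zariski_closure_superset by blast
  show "Z \<subseteq> proj_space"
    unfolding P(3) by blast
  show "c *s v \<in> affine_cone Z" if "v \<in> affine_cone Z"
  proof -
    have "p 0 = 0" if "p \<in> P" for p
      using cone that by (auto simp: affine_cone_def)
    then show ?thesis
      using that unfolding cone by (auto intro: homogeneous_scale[OF P(2)])
  qed
qed

text \<open>The coefficient functions of \<open>c \<mapsto> p (c v)\<close> are the homogeneous components of \<open>p\<close>.\<close>

lemma homogeneous_components:
  fixes p :: "complex^'n \<Rightarrow> complex"
  assumes "poly_fun p"
  shows "\<exists>q. (\<forall>v c. poly (q v) c = p (c *s v)) \<and> (\<forall>k. poly_fun (\<lambda>v. coeff (q v) k)) \<and>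
    (\<forall>k c v. coeff (q (c *s v)) k = c ^ k * coeff (q v) k)"
  using assms
proof induction
  case (poly_const a)
  have "poly_fun (\<lambda>v::complex^'n. coeff [:a:] k)" for k
    by (rule poly_fun.intros)
  moreover have "coeff [:a:] k = c ^ k * coeff [:a:] k" for k and c :: complex
    by (cases k) auto
  ultimately show ?case
    by (intro exI[of _ "\<lambda>v. [:a:]"]) auto
next
  case (poly_coord i)
  have "poly_fun (\<lambda>v::complex^'n. coeff [:0, v $ i:] k)" for k
    by (cases k; cases "k - 1") (auto simp: coeff_pCons intro: poly_fun.intros split: nat.split)
  moreover have "coeff [:0, c * v $ i:] k = c ^ k * coeff [:0, v $ i:] k" for k and c :: complex and v :: "complex^'n"
    by (cases k; cases "k - 1") (auto simp: coeff_pCons split: nat.split)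
  ultimately show ?case
    by (intro exI[of _ "\<lambda>v. [:0, v $ i:]"]) auto
next
  case (poly_add p p')
  obtain q where q: "\<And>v c. poly (q v) c = p (c *s v)" "\<And>k. poly_fun (\<lambda>v. coeff (q v) k)"
    "\<And>k c v. coeff (q (c *s v)) k = c ^ k * coeff (q v) k"
    using poly_add.IH(1) by blast
  obtain q' where q': "\<And>v c. poly (q' v) c = p' (c *s v)" "\<And>k. poly_fun (\<lambda>v. coeff (q' v) k)"
    "\<And>k c v. coeff (q' (c *s v)) k = c ^ k * coeff (q' v) k"
    using poly_add.IH(2) by blast
  show ?case
    by (intro exI[of _ "\<lambda>v. q v + q' v"])
      (auto simp: q(1,3) q'(1,3) algebra_simps intro!: poly_fun.intros q(2) q'(2))
next
  case (poly_mult p p')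
  obtain q where q: "\<And>v c. poly (q v) c = p (c *s v)" "\<And>k. poly_fun (\<lambda>v. coeff (q v) k)"
    "\<And>k c v. coeff (q (c *s v)) k = c ^ k * coeff (q v) k"
    using poly_mult.IH(1) by blast
  obtain q' where q': "\<And>v c. poly (q' v) c = p' (c *s v)" "\<And>k. poly_fun (\<lambda>v. coeff (q' v) k)"
    "\<And>k c v. coeff (q' (c *s v)) k = c ^ k * coeff (q' v) k"
    using poly_mult.IH(2) by blast
  have "coeff (q (c *s v) * q' (c *s v)) k = c ^ k * coeff (q v * q' v) k" for k c v
  proof -
    have "c ^ i * a * (c ^ (k - i) * b) = c ^ k * (a * b)" if "i \<le> k" for i a b
      using that power_add[of c i "k - i"] by simp
    then show ?thesis
      unfolding coeff_mult q(3) q'(3) sum_distrib_left by (intro sum.cong) auto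
  qed
  moreover have "poly_fun (\<lambda>v. coeff (q v * q' v) k)" for k
    unfolding coeff_mult by (intro poly_fun_sum poly_fun.intros q(2) q'(2))
  ultimately show ?case
    by (intro exI[of _ "\<lambda>v. q v * q' v"]) (auto simp: q(1) q'(1))
qed

text \<open>For \<open>p\<close> vanishing on the cone and \<open>y\<close> in \<open>K\<close>, the
  polynomial \<open>c \<mapsto> p (c y)\<close> is zero, so every homogeneous component of
  \<open>p\<close> vanishes on \<open>K\<close>. Hence homogeneous polynomials already cut out the
  closure.\<close>

lemma zariski_closure_homogeneous:
  assumes K: "\<And>c v. v \<in> K \<Longrightarrow> c *s v \<in> K"
    and v: "\<And>p. poly_fun p \<Longrightarrow> homogeneous p \<Longrightarrow> (\<forall>y\<in>K. p y = 0) \<Longrightarrow> p v = 0"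
  shows "v \<in> zariski_closure K"
proof -
  have "p v = 0" if p: "poly_fun p" "\<forall>y\<in>K. p y = 0" for p
  proof -
    obtain q where q: "\<And>v c. poly (q v) c = p (c *s v)" "\<And>k. poly_fun (\<lambda>v. coeff (q v) k)"
      "\<And>k c v. coeff (q (c *s v)) k = c ^ k * coeff (q v) k"
      using homogeneous_components[OF p(1)] by blast
    have "q y = 0" if "y \<in> K" for y
      using q(1)[of y] p(2) K[OF that] poly_all_0_iff_0[of "q y"] by simp
    then have "coeff (q v) k = 0" for k
      using q(3) by (intro v q(2)) (auto simp: homogeneous_def)
    then have "q v = 0"
      by (simp add: poly_eq_iff)
    then show ?thesis
      using q(1)[of v 1] by simp
  qed
  then show ?thesis
    by (simp add: zariski_closure_def)
qed

lemma bij_linear_matrix: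
  fixes f :: "complex^'n \<Rightarrow> complex^'m"
  assumes "Vector_Spaces.linear (*s) (*s) f" "bij f"
  obtains M N where "f = (*v) M" "M ** N = mat 1" "N ** M = mat 1"
proof -
  have f: "f = (*v) (matrix f)"
    using matrix_works[OF assms(1)] by auto
  obtain N where N: "N ** matrix f = mat 1"
    using matrix_left_invertible_injective[of "matrix f"] assms(2) f by (auto simp: bij_def)
  obtain N' where N': "matrix f ** N' = mat 1"
    using matrix_right_invertible_surjective[of "matrix f"] assms(2) f by (auto simp: bij_def)
  have "N = N ** (matrix f ** N')"
    by (simp add: N')
  also have "\<dots> = N'"
    by (simp add: matrix_mul_assoc N)
  finally show thesis
    using that[OF f] N N' by blast
qed

text \<open>The variety is the union of its part over the closure of \<open>K\<close> and its part over the hyperplane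
  where coordinate \<open>i\<close> vanishes; irreducibility and the point \<open>x\<close> exclude the latter.\<close>

lemma irreducible_cone_subset:
  fixes Z :: "(complex^'n) set set" and M :: "complex^'n^'n"
  assumes Z: "projective_variety Z"
    and K: "\<And>c v. v \<in> K \<Longrightarrow> c *s v \<in> K"
    and dense: "\<And>v. v \<in> affine_cone Z \<Longrightarrow> (M *v v) $ i \<noteq> 0 \<Longrightarrow> M *v v \<in> K"
    and x: "x \<in> Z" "v0 \<in> x" "(M *v v0) $ i \<noteq> 0"
  shows "(*v) M ` affine_cone Z \<subseteq> zariski_closure K"
proof -
  obtain P where P: "\<forall>p\<in>P. poly_fun p \<and> homogeneous p"
    "Z = {L \<in> proj_space. \<forall>p\<in>P. \<forall>v\<in>L. p v = 0}"
    using Z unfolding projective_variety_def proj_closed_def by blast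
  have ne: "Z \<noteq> {}"
    using x by blast
  define l where "l = (\<lambda>v. (M *v v) $ i)"
  \<comment> \<open>\<open>proj_closed\<close> admits only homogeneous equations; by
    \<open>zariski_closure_homogeneous\<close> those vanishing on \<open>K\<close> still describe
    its closure. Pulled back along \<open>M\<close>, they become equations for
    \<open>Z\<close>.\<close>
  define Q where "Q = (\<lambda>p v. p (M *v v) :: complex) ` {p. poly_fun p \<and> homogeneous p \<and> (\<forall>y\<in>K. p y = 0)}"
  define A where "A = {L \<in> proj_space. \<forall>p\<in>P \<union> Q. \<forall>v\<in>L. p v = 0}"
  define B where "B = {L \<in> proj_space. \<forall>p\<in>insert l P. \<forall>v\<in>L. p v = 0}"
  have "proj_closed B"
    unfolding proj_closed_def
  proof (intro exI conjI)
    have "homogeneous l"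
      unfolding homogeneous_def l_def by (intro exI[of _ 1]) (simp add: vec.scale)
    moreover have "poly_fun l"
      unfolding l_def by (intro poly_fun_matrix_comp poly_fun.intros)
    ultimately show "\<forall>p\<in>insert l P. poly_fun p \<and> homogeneous p"
      using P(1) by auto
  qed (rule B_def)
  moreover have "proj_closed A"
    unfolding proj_closed_def
  proof (intro exI conjI)
    show "\<forall>p\<in>P \<union> Q. poly_fun p \<and> homogeneous p"
      using P(1) poly_fun_matrix_comp[of _ M] homogeneous_matrix_comp[of _ M] by (auto simp: Q_def)
  qed (rule A_def)
  moreover have "Z = A \<union> B"
  proof (intro equalityI subsetI)
    fix L assume L: "L \<in> Z"
    then have "L \<in> proj_space"
      unfolding P(2) by simp
    then obtain v where v: "L = range (\<lambda>c. c *s v)"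
      unfolding proj_space_iff by blast
    then have "v \<in> L"
      by (auto intro: range_eqI[of _ _ 1])
    then have vC: "v \<in> affine_cone Z"
      using L by (auto simp: affine_cone_def)
    show "L \<in> A \<union> B"
    proof (cases "l v = 0")
      case True
      then have "L \<in> B"
        using L P(2) by (auto simp: B_def v l_def vec.scale)
      then show ?thesis by blast
    next
      case False
      then have "M *v v \<in> K"
        using dense[OF vC] by (simp add: l_def)
      then have "L \<in> A"
        using L P(2) K by (auto simp: A_def Q_def v vec.scale)
      then show ?thesis by blast
    qed
  qed (auto simp: A_def B_def P(2))
  ultimately have "Z = A \<or> Z = B"
    using Z unfolding projective_variety_def by blast
  moreover have "Z \<noteq> B"
    using x by (auto simp: B_def l_def)
  ultimately have ZA: "Z = A"
    by blast
  have "M *v v \<in> zariski_closure K" if "v \<in> affine_cone Z" for v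
  proof (rule zariski_closure_homogeneous[OF K])
    fix p :: "complex^'n \<Rightarrow> complex"
    assume p: "poly_fun p" "homogeneous p" "\<forall>y\<in>K. p y = 0"
    then have Q: "(\<lambda>v. p (M *v v)) \<in> Q"
      by (auto simp: Q_def)
    have eq: "affine_cone Z = {v. \<forall>p\<in>P \<union> Q. p v = 0}"
    proof (rule affine_cone_zero_set[OF _ ne])
      show "Z = {L \<in> proj_space. \<forall>p\<in>P \<union> Q. \<forall>v\<in>L. p v = 0}"
        using ZA by (simp add: A_def)
      show "homogeneous p" if "p \<in> P \<union> Q" for p
        using that P(1) homogeneous_matrix_comp[of _ M] by (auto simp: Q_def)
    qed
    have "v \<in> {v. \<forall>p\<in>P \<union> Q. p v = 0}"
      using that unfolding eq .
    from bspec[OF CollectD[OF this] UnI2[OF Q]] show "p (M *v v) = 0" .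
  qed
  then show ?thesis
    by blast
qed

section \<open>Linear forms adapted to the filtration by vanishing order\<close>

lemma linear_form_coordinates:
  fixes l :: "complex^'n \<Rightarrow> complex"
  assumes "linear_form l"
  obtains a where "\<And>v. l v = (\<Sum>j\<in>UNIV. a $ j * v $ j)"
proof -
  interpret l: Vector_Spaces.linear "(*s)" "(*)" l by (rule assms)
  have "l v = (\<Sum>j\<in>UNIV. (\<chi> j. l (axis j 1)) $ j * v $ j)" for v
  proof -
    have "l v = l (\<Sum>j\<in>UNIV. v $ j *s axis j 1)"
      by (simp add: basis_expansion)
    also have "\<dots> = (\<Sum>j\<in>UNIV. l (axis j 1) * v $ j)"
      by (simp add: l.sum l.scale mult.commute)
    finally show ?thesis by simp
  qed
  then show thesis by (rule that)
qed

lemma card_le_of_independent_family: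
  fixes a :: "'i \<Rightarrow> complex^'n"
  assumes I: "finite I"
    and indep: "\<And>c i. (\<Sum>i\<in>I. c i *s a i) = 0 \<Longrightarrow> i \<in> I \<Longrightarrow> c i = 0"
  shows "card I \<le> CARD('n)"
proof -
  have inj: "inj_on a I"
  proof (rule inj_onI, rule ccontr)
    fix i j assume ij: "i \<in> I" "j \<in> I" "a i = a j" "i \<noteq> j"
    define c :: "'i \<Rightarrow> complex" where "c = (\<lambda>k. if k = i then 1 else if k = j then - 1 else 0)"
    have "(\<Sum>k\<in>I. c k *s a k) = (\<Sum>k\<in>{i, j}. c k *s a k)"
      by (rule sum.mono_neutral_right) (use I ij in \<open>auto simp: c_def\<close>)
    also have "\<dots> = 0"
      using ij by (simp add: c_def)
    finally have "c i = 0"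
      by (rule indep) (rule ij(1))
    then show False
      by (simp add: c_def)
  qed
  have "vec.independent (a ` I)"
  proof
    assume "vec.dependent (a ` I)"
    then obtain u v where u: "v \<in> a ` I" "u v \<noteq> 0" "(\<Sum>v\<in>a ` I. u v *s v) = 0"
      using vec.dependent_finite[of "a ` I"] I by auto
    then have "(\<Sum>i\<in>I. u (a i) *s a i) = 0"
      by (simp add: sum.reindex[OF inj])
    then have "u (a i) = 0" if "i \<in> I" for i
      using that by (rule indep[of "\<lambda>i. u (a i)"])
    then show False
      using u(1,2) by auto
  qed
  then have "card (a ` I) \<le> vec.dim (UNIV :: (complex^'n) set)"
    by (intro vec.independent_card_le_dim) auto
  then show ?thesis
    by (simp add: card_image[OF inj] card_cart_basis)
qed

text \<open>\<open>a\<close> is the coefficient vector of a linear form whose restriction to the frame vanishes to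
  order \<open>k\<close>, with leading term \<open>s\<close>.\<close>

definition has_leading_form where
  "has_leading_form \<phi> \<phi>' a k s \<longleftrightarrow>
     (\<forall>w. ((\<lambda>t. (\<Sum>j\<in>UNIV. a $ j * \<phi> (t *s w) $ j) / t ^ k) \<longlongrightarrow> s (replicate k w)) (at 0)) \<and>
     (\<forall>w h. ((\<lambda>t. t * (\<Sum>j\<in>UNIV. a $ j * \<phi>' (t *s w) h $ j) / t ^ k) \<longlongrightarrow>
        of_nat k * s (h # replicate (k - 1) w)) (at (0::complex)))"

lemma symbol_has_leading_form:
  fixes \<phi> :: "complex^'d \<Rightarrow> complex^'n"
  assumes \<phi>: "holomorphic_map U \<phi>" "0 \<in> U"
    and S: "cfun.subspace (fundamental_forms \<phi> k)" "fundamental_forms \<phi> k \<subseteq> sym_forms k"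
    and s: "s \<in> fundamental_forms \<phi> k"
  shows "\<exists>a. has_leading_form \<phi> (\<lambda>w. frechet_derivative \<phi> (at w)) a k s"
proof -
  \<comment> \<open>The Taylor coefficient of order \<open>k\<close> is the \<open>k\<close>-th
    derivative divided by \<open>k!\<close>. Starting from \<open>k! s\<close> makes the leading
    term exactly \<open>s\<close>.\<close>
  have "fun_scale (fact k) s \<in> fundamental_forms \<phi> k"
    using S(1) s by (rule cfun.subspace_scale)
  then obtain l where l: "l \<in> dual_filtration \<phi> k"
    "\<And>hs. fact k * s hs = (if length hs = k then derivs_at_0 (l \<circ> \<phi>) hs else 0)"
    unfolding fundamental_forms_def by (auto simp: fun_scale_def fun_eq_iff)
  have van: "derivs_at_0 (l \<circ> \<phi>) hs = 0" if "length hs < k" for hs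
    using l(1) that by (simp add: dual_filtration_def)
  obtain a where a: "\<And>v. l v = (\<Sum>j\<in>UNIV. a $ j * v $ j)"
    using linear_form_coordinates l(1) unfolding dual_filtration_def by blast
  have der: "((l \<circ> \<phi>) has_derivative (\<lambda>h. l (frechet_derivative \<phi> (at w) h))) (at w)"
    "frechet_derivative \<phi> (at w) (c *s h) = c *s frechet_derivative \<phi> (at w) h" if w: "w \<in> U" for w c h
  proof -
    obtain D where D: "(\<phi> has_derivative D) (at w)" "Vector_Spaces.linear (*s) (*s) D"
      using \<phi>(1) w unfolding holomorphic_map_def by blast
    then have eq: "D = frechet_derivative \<phi> (at w)"
      using frechet_derivative_at by blast
    interpret D: Vector_Spaces.linear "(*s)" "(*s)" D by (rule D(2))
    show "frechet_derivative \<phi> (at w) (c *s h) = c *s frechet_derivative \<phi> (at w) h"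
      using D.scale eq by simp
    have "((\<lambda>w. \<phi> w $ j) has_derivative (\<lambda>h. D h $ j)) (at w)" for j
      by (rule bounded_linear.has_derivative[OF bounded_linear_vec_nth D(1)])
    then show "((l \<circ> \<phi>) has_derivative (\<lambda>h. l (frechet_derivative \<phi> (at w) h))) (at w)"
      unfolding o_def a eq[symmetric] by (intro has_derivative_sum has_derivative_mult_right)
  qed
  have "open U"
    using \<phi>(1) by (simp add: holomorphic_map_def)
  have cd: "cdiff_on U (l \<circ> \<phi>)"
    unfolding cdiff_on_def
  proof (intro conjI ballI \<open>open U\<close>)
    fix w assume w: "w \<in> U"
    have "l (frechet_derivative \<phi> (at w) (c *s h)) = c * l (frechet_derivative \<phi> (at w) h)" for c h
      by (simp add: der(2)[OF w] a sum_distrib_left mult.left_commute)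
    then show "\<exists>D. ((l \<circ> \<phi>) has_derivative D) (at w) \<and> (\<forall>c h. D (c *s h) = c * D h)"
      using der(1)[OF w] by blast
  qed
  have "((\<lambda>t. l (\<phi> (t *s w)) / t ^ k) \<longlongrightarrow> s (replicate k w)) (at 0)" for w
  proof -
    have "derivs_at_0 (l \<circ> \<phi>) (replicate k w) / fact k = s (replicate k w)"
      using l(2)[of "replicate k w"] by (simp add: field_simps)
    then show ?thesis
      using leading_term_limit[where k = k and w = w, OF cd \<phi>(2) van] by (simp add: o_def)
  qed
  moreover have "((\<lambda>t. t * l (frechet_derivative \<phi> (at (t *s w)) h) / t ^ k) \<longlongrightarrow>
      of_nat k * s (h # replicate (k - 1) w)) (at 0)" for w h
  proof (rule Lim_transform_eventually)
    have "open ((\<lambda>t. t *s w) -` U)"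
      by (intro open_vimage \<open>open U\<close> continuous_intros)
    then have "\<forall>\<^sub>F t in at 0. t *s w \<in> U"
      using \<phi>(2) eventually_at_in_open'[of "(\<lambda>t. t *s w) -` U" 0] by simp
    then show "\<forall>\<^sub>F t in at 0. t * dir_deriv h (l \<circ> \<phi>) (t *s w) / t ^ k =
        t * l (frechet_derivative \<phi> (at (t *s w)) h) / t ^ k"
    proof eventually_elim
      case (elim t)
      then show ?case
        using dir_deriv_eq[OF cd elim, of h] frechet_derivative_at[OF der(1)[OF elim]] by metis
    qed
    have "(if k = 0 then 0 else derivs_at_0 (l \<circ> \<phi>) (replicate (k - 1) w @ [h]) / fact (k - 1))
        = of_nat k * s (h # replicate (k - 1) w)"
    proof (cases k)
      case (Suc m)
      have "s \<in> sym_forms k"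
        using S(2) s by blast
      then have "s (replicate m w @ [h]) = s (h # replicate m w)"
        by (rule sym_form_mset) simp
      then show ?thesis
        using l(2)[of "replicate m w @ [h]"] by (simp add: Suc field_simps)
    qed simp
    then show "((\<lambda>t. t * dir_deriv h (l \<circ> \<phi>) (t *s w) / t ^ k) \<longlongrightarrow>
        of_nat k * s (h # replicate (k - 1) w)) (at 0)"
      using leading_term_derivative_limit[where k = k and w = w and h = h, OF cd \<phi>(2) van] by simp
  qed
  ultimately show ?thesis
    unfolding has_leading_form_def a by blast
qed

lemma sum_fun_scale_apply: "(\<Sum>i\<in>I. fun_scale (c i) (f i)) x = (\<Sum>i\<in>I. c i * f i x)"
  by (induction I rule: infinite_finite_induct) (auto simp: fun_scale_def)

text \<open>In a linear relation let \<open>k\<close> be the lowest degree with a nonzero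
  coefficient. Restricted to the frame and divided by \<open>t ^ k\<close>, the relation tends to
  one among the forms of degree \<open>k\<close> on the diagonal, which polarization extends to the
  forms themselves.\<close>

lemma leading_forms_independent:
  fixes a :: "'i \<Rightarrow> complex^'n"
  assumes I: "finite I"
    and S: "\<And>k. cfun.subspace (S k)" "\<And>k. S k \<subseteq> sym_forms k"
    and lead: "\<And>i. i \<in> I \<Longrightarrow> has_leading_form \<phi> \<phi>' (a i) (d i) (s i)"
    and s: "\<And>i. i \<in> I \<Longrightarrow> s i \<in> S (d i)"
    and indep: "\<And>k c i. (\<Sum>i\<in>{i\<in>I. d i = k}. fun_scale (c i) (s i)) = 0 \<Longrightarrow> i \<in> I \<Longrightarrow> d i = k \<Longrightarrow> c i = 0"
    and c: "(\<Sum>i\<in>I. c i *s a i) = 0" and i: "i \<in> I"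
  shows "c i = 0"
proof (rule ccontr)
  assume "c i \<noteq> 0"
  then have ex: "\<exists>k i. i \<in> I \<and> c i \<noteq> 0 \<and> d i = k"
    using i by blast
  define k where "k = (LEAST k. \<exists>i. i \<in> I \<and> c i \<noteq> 0 \<and> d i = k)"
  obtain m where m: "m \<in> I" "c m \<noteq> 0" "d m = k"
    using LeastI_ex[OF ex] unfolding k_def by blast
  have k_le: "k \<le> d i" if "i \<in> I" "c i \<noteq> 0" for i
    unfolding k_def using that by (intro Least_le) blast
  define l where "l = (\<lambda>i v. \<Sum>j\<in>UNIV. a i $ j * v $ j)"
  have l0: "(\<Sum>i\<in>I. c i * l i v) = 0" for v
  proof -
    have "(\<Sum>i\<in>I. c i * l i v) = (\<Sum>j\<in>UNIV. (\<Sum>i\<in>I. c i *s a i) $ j * v $ j)"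
      unfolding l_def sum_distrib_left
      by (subst sum.swap) (simp add: sum_distrib_right mult.assoc)
    then show ?thesis
      by (simp add: c)
  qed
  define f where "f = (\<Sum>i\<in>{i\<in>I. d i = k}. fun_scale (c i) (s i))"
  have "f \<in> S k"
    unfolding f_def using s by (intro cfun.subspace_sum cfun.subspace_scale S) auto
  moreover have "f (replicate k w) = 0" for w
  proof -
    have lim: "((\<lambda>t. c i * l i (\<phi> (t *s w)) / t ^ k) \<longlongrightarrow>
        (if d i = k then c i * s i (replicate k w) else 0)) (at 0)" if i: "i \<in> I" for i
    proof (cases "c i = 0")
      case False
      obtain e where e: "d i = k + e"
        using k_le[OF i False] le_Suc_ex by blast
      have lim_e: "((\<lambda>t. c i * (t ^ e * (l i (\<phi> (t *s w)) / t ^ d i))) \<longlongrightarrow>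
          c i * (0 ^ e * s i (replicate (d i) w))) (at 0)"
        using lead[OF i] unfolding has_leading_form_def l_def
        by (intro tendsto_intros) blast
      have val: "c i * (0 ^ e * s i (replicate (d i) w)) = (if d i = k then c i * s i (replicate k w) else 0)"
        by (auto simp: e power_0_left)
      have "\<forall>\<^sub>F t in at 0. c i * (t ^ e * (l i (\<phi> (t *s w)) / t ^ d i)) = c i * l i (\<phi> (t *s w)) / t ^ k"
        unfolding eventually_at_filter by (simp add: e power_add)
      then show ?thesis
        by (rule Lim_transform_eventually[OF lim_e[unfolded val]])
    qed simp
    have "((\<lambda>t. \<Sum>i\<in>I. c i * l i (\<phi> (t *s w)) / t ^ k) \<longlongrightarrow>
        (\<Sum>i\<in>I. if d i = k then c i * s i (replicate k w) else 0)) (at 0)"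
      by (intro tendsto_sum lim)
    moreover have "(\<lambda>t. \<Sum>i\<in>I. c i * l i (\<phi> (t *s w)) / t ^ k) = (\<lambda>t. 0)"
      by (simp add: sum_divide_distrib[symmetric] l0)
    ultimately have "(\<Sum>i\<in>I. if d i = k then c i * s i (replicate k w) else 0) = 0"
      by (simp add: tendsto_const_iff)
    then show ?thesis
      unfolding f_def sum_fun_scale_apply by (simp add: sum.inter_filter[OF I])
  qed
  ultimately have "f = 0"
    using sym_form_eq_0[of f k] S(2) by (auto simp: zero_fun_def)
  then have "c m = 0"
    unfolding f_def by (rule indep) (use m in auto)
  then show False
    using m by simp
qed

text \<open>Indexing by \<open>'n\<close>, the coordinate type of the ambient space, lets the basis
  forms serve directly as labels of coordinates there.\<close>

locale symbol_basis =
  fixes r :: nat and S :: "nat \<Rightarrow> ((complex^'d::finite) list \<Rightarrow> complex) set"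
    and d :: "'n::finite \<Rightarrow> nat" and s :: "'n \<Rightarrow> (complex^'d) list \<Rightarrow> complex"
  assumes system: "symbol_system r S"
    and basis_mem: "s i \<in> S (d i)"
    and basis_span: "f \<in> S k \<Longrightarrow> \<exists>c. f = (\<Sum>j | d j = k. fun_scale (c j) (s j))"
    and basis_independent: "(\<Sum>j | d j = k. fun_scale (c j) (s j)) = 0 \<Longrightarrow> d j = k \<Longrightarrow> c j = 0"

theorem adapted_basis:
  fixes \<phi> :: "complex^'d \<Rightarrow> complex^'n"
  assumes \<phi>: "holomorphic_map U \<phi>" "0 \<in> U"
    and system: "symbol_system r (fundamental_forms \<phi>)"
    and dim: "symbol_dim r (fundamental_forms \<phi>) = CARD('n)"
  obtains d :: "'n \<Rightarrow> nat" and s M N where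
    "symbol_basis r (fundamental_forms \<phi>) d s" "M ** N = mat 1" "N ** M = mat 1"
    "\<And>i. has_leading_form \<phi> (\<lambda>w. frechet_derivative \<phi> (at w)) (M $ i) (d i) (s i)"
proof -
  define S where "S = fundamental_forms \<phi>"
  define \<phi>' where "\<phi>' = (\<lambda>w. frechet_derivative \<phi> (at w))"
  have S: "cfun.subspace (S k)" "S k \<subseteq> sym_forms k" "k > r \<Longrightarrow> S k = {0}" for k
    using system by (simp_all add: symbol_system_def S_def zero_fun_def)
  have "\<forall>k. \<exists>B. B \<subseteq> S k \<and> cfun.independent B \<and> S k \<subseteq> cfun.span B \<and> card B = cfun.dim (S k)"
    using cfun.basis_exists by metis
  then obtain B where B: "\<And>k. B k \<subseteq> S k" "\<And>k. cfun.independent (B k)"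
    "\<And>k. S k \<subseteq> cfun.span (B k)" "\<And>k. card (B k) = cfun.dim (S k)"
    by metis
  have ex: "\<exists>a. has_leading_form \<phi> \<phi>' a k f" if "f \<in> S k" for f k
    using symbol_has_leading_form[OF \<phi>, of k f] S that by (simp add: S_def \<phi>'_def)
  \<comment> \<open>The equation for \<open>card\<close> does not exclude infinite bases, whose
    cardinality counts as 0. An infinite one would give more independent linear forms on
    \<open>V\<close> than its dimension.\<close>
  have B_fin: "finite (B k)" for k
  proof (rule ccontr)
    assume "infinite (B k)"
    then obtain T where T: "finite T" "card T = Suc CARD('n)" "T \<subseteq> B k"
      using infinite_arbitrarily_large by metis
    have "\<forall>f\<in>T. \<exists>a. has_leading_form \<phi> \<phi>' a k f"
      using ex T(3) B(1) by blast
    then obtain a where a: "\<And>f. f \<in> T \<Longrightarrow> has_leading_form \<phi> \<phi>' (a f) k f"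
      by metis
    have "card T \<le> CARD('n)"
    proof (rule card_le_of_independent_family[OF T(1)])
      fix c f assume c: "(\<Sum>f\<in>T. c f *s a f) = 0" "f \<in> T"
      show "c f = 0"
      proof (rule leading_forms_independent[OF T(1) S(1,2) _ _ _ c, where d = "\<lambda>_. k" and s = "\<lambda>f. f"])
        show "has_leading_form \<phi> \<phi>' (a f) k f" if "f \<in> T" for f
          by (rule a[OF that])
        show "f \<in> S k" if "f \<in> T" for f
          using that T(3) B(1) by blast
        show "c f = 0" if "(\<Sum>f\<in>{f \<in> T. k = k'}. fun_scale (c f) f) = 0" "f \<in> T" "k = k'" for k' c f
          using cfun.independentD[OF B(2) T(1,3), of c f] that by simp
      qed
    qed
    then show False
      using T(2) by simp
  qed
  \<comment> \<open>The disjoint union of the bases has \<open>CARD('n)\<close> elements by the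
    dimension hypothesis, so it can be indexed by coordinates.\<close>
  define I where "I = (SIGMA k:{..r}. B k)"
  have "finite I"
    unfolding I_def by (intro finite_SigmaI B_fin) simp
  moreover have "card I = CARD('n)"
    using dim by (simp add: I_def B_fin B(4) symbol_dim_def S_def)
  ultimately obtain e :: "'n \<Rightarrow> nat \<times> ((complex^'d) list \<Rightarrow> complex)" where e: "bij_betw e UNIV I"
    using finite_same_card_bij[of "UNIV :: 'n set" I] by auto
  define d where "d = fst \<circ> e"
  define s where "s = snd \<circ> e"
  have e_I: "e i \<in> I" for i
    using e by (auto simp: bij_betw_def)
  have e_eq: "e i = (d i, s i)" for i
    by (simp add: d_def s_def)
  have s_B: "s i \<in> B (d i)" "d i \<le> r" for i
    using e_I[of i] by (auto simp: I_def e_eq)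
  have bij: "bij_betw s {j. d j = k} (B k)" if "k \<le> r" for k
    unfolding bij_betw_def
  proof
    show "inj_on s {j. d j = k}"
      using e by (auto simp: bij_betw_def inj_on_def e_eq)
    show "s ` {j. d j = k} = B k"
    proof (intro equalityI subsetI)
      fix f assume "f \<in> B k"
      then have "(k, f) \<in> I"
        using that by (simp add: I_def)
      then obtain j where "e j = (k, f)"
        using e by (metis bij_betw_imp_surj_on imageE)
      then show "f \<in> s ` {j. d j = k}"
        by (auto simp: e_eq)
    qed (use s_B in auto)
  qed
  have empty: "{j. d j = k} = {}" if "\<not> k \<le> r" for k
    using s_B(2) that by auto
  have basis: "symbol_basis r S d s"
  proof
    show "symbol_system r S"
      using system by (simp add: S_def)
    show "s i \<in> S (d i)" for i
      using s_B B(1) by blast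
    show "\<exists>c. f = (\<Sum>j | d j = k. fun_scale (c j) (s j))" if f: "f \<in> S k" for f k
    proof (cases "k \<le> r")
      case True
      obtain u where "f = (\<Sum>b\<in>B k. fun_scale (u b) b)"
        using f B(3)[of k] cfun.span_finite[OF B_fin[of k]] by auto
      then have "f = (\<Sum>j | d j = k. fun_scale (u (s j)) (s j))"
        using sum.reindex_bij_betw[OF bij[OF True], of "\<lambda>b. fun_scale (u b) b"] by simp
      then show ?thesis
        by (intro exI[of _ "\<lambda>j. u (s j)"])
    next
      case False
      then show ?thesis
        using f S(3)[of k] by (simp add: empty)
    qed
    show "c j = 0" if c: "(\<Sum>j | d j = k. fun_scale (c j) (s j)) = 0" and j: "d j = k" for k c j
    proof -
      have kr: "k \<le> r"
        using s_B(2)[of j] j by simp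
      define u where "u = (\<lambda>b. c (the_inv_into {j. d j = k} s b))"
      have inj: "inj_on s {j. d j = k}"
        using bij[OF kr] by (simp add: bij_betw_def)
      have u: "u (s j) = c j" if "d j = k" for j
        unfolding u_def using the_inv_into_f_f[OF inj, of j] that by simp
      have "(\<Sum>b\<in>B k. fun_scale (u b) b) = (\<Sum>j | d j = k. fun_scale (u (s j)) (s j))"
        using sum.reindex_bij_betw[OF bij[OF kr], of "\<lambda>b. fun_scale (u b) b"] by simp
      also have "\<dots> = 0"
        using c by (simp add: u)
      finally have "u (s j) = 0"
        using cfun.independentD[OF B(2) B_fin subset_refl, where u = u and v = "s j"] s_B(1)[of j] j by simp
      then show ?thesis
        using u[OF j] by simp
    qed
  qed
  interpret symbol_basis r S d s by (rule basis)
  have "\<forall>i. \<exists>a. has_leading_form \<phi> \<phi>' a (d i) (s i)"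
    using ex basis_mem by blast
  then obtain a where a: "\<And>i. has_leading_form \<phi> \<phi>' (a i) (d i) (s i)"
    by metis
  \<comment> \<open>Rows are the coefficient vectors of the adapted linear forms; being independent
    and as many as the coordinates, they form an invertible matrix.\<close>
  define M where "M = (\<chi> i. a i)"
  have "c i = 0" if c: "(\<Sum>i\<in>UNIV. c i *s row i M) = 0" for c i
  proof (rule leading_forms_independent[where I = UNIV and S = S and s = s and d = d and a = a and \<phi> = \<phi> and \<phi>' = \<phi>'])
    show "(\<Sum>i\<in>UNIV. c i *s a i) = 0"
      using c by (simp add: row_def M_def)
    show "c i = 0" if "(\<Sum>i\<in>{i \<in> UNIV. d i = k}. fun_scale (c i) (s i)) = 0" "d i = k" for k c i
      using basis_independent[of c k i] that by simp
  qed (simp_all add: S a basis_mem)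
  then obtain N where N: "M ** N = mat 1"
    using matrix_right_invertible_independent_rows[of M] by blast
  then have "N ** M = mat 1"
    using matrix_left_right_inverse by blast
  then show thesis
    using that[of d s M N] basis N a by (simp add: S_def \<phi>'_def M_def)
qed

section \<open>The model cone of a symbol system\<close>

context symbol_basis
begin

lemma S_sym: "S k \<subseteq> sym_forms k" and S_subspace: "cfun.subspace (S k)"
  and S_contract: "f \<in> S (Suc k) \<Longrightarrow> contract v f \<in> S k"
  and S_0: "S 0 = sym_forms 0" and S_1: "S 1 = sym_forms 1"
  and S_above: "k > r \<Longrightarrow> S k = {0}"
  using system by (simp_all add: symbol_system_def zero_fun_def)

lemma s_sym: "s i \<in> sym_forms (d i)"
  using basis_mem S_sym by blast

lemma combination:
  assumes "f \<in> S k"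
  shows "\<exists>c. \<forall>us. f us = (\<Sum>j | d j = k. c j * s j us)"
proof -
  obtain c where "f = (\<Sum>j | d j = k. fun_scale (c j) (s j))"
    using basis_span[OF assms] by blast
  then have "f us = (\<Sum>j | d j = k. c j * s j us)" for us
    by (simp add: sum_fun_scale_apply)
  then show ?thesis by blast
qed

lemma combination_0:
  assumes "\<And>us. (\<Sum>j | d j = k. c j * s j us) = 0" "d j = k"
  shows "c j = 0"
proof (rule basis_independent[of c k j])
  show "(\<Sum>j | d j = k. fun_scale (c j) (s j)) = 0"
    by (rule ext) (simp add: sum_fun_scale_apply assms(1))
qed (rule assms(2))

lemma degree_le: "d i \<le> r"
proof (rule ccontr)
  assume "\<not> d i \<le> r"
  then have "s i = 0"
    using basis_mem[of i] S_above[of "d i"] by simp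
  then have "(\<Sum>j | d j = d i. (if j = i then 1 else 0) * s j us) = 0" for us
    by (intro sum.neutral) auto
  from combination_0[where c = "\<lambda>j. if j = i then 1 else 0", OF this refl] show False
    by simp
qed

definition coordinate_form :: "'d \<Rightarrow> (complex^'d) list \<Rightarrow> complex" where
  "coordinate_form a us = (if length us = 1 then hd us $ a else 0)"

lemma coordinate_form_S: "coordinate_form a \<in> S 1"
  unfolding S_1 sym_forms_def mem_Collect_eq
proof (intro conjI allI impI)
  fix us vs :: "(complex^'d) list" assume eq: "mset us = mset vs"
  then have "length us = length vs"
    by (metis size_mset)
  then show "coordinate_form a us = coordinate_form a vs"
    using eq by (cases us; cases vs) (auto simp: coordinate_form_def)
next
  fix us :: "(complex^'d) list" assume "Suc (length us) = 1"
  then have "(\<lambda>w. coordinate_form a (w # us)) = (\<lambda>w. w $ a)"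
    by (simp add: coordinate_form_def)
  then show "linear_form (\<lambda>w. coordinate_form a (w # us))"
    by (simp add: Vector_Spaces.linear_iff vec.vector_space_axioms vector_space_over_itself.vector_space_axioms)
qed (simp add: coordinate_form_def)

lemma r_pos: "r > 0"
proof (rule ccontr)
  assume "\<not> r > 0"
  then have "S 1 = {0}"
    by (intro S_above) simp
  then have "coordinate_form (undefined :: 'd) = 0"
    using coordinate_form_S by blast
  then have "coordinate_form (undefined :: 'd) [axis undefined 1] = 0"
    by simp
  then show False
    by (simp add: coordinate_form_def)
qed

lemma s_degree_1_expand:
  assumes "d i = 1"
  shows "s i [v] = (\<Sum>a\<in>UNIV. v $ a * s i [axis a 1])"
proof -
  have "s i \<in> sym_forms 1"
    using s_sym[of i] assms by simp
  then interpret l: Vector_Spaces.linear "(*s)" "(*)" "\<lambda>w. s i [w]"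
    by (rule sym_form_linear) simp
  have "s i [v] = s i [\<Sum>a\<in>UNIV. v $ a *s axis a 1]"
    by (simp add: basis_expansion)
  then show ?thesis
    by (simp add: l.sum l.scale)
qed

text \<open>The standard coordinates and the forms \<open>s j\<close> of degree 1 are two bases of
  \<open>S 1\<close>, related by inverse matrices. The first identity yields
  \<open>separating\<close>, the second \<open>interpolating\<close>.\<close>

lemma dual_coordinates:
  obtains c where "\<And>a v. v $ a = (\<Sum>j | d j = 1. c a j * s j [v])"
    "\<And>i j. d i = 1 \<Longrightarrow> d j = 1 \<Longrightarrow> (\<Sum>a\<in>UNIV. s i [axis a 1] * c a j) = (if i = j then 1 else 0)"
proof -
  have "\<forall>a. \<exists>c. \<forall>us. coordinate_form a us = (\<Sum>j | d j = 1. c j * s j us)"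
    using combination[OF coordinate_form_S] by blast
  then obtain c where c: "\<And>a us. coordinate_form a us = (\<Sum>j | d j = 1. c a j * s j us)"
    by metis
  have va: "v $ a = (\<Sum>j | d j = 1. c a j * s j [v])" for a v
    using c[of a "[v]"] by (simp add: coordinate_form_def)
  have "(\<Sum>a\<in>UNIV. s i [axis a 1] * c a j) - (if i = j then 1 else 0) = 0" if i: "d i = 1" and j: "d j = 1" for i j
  proof (rule combination_0[where c = "\<lambda>j. (\<Sum>a\<in>UNIV. s i [axis a 1] * c a j) - (if i = j then 1 else 0)", OF _ j])
    fix us
    show "(\<Sum>j | d j = 1. ((\<Sum>a\<in>UNIV. s i [axis a 1] * c a j) - (if i = j then 1 else 0)) * s j us) = 0"
    proof (cases "length us = 1")
      case True
      then obtain v where us: "us = [v]"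
        by (auto simp: length_Suc_conv)
      have "(\<Sum>j | d j = 1. (\<Sum>a\<in>UNIV. s i [axis a 1] * c a j) * s j [v])
          = (\<Sum>a\<in>UNIV. s i [axis a 1] * (\<Sum>j | d j = 1. c a j * s j [v]))"
        unfolding sum_distrib_left sum_distrib_right by (subst sum.swap) (simp add: mult.assoc)
      also have "\<dots> = s i [v]"
        unfolding va[symmetric] by (simp add: s_degree_1_expand[OF i, of v] mult.commute)
      also have "s i [v] = (\<Sum>j | d j = 1. (if i = j then 1 else 0) * s j [v])"
        using i by (simp add: if_distrib[of "\<lambda>x. x * _"] cong: if_cong)
      finally show ?thesis
        by (simp add: us left_diff_distrib sum_subtractf)
    next
      case False
      have "s j us = 0" if "d j = 1" for j
        using sym_form_length[OF s_sym[of j]] that False by simp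
      then show ?thesis by simp
    qed
  qed
  then show thesis
    using that[of c] va by simp
qed

lemma graded_symbol: "\<exists>i0. graded_symbol d s i0"
proof -
  define e where "e = (\<lambda>us::(complex^'d) list. if us = [] then 1 else 0 :: complex)"
  have "e \<in> S 0"
    unfolding S_0 by (auto simp: sym_forms_def e_def)
  then obtain c where c: "\<And>us. e us = (\<Sum>j | d j = 0. c j * s j us)"
    using combination by blast
  have "(\<Sum>j | d j = 0. c j * s j []) \<noteq> 0"
    using c[of "[]"] by (simp add: e_def)
  then obtain i0 where i0: "d i0 = 0" "s i0 [] \<noteq> 0"
    by (force elim: sum.not_neutral_contains_not_neutral)
  have unique: "i = i0" if i: "d i = 0" for i
  proof (rule ccontr)
    assume "i \<noteq> i0"
    \<comment> \<open>Forms of degree 0 are determined by their value at the empty list, so two of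
      them satisfy this explicit relation.\<close>
    define b where "b = (\<lambda>j. if j = i then s i0 [] else if j = i0 then - s i [] else 0)"
    have "(\<Sum>j | d j = 0. b j * s j us) = 0" for us
    proof (cases "us = []")
      case True
      have "(\<Sum>j | d j = 0. b j * s j us) = (\<Sum>j\<in>{i, i0}. b j * s j us)"
        by (rule sum.mono_neutral_right) (use i i0 in \<open>auto simp: b_def\<close>)
      then show ?thesis
        using \<open>i \<noteq> i0\<close> by (simp add: b_def True)
    next
      case False
      then have "s j us = 0" if "d j = 0" for j
        using sym_form_length[OF s_sym[of j]] that by simp
      then show ?thesis by simp
    qed
    from combination_0[where c = b, OF this i] show False
      using i0 by (simp add: b_def)
  qed
  obtain c where c: "\<And>a v. v $ a = (\<Sum>j | d j = 1. c a j * s j [v])"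
    "\<And>i j. d i = 1 \<Longrightarrow> d j = 1 \<Longrightarrow> (\<Sum>a\<in>UNIV. s i [axis a 1] * c a j) = (if i = j then 1 else 0)"
    by (rule dual_coordinates) blast
  have "graded_symbol d s i0"
  proof
    show "s i \<in> sym_forms (d i)" for i
      by (rule s_sym)
    show "\<exists>c. \<forall>us. s i (v # us) = (\<Sum>j | d j = k. c j * s j us)" if "d i = Suc k" for i k v
      using combination[of "contract v (s i)" k] S_contract[of "s i" k v] basis_mem[of i] that
      by (simp add: contract_def)
    show "d i = 0 \<longleftrightarrow> i = i0" for i
      by (rule iffI[OF unique]) (simp_all add: i0(1))
    show "s i0 [] \<noteq> 0"
      by (rule i0)
    show "v = 0" if "\<And>i. d i = 1 \<Longrightarrow> s i [v] = 0" for v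
      using c(1)[of v] that by (simp add: vec_eq_iff)
    show "\<exists>v. \<forall>i. d i = 1 \<longrightarrow> s i [v] = a i" for a
    proof (intro exI allI impI)
      fix i assume i: "d i = 1"
      define v where "v = (\<chi> b. \<Sum>j | d j = 1. c b j * a j)"
      have "s i [v] = (\<Sum>b\<in>UNIV. (\<Sum>j | d j = 1. c b j * a j) * s i [axis b 1])"
        unfolding s_degree_1_expand[OF i, of v] by (simp add: v_def)
      also have "\<dots> = (\<Sum>j | d j = 1. (\<Sum>b\<in>UNIV. s i [axis b 1] * c b j) * a j)"
        unfolding sum_distrib_right by (subst sum.swap) (simp add: mult_ac)
      also have "\<dots> = (\<Sum>j | d j = 1. (if i = j then 1 else 0) * a j)"
        by (intro sum.cong refl) (simp add: c(2)[OF i])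
      also have "\<dots> = a i"
        using i by (simp add: if_distrib[of "\<lambda>x. x * _"] cong: if_cong)
      finally show "s i [\<chi> b. \<Sum>j | d j = 1. c b j * a j] = a i"
        by (simp add: v_def)
    qed
  qed
  then show ?thesis by blast
qed

end

text \<open>\<open>sym_prod us\<close> is 0 outside the symmetric forms of its degree, so elements
  of \<open>sym_power k\<close> are linear only among the latter; \<open>T\<close> keeps all
  combinations there.\<close>

lemma sym_power_combination:
  assumes \<xi>: "\<xi> \<in> sym_power k" and T: "cfun.subspace T" "T \<subseteq> sym_forms k"
    and f: "\<And>j. j \<in> J \<Longrightarrow> f j \<in> T"
  shows "\<xi> (\<Sum>j\<in>J. fun_scale (c j) (f j)) = (\<Sum>j\<in>J. c j * \<xi> (f j))"
  using \<xi> unfolding sym_power_def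
proof (induction rule: cfun.span_induct_alt)
  case base
  then show ?case by simp
next
  case (step a x y)
  then obtain us :: "(complex^'a) list" where us: "x = sym_prod us" "length us = k"
    by blast
  have "(\<Sum>j\<in>J. fun_scale (c j) (f j)) \<in> T"
    by (intro cfun.subspace_sum cfun.subspace_scale T f)
  then have "x (\<Sum>j\<in>J. fun_scale (c j) (f j)) = (\<Sum>j\<in>J. c j * f j us)"
    using T(2) us by (auto simp: sym_prod_def sum_fun_scale_apply)
  also have "\<dots> = (\<Sum>j\<in>J. c j * x (f j))"
    using T(2) us f by (intro sum.cong) (auto simp: sym_prod_def)
  finally show ?case
    using step by (simp add: fun_scale_def sum.distrib sum_distrib_left algebra_simps)
qed

context symbol_basis
begin

lemma sym_prod_power: "length us = k \<Longrightarrow> sym_prod us \<in> sym_power k"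
  unfolding sym_power_def by (rule cfun.span_base) blast

lemma sym_power_perp:
  assumes "\<xi> \<in> sym_power k" "\<And>i. d i = k \<Longrightarrow> \<xi> (s i) = 0"
  shows "\<xi> \<in> symbol_perp S k"
  unfolding symbol_perp_def
proof (intro CollectI conjI assms(1) ballI)
  fix f assume "f \<in> S k"
  then obtain c where "f = (\<Sum>j | d j = k. fun_scale (c j) (s j))"
    using basis_span by blast
  then have "\<xi> f = (\<Sum>j | d j = k. c j * \<xi> (s j))"
    using sym_power_combination[OF assms(1) S_subspace S_sym, of "{j. d j = k}" s c] basis_mem by auto
  then show "\<xi> f = 0"
    by (simp add: assms(2))
qed

text \<open>The pairings with the basis forms \<open>s i\<close> are coordinates on the quotient space.\<close>

lemma quotient_coordinates:
  fixes cl :: "nat \<Rightarrow> (((complex^'d) list \<Rightarrow> complex) \<Rightarrow> complex) \<Rightarrow> complex^'m"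
  assumes cl: "symbol_quotient S cl"
  obtains Q :: "complex^'m^'n" and R where "Q ** R = mat 1" "R ** Q = mat 1"
    "\<And>k \<xi> i. \<xi> \<in> sym_power k \<Longrightarrow> (Q *v cl k \<xi>) $ i = (if d i = k then \<xi> (s i) else 0)"
proof -
  have lin: "Vector_Spaces.linear fun_scale (*s) (cl k)" for k
    using cl unfolding symbol_quotient_def by blast
  have cl_add: "cl k (\<xi> + \<eta>) = cl k \<xi> + cl k \<eta>" and cl_scale: "cl k (fun_scale c \<xi>) = c *s cl k \<xi>"
    and cl_diff: "cl k (\<xi> - \<eta>) = cl k \<xi> - cl k \<eta>" and cl_0: "cl k 0 = 0" for k \<xi> \<eta> c
  proof -
    interpret Vector_Spaces.linear fun_scale "(*s)" "cl k" by (rule lin)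
    show "cl k (\<xi> + \<eta>) = cl k \<xi> + cl k \<eta>" "cl k (fun_scale c \<xi>) = c *s cl k \<xi>"
      "cl k (\<xi> - \<eta>) = cl k \<xi> - cl k \<eta>" "cl k 0 = 0"
      by (rule add, rule scale, rule diff, rule zero)
  qed
  have pow: "\<xi> + \<eta> \<in> sym_power k" "\<xi> - \<eta> \<in> sym_power k" "fun_scale c \<xi> \<in> sym_power k" "0 \<in> sym_power k"
    if "\<xi> \<in> sym_power k" "\<eta> \<in> sym_power k" for k \<xi> \<eta> c
    using that unfolding sym_power_def
    by (auto intro: cfun.span_add cfun.span_diff cfun.span_scale cfun.span_zero)
  have pow0: "0 \<in> sym_power k" for k
    unfolding sym_power_def by (rule cfun.span_zero)
  have ker: "cl k \<xi> = 0 \<longleftrightarrow> \<xi> \<in> symbol_perp S k" if "\<xi> \<in> sym_power k" for k \<xi>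
    using cl that unfolding symbol_quotient_def by blast
  \<comment> \<open>\<open>dec u c\<close> says that \<open>c\<close> lists the graded components of
    \<open>u\<close>; their uniqueness makes them linear in \<open>u\<close>.\<close>
  define dec where "dec = (\<lambda>u c. (\<forall>k. c k \<in> cl k ` sym_power k) \<and> finite {k. c k \<noteq> 0} \<and> u = (\<Sum>k | c k \<noteq> 0. c k))"
  have dec_ex: "\<exists>!c. dec u c" for u
    using cl unfolding symbol_quotient_def dec_def by blast
  have sum_supp: "(\<Sum>k | c k \<noteq> 0. c k) = (\<Sum>k\<in>K. c k)"
    if "finite K" "{k. c k \<noteq> 0} \<subseteq> K" for K and c :: "nat \<Rightarrow> complex^'m"
    using that by (intro sum.mono_neutral_left) auto
  obtain c where c: "\<And>u. dec u (c u)"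
    using dec_ex by metis
  have c_eqI: "c u = f" if "dec u f" for u f
    using dec_ex[of u] c that by blast
  have c_im: "c u k \<in> cl k ` sym_power k" and c_fin: "finite {k. c u k \<noteq> 0}"
    and c_sum: "u = (\<Sum>k | c u k \<noteq> 0. c u k)" for u k
    using c[of u] unfolding dec_def by blast+
  have c_add: "c (u + v) = (\<lambda>k. c u k + c v k)" for u v
  proof (rule c_eqI, unfold dec_def, intro conjI allI)
    let ?K = "{k. c u k \<noteq> 0} \<union> {k. c v k \<noteq> 0}"
    have sub: "{k. c u k + c v k \<noteq> 0} \<subseteq> ?K" and fin: "finite ?K"
      using c_fin by auto
    show "finite {k. c u k + c v k \<noteq> 0}"
      by (rule finite_subset[OF sub fin])
    have "u = (\<Sum>k\<in>?K. c u k)" "v = (\<Sum>k\<in>?K. c v k)"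
      using c_sum[of u] c_sum[of v] sum_supp[OF fin, of "c u"] sum_supp[OF fin, of "c v"] by auto
    then show "u + v = (\<Sum>k | c u k + c v k \<noteq> 0. c u k + c v k)"
      using sum_supp[OF fin sub] by (simp add: sum.distrib)
    show "c u k + c v k \<in> cl k ` sym_power k" for k
      using c_im[of u k] c_im[of v k] by (auto simp: cl_add[symmetric] intro!: imageI pow)
  qed
  have c_scale: "c (a *s u) = (\<lambda>k. a *s c u k)" for a u
  proof (rule c_eqI, unfold dec_def, intro conjI allI)
    have sub: "{k. a *s c u k \<noteq> 0} \<subseteq> {k. c u k \<noteq> 0}"
      by auto
    then show "finite {k. a *s c u k \<noteq> 0}"
      by (rule finite_subset[OF _ c_fin])
    have "(\<Sum>k | a *s c u k \<noteq> 0. a *s c u k) = (\<Sum>k | c u k \<noteq> 0. a *s c u k)"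
      by (rule sum_supp[OF c_fin sub])
    also have "\<dots> = a *s (\<Sum>k | c u k \<noteq> 0. c u k)"
      by (simp only: vec.scale_sum_right)
    also have "\<dots> = a *s u"
      by (simp only: c_sum[symmetric])
    finally show "a *s u = (\<Sum>k | a *s c u k \<noteq> 0. a *s c u k)"
      by (rule sym)
    show "a *s c u k \<in> cl k ` sym_power k" for k
      using c_im[of u k] by (auto simp: cl_scale[symmetric] intro!: imageI pow)
  qed
  have c_cl: "c (cl k \<xi>) = (\<lambda>l. if l = k then cl k \<xi> else 0)" if \<xi>: "\<xi> \<in> sym_power k" for k \<xi>
  proof (rule c_eqI, unfold dec_def, intro conjI allI)
    have sub: "{l. (if l = k then cl k \<xi> else 0) \<noteq> 0} \<subseteq> {k}"
      by auto
    then show "finite {l. (if l = k then cl k \<xi> else 0) \<noteq> 0}"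
      by (rule finite_subset) simp
    show "cl k \<xi> = (\<Sum>l | (if l = k then cl k \<xi> else 0) \<noteq> 0. if l = k then cl k \<xi> else 0)"
      using sum_supp[OF _ sub] by simp
    show "(if l = k then cl k \<xi> else 0) \<in> cl l ` sym_power l" for l
      using \<xi> pow0[of l] cl_0[of l] by (auto intro: image_eqI[of _ _ 0])
  qed
  \<comment> \<open>The value of a class on \<open>s i\<close>, read off from any representative;
    two representatives differ by an element of \<open>symbol_perp\<close>, which pairs to 0 with
    \<open>s i\<close>.\<close>
  define val where "val = (\<lambda>i y. (SOME \<xi>. \<xi> \<in> sym_power (d i) \<and> cl (d i) \<xi> = y) (s i))"
  have val: "val i (cl (d i) \<xi>) = \<xi> (s i)" if \<xi>: "\<xi> \<in> sym_power (d i)" for i \<xi>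
  proof -
    define \<eta> where "\<eta> = (SOME \<eta>. \<eta> \<in> sym_power (d i) \<and> cl (d i) \<eta> = cl (d i) \<xi>)"
    have \<eta>: "\<eta> \<in> sym_power (d i)" "cl (d i) \<eta> = cl (d i) \<xi>"
      unfolding \<eta>_def using someI[of "\<lambda>\<eta>. \<eta> \<in> sym_power (d i) \<and> cl (d i) \<eta> = cl (d i) \<xi>" \<xi>] \<xi> by blast+
    then have "\<eta> - \<xi> \<in> symbol_perp S (d i)"
      using ker[of "\<eta> - \<xi>" "d i"] pow(2)[OF \<eta>(1) \<xi>] by (simp add: cl_diff)
    then have "(\<eta> - \<xi>) (s i) = 0"
      using basis_mem by (simp add: symbol_perp_def)
    then show ?thesis
      by (simp add: val_def \<eta>_def)
  qed
  define b where "b = (\<lambda>u. \<chi> i. val i (c u (d i)))"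
  have b_lin: "Vector_Spaces.linear (*s) (*s) b"
  proof -
    have "b (u + v) $ i = (b u + b v) $ i" "b (a *s u) $ i = (a *s b u) $ i" for u v a i
    proof -
      obtain \<xi> \<eta> where \<xi>: "\<xi> \<in> sym_power (d i)" "c u (d i) = cl (d i) \<xi>"
        and \<eta>: "\<eta> \<in> sym_power (d i)" "c v (d i) = cl (d i) \<eta>"
        using c_im[of u "d i"] c_im[of v "d i"] by blast
      show "b (u + v) $ i = (b u + b v) $ i"
        using val[OF pow(1)[OF \<xi>(1) \<eta>(1)]] by (simp add: b_def c_add \<xi> \<eta> cl_add val)
      show "b (a *s u) $ i = (a *s b u) $ i"
      proof -
        have "val i (a *s cl (d i) \<xi>) = fun_scale a \<xi> (s i)"
          using val[OF pow(3)[OF \<xi>(1) \<xi>(1)], of a] by (simp only: cl_scale)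
        then show ?thesis
          by (simp add: b_def c_scale \<xi> val fun_scale_def)
      qed
    qed
    then show ?thesis
      unfolding Vector_Spaces.linear_iff vec_eq_iff by (simp add: vec.vector_space_axioms)
  qed
  define Q where "Q = matrix b"
  have Q: "Q *v u = b u" for u
    unfolding Q_def by (rule matrix_works[OF b_lin])
  have coord: "(Q *v cl k \<xi>) $ i = (if d i = k then \<xi> (s i) else 0)" if \<xi>: "\<xi> \<in> sym_power k" for k \<xi> i
    using val[of \<xi> i] val[OF pow0, of i] \<xi> by (auto simp: Q b_def c_cl[OF \<xi>] cl_0)
  have "u = 0" if "Q *v u = 0" for u
  proof -
    have "c u k = 0" for k
    proof -
      obtain \<xi> where \<xi>: "\<xi> \<in> sym_power k" "c u k = cl k \<xi>"
        using c_im[of u k] by blast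
      have "\<xi> (s i) = 0" if "d i = k" for i
      proof -
        have "val i (c u (d i)) = 0"
          using \<open>Q *v u = 0\<close> by (simp add: Q b_def vec_eq_iff)
        then show ?thesis
          using val[of \<xi> i] \<xi> that by simp
      qed
      then show ?thesis
        using ker[OF \<xi>(1)] sym_power_perp[OF \<xi>(1)] \<xi>(2) by simp
    qed
    then show ?thesis
      using c_sum[of u] by simp
  qed
  then obtain R where R: "R ** Q = mat 1"
    using matrix_left_invertible_ker[of Q] by blast
  \<comment> \<open>A relation between the rows of \<open>Q\<close>, tested on classes of products,
    becomes a relation between basis forms. So \<open>Q\<close> also has a right inverse, although
    \<open>'m\<close> and \<open>'n\<close> are different types.\<close>
  have "a i = 0" if a: "(\<Sum>i\<in>UNIV. a i *s row i Q) = 0" for a i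
  proof (rule combination_0[where c = a, OF _ refl])
    fix us
    show "(\<Sum>j | d j = d i. a j * s j us) = 0"
    proof (cases "length us = d i")
      case True
      define u where "u = cl (d i) (sym_prod us)"
      have "(\<Sum>j\<in>UNIV. a j * (Q *v u) $ j) = (\<Sum>l\<in>UNIV. (\<Sum>j\<in>UNIV. a j *s row j Q) $ l * u $ l)"
        unfolding matrix_vector_mult_def vec_lambda_beta sum_distrib_left
        by (subst sum.swap) (simp add: sum_distrib_right row_def mult.assoc)
      also have "\<dots> = 0"
        by (simp add: a)
      finally have "(\<Sum>j\<in>UNIV. if d j = d i then a j * sym_prod us (s j) else 0) = 0"
        unfolding u_def coord[OF sym_prod_power[OF True]] by (simp add: if_distrib[of "\<lambda>x. _ * x"] cong: if_cong)
      then have "(\<Sum>j | d j = d i. a j * sym_prod us (s j)) = 0"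
        by (simp add: sum.If_cases)
      moreover have "sym_prod us (s j) = s j us" if "d j = d i" for j
        using s_sym[of j] that True by (simp add: sym_prod_def)
      ultimately show ?thesis
        by simp
    next
      case False
      then have "s j us = 0" if "d j = d i" for j
        using sym_form_length[OF s_sym[of j]] that by simp
      then show ?thesis by simp
    qed
  qed
  then obtain R' where R': "Q ** R' = mat 1"
    using matrix_right_invertible_independent_rows[of Q] by blast
  have "R = R ** (Q ** R')"
    by (simp add: R')
  also have "\<dots> = R'"
    by (simp add: matrix_mul_assoc R)
  finally show thesis
    using that[of Q R] R R' coord by simp
qed

section \<open>The Euler map in coordinates\<close>

lemma euler_map_coordinates:
  assumes Q: "\<And>k \<xi> i. \<xi> \<in> sym_power k \<Longrightarrow> (Q *v cl k \<xi>) $ i = (if d i = k then \<xi> (s i) else 0)"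
  shows "(Q *v euler_map r cl (t, v)) $ i = t ^ (r - d i) * s i (replicate (d i) v)"
proof -
  have mem: "fun_scale a (sym_prod (replicate k v)) \<in> sym_power k" for a k
    unfolding sym_power_def by (intro cfun.span_scale cfun.span_base) force
  have "sym_prod (replicate (d i) v) (s i) = s i (replicate (d i) v)"
    using s_sym[of i] by (simp add: sym_prod_def)
  moreover have "(Q *v euler_map r cl (t, v)) $ i =
      (\<Sum>k\<le>r. if d i = k then fun_scale (t ^ (r - k)) (sym_prod (replicate k v)) (s i) else 0)"
    by (simp add: euler_map_def vec.sum Q[OF mem])
  ultimately show ?thesis
    using degree_le[of i] by (simp add: fun_scale_def)
qed

text \<open>For nonzero \<open>t\<close>, homogeneity gives
  \<open>f (t, v) = t ^ r psi (v / t)\<close>, a point of the model; points with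
  \<open>t = 0\<close> are limits of these, and polynomials are continuous. Conversely,
  \<open>c psi w\<close> is reached through an \<open>r\<close>-th root of \<open>c\<close>.\<close>

lemma euler_closure:
  assumes g: "graded_symbol d s i0"
    and f: "\<And>t v i. f (t, v) $ i = t ^ (r - d i) * s i (replicate (d i) v)"
  shows "zariski_closure (range f) = zariski_closure (graded_symbol.model d s)"
proof -
  interpret graded_symbol d s i0 by (rule g)
  have f_model: "f (t, v) = t ^ r *s psi (inverse t *s v)" if "t \<noteq> 0" for t v
  proof -
    have "t ^ (r - d i) * s i (replicate (d i) v) = t ^ r * s i (replicate (d i) (inverse t *s v))" for i
      using sym_form_replicate_scale[OF sym[of i], of "d i" "[]" "inverse t" v] that degree_le[of i]
      by (simp add: power_diff field_simps)
    then show ?thesis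
      by (simp add: vec_eq_iff f psi_def)
  qed
  have "model \<subseteq> range f"
  proof
    fix y assume "y \<in> model"
    then obtain c w where y: "y = c *s psi w"
      by (auto simp: model_def)
    show "y \<in> range f"
    proof (cases "c = 0")
      case True
      \<comment> \<open>Coordinates of degree below \<open>r\<close> vanish through the power of
        \<open>t = 0\<close>, those of degree \<open>r\<close> through \<open>v = 0\<close>, as
        \<open>r > 0\<close>.\<close>
      have "f (0, 0) $ i = 0" for i
        using sym_form_replicate_scale[OF sym[of i], of "d i" "[]" 0 0] degree_le[of i] r_pos
        by (cases "d i = r") (auto simp: f power_0_left)
      then have "y = f (0, 0)"
        by (simp add: y True vec_eq_iff)
      then show ?thesis by blast
    next
      case False
      obtain t where t: "t ^ r = c"
        using exists_complex_root[of r c] r_pos by auto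
      then have "t \<noteq> 0"
        using False r_pos by (auto simp: power_0_left)
      then have "y = f (t, t *s w)"
        using f_model[of t "t *s w"] by (simp add: y t)
      then show ?thesis by blast
    qed
  qed
  moreover have "range f \<subseteq> zariski_closure model"
  proof (clarsimp simp: zariski_closure_def)
    fix t v p
    assume p: "poly_fun p" "\<forall>y\<in>model. p y = 0"
    have "p (f (t, v)) = 0" if "t \<noteq> 0" for t
      using p(2) f_model[OF that] by (auto simp: model_def)
    then have "\<forall>\<^sub>F u in at t. p (f (u, v)) = 0"
      using eventually_neq_at_within[of 0 t UNIV] by (auto elim!: eventually_mono)
    moreover have "((\<lambda>u. p (f (u, v))) \<longlongrightarrow> p (f (t, v))) (at t)"
    proof -
      have "isCont (\<lambda>u. f (u, v)) t"
        unfolding isCont_def by (rule vec_tendstoI) (auto simp: f intro!: tendsto_intros)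
      then show ?thesis
        using isCont_o2[of t "\<lambda>u. f (u, v)" p] poly_fun_continuous_on[OF p(1), of UNIV]
        by (simp add: isCont_def continuous_on_eq_continuous_at)
    qed
    ultimately have "((\<lambda>u. 0) \<longlongrightarrow> p (f (t, v))) (at t)"
      using tendsto_cong by force
    then show "p (f (t, v)) = 0"
      by (simp add: tendsto_const_iff)
  qed
  ultimately show ?thesis
    using zariski_closure_minimal[of "range f" model] zariski_closure_minimal[of model "range f"]
      zariski_closure_superset[of "range f"] by blast
qed

end

section \<open>The theorem\<close>

text \<open>A sequence in the cone tending to a nonzero multiple of a frame vector eventually enters
  the relatively open set \<open>N\<close>, where the continuous inverse \<open>g\<close> supplies
  the scalar and the chart point.\<close>

lemma local_frame_cone_frame:
  fixes Z :: "(complex^'n) set set" and \<phi> :: "complex^'d \<Rightarrow> complex^'n"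
  assumes Z: "proj_closed Z" "Z \<noteq> {}" and frame: "local_frame Z x \<phi>"
  obtains U where "holomorphic_map U \<phi>" "0 \<in> U"
    "cone_frame (affine_cone Z) \<phi> (\<lambda>w. frechet_derivative \<phi> (at w)) U"
proof -
  obtain U N g where U: "0 \<in> U" "holomorphic_map U \<phi>"
    and N: "openin (top_of_set (affine_cone Z)) N"
    and hom: "homeomorphism ((- {0}) \<times> U) N (\<lambda>(c, w). c *s \<phi> w) g"
    and imm: "\<And>w c h. w \<in> U \<Longrightarrow> c *s \<phi> w + frechet_derivative \<phi> (at w) h = 0 \<Longrightarrow> c = 0 \<and> h = 0"
    using frame unfolding local_frame_def by blast
  have N_C: "N \<subseteq> affine_cone Z"
    using N by (simp add: openin_subtopology_Int2 openin_imp_subset)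
  have mem_N: "c *s \<phi> w \<in> N" if "c \<noteq> 0" "w \<in> U" for c w
    using homeomorphism_image1[OF hom] that by force
  have g: "g (c *s \<phi> w) = (c, w)" if "c \<noteq> 0" "w \<in> U" for c w
    using homeomorphism_apply1[OF hom, of "(c, w)"] that by simp
  have "cone_frame (affine_cone Z) \<phi> (\<lambda>w. frechet_derivative \<phi> (at w)) U"
  proof
    show "zariski_closure (affine_cone Z) = affine_cone Z"
      "\<And>y c. y \<in> affine_cone Z \<Longrightarrow> c *s y \<in> affine_cone Z"
      by (rule proj_closed_cone[OF Z], assumption?)+
    show "\<phi> w \<in> affine_cone Z" if "w \<in> U" for w
      using mem_N[of 1 w] that N_C by auto
    show "\<exists>a v. a \<longlonglongrightarrow> c \<and> v \<longlonglongrightarrow> w \<and> (\<forall>\<^sub>F n in sequentially. y n = a n *s \<phi> (v n) \<and> v n \<in> U)"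
      if w: "w \<in> U" "c \<noteq> 0" and y: "\<And>n. y n \<in> affine_cone Z" "y \<longlonglongrightarrow> c *s \<phi> w" for w c y
    proof -
      obtain T where T: "open T" "N = affine_cone Z \<inter> T"
        using N by (auto simp: openin_open)
      have "\<forall>\<^sub>F n in sequentially. y n \<in> T"
        using y(2) T mem_N[OF w(2,1)] by (intro topological_tendstoD) auto
      then have ev: "\<forall>\<^sub>F n in sequentially. y n \<in> N"
        using y(1) T(2) by (auto elim: eventually_mono)
      have "(\<lambda>n. g (y n)) \<longlonglongrightarrow> g (c *s \<phi> w)"
        using hom mem_N[OF w(2,1)] ev y(2)
        by (intro continuous_on_tendsto_compose[of N g]) (auto simp: homeomorphism_def)
      then have lim: "(\<lambda>n. g (y n)) \<longlonglongrightarrow> (c, w)"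
        by (simp add: g w)
      have "\<forall>\<^sub>F n in sequentially. y n = fst (g (y n)) *s \<phi> (snd (g (y n))) \<and> snd (g (y n)) \<in> U"
        using ev
      proof eventually_elim
        case (elim n)
        have "g (y n) \<in> (- {0}) \<times> U"
          using homeomorphism_image2[OF hom] elim by blast
        moreover have "(\<lambda>(c, w). c *s \<phi> w) (g (y n)) = y n"
          using homeomorphism_apply2[OF hom elim] .
        ultimately show ?case
          by (auto simp: case_prod_unfold)
      qed
      then show ?thesis
        using tendsto_fst[OF lim] tendsto_snd[OF lim] by auto
    qed
    have D: "\<exists>D. (\<phi> has_derivative D) (at w) \<and> Vector_Spaces.linear (*s) (*s) D \<and> D = frechet_derivative \<phi> (at w)"
      if "w \<in> U" for w
      using U(2) that frechet_derivative_at unfolding holomorphic_map_def by blast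
    show "(\<phi> has_derivative frechet_derivative \<phi> (at w)) (at w)" if "w \<in> U" for w
      using D[OF that] by blast
    show "frechet_derivative \<phi> (at w) (c *s h) = c *s frechet_derivative \<phi> (at w) h" if "w \<in> U" for w c h
    proof -
      interpret Vector_Spaces.linear "(*s)" "(*s)" "frechet_derivative \<phi> (at w)"
        using D[OF that] by blast
      show ?thesis by (rule scale)
    qed
    show "c = 0 \<and> h = 0" if "w \<in> U" "c *s \<phi> w + frechet_derivative \<phi> (at w) h = 0" for w c h
      by (rule imm[OF that])
    show "open U"
      using U(2) by (simp add: holomorphic_map_def)
  qed (rule U(1))
  then show thesis
    using that U by blast
qed

theorem theorem1p4:
  fixes Z :: "(complex^'n) set set"
    and x :: "(complex^'n) set"
    and \<phi> :: "complex^'d \<Rightarrow> complex^'n"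
    and r :: nat
    and cl :: "nat \<Rightarrow> (((complex^'d) list \<Rightarrow> complex) \<Rightarrow> complex) \<Rightarrow> complex^'m"
  assumes "projective_variety Z"
    and "linearly_nondegenerate Z"
    and "x \<in> Z"
    and "local_frame Z x \<phi>"
    and "symbol_system r (fundamental_forms \<phi>)"
    and "symbol_dim r (fundamental_forms \<phi>) = CARD('n)"
    and "symbol_quotient (fundamental_forms \<phi>) cl"
  shows "cmat.dim (aut_cone (affine_cone Z)) \<le> cmat.dim (aut_cone (euler_cone r cl)) \<and>
    (cmat.dim (aut_cone (affine_cone Z)) = cmat.dim (aut_cone (euler_cone r cl)) \<longleftrightarrow>
      projectively_equivalent Z (euler_variety r cl))"
proof -
  have Z: "proj_closed Z" "Z \<noteq> {}"
    using assms(1) by (simp_all add: projective_variety_def)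
  obtain U where U: "holomorphic_map U \<phi>" "0 \<in> U"
    "cone_frame (affine_cone Z) \<phi> (\<lambda>w. frechet_derivative \<phi> (at w)) U"
    using local_frame_cone_frame[OF Z assms(4)] by blast
  obtain d :: "'n \<Rightarrow> nat" and s M N where basis: "symbol_basis r (fundamental_forms \<phi>) d s"
    and MN: "M ** N = mat 1" "N ** M = mat 1"
    and lead: "\<And>i. has_leading_form \<phi> (\<lambda>w. frechet_derivative \<phi> (at w)) (M $ i) (d i) (s i)"
    using adapted_basis[OF U(1,2) assms(5,6)] by metis
  interpret symbol_basis r "fundamental_forms \<phi>" d s by (rule basis)
  obtain i0 where i0: "graded_symbol d s i0"
    using graded_symbol by blast
  interpret graded_symbol d s i0 by (rule i0)
  interpret frame: cone_frame "affine_cone Z" \<phi> "\<lambda>w. frechet_derivative \<phi> (at w)" U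
    by (rule U(3))
  interpret frame': cone_frame "(*v) M ` affine_cone Z" "\<lambda>w. M *v \<phi> w"
    "\<lambda>w h. M *v frechet_derivative \<phi> (at w) h" U
    by (rule frame.transport[OF MN])
  interpret adapted_frame d s i0 "(*v) M ` affine_cone Z" "\<lambda>w. M *v \<phi> w"
    "\<lambda>w h. M *v frechet_derivative \<phi> (at w) h" U
    by unfold_locales
      (use lead in \<open>simp_all add: has_leading_form_def matrix_vector_mult_def psi_def dpsi_def\<close>)
  obtain Q :: "complex^'m^'n" and R where Q: "Q ** R = mat 1" "R ** Q = mat 1"
    "\<And>k \<xi> i. \<xi> \<in> sym_power k \<Longrightarrow> (Q *v cl k \<xi>) $ i = (if d i = k then \<xi> (s i) else 0)"
    using quotient_coordinates[OF assms(7)] by blast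
  have Q_euler: "(*v) Q ` euler_cone r cl = zariski_closure model"
  proof -
    have "(*v) Q ` euler_cone r cl = zariski_closure (range (\<lambda>q. Q *v euler_map r cl q))"
      by (simp add: euler_cone_def zariski_closure_matrix_image[OF Q(1,2), symmetric] image_image)
    also have "\<dots> = zariski_closure model"
      by (rule euler_closure[OF i0]) (rule euler_map_coordinates[OF Q(3)])
    finally show ?thesis .
  qed
  have model_scale: "c *s y \<in> model" if "y \<in> model" for c y
  proof -
    obtain a w where "y = a *s psi w"
      using \<open>y \<in> model\<close> by (auto simp: model_def)
    then have "c *s y = (c * a) *s psi w"
      by simp
    then show ?thesis
      unfolding model_def by blast
  qed
  have euler_closed: "zariski_closure (euler_cone r cl) = euler_cone r cl"
    by (simp add: euler_cone_def zariski_closure_idem)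
  have RQ: "R *v (Q *v y) = y" for y
    by (simp add: matrix_vector_mul_assoc Q)
  have euler_R: "euler_cone r cl = (*v) R ` zariski_closure model"
    by (simp add: Q_euler[symmetric] image_image RQ)
  \<comment> \<open>Scalar multiplication is the matrix \<open>mat c\<close>, so polynomials pull
    back along it, also for \<open>c = 0\<close>.\<close>
  have closure_scale: "c *s y \<in> zariski_closure model" if "y \<in> zariski_closure model" for c y
  proof -
    have "p (c *s y) = 0" if p: "poly_fun p" "\<forall>y\<in>model. p y = 0" for p
    proof -
      have "poly_fun (\<lambda>y. p (mat c *v y))"
        by (rule poly_fun_matrix_comp[OF p(1)])
      moreover have mat_c: "mat c *v y = c *s y" for y :: "complex^'n"
        by (simp add: vec_eq_iff mat_def matrix_vector_mult_def if_distrib[of "\<lambda>x. x * _"] cong: if_cong)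
      ultimately show ?thesis
        using \<open>y \<in> zariski_closure model\<close> p(2) model_scale by (auto simp: zariski_closure_def)
    qed
    then show ?thesis
      by (simp add: zariski_closure_def)
  qed
  have euler_affine: "affine_cone (euler_variety r cl) = euler_cone r cl"
    unfolding euler_variety_def
  proof (rule affine_cone_lines)
    show "c *s y \<in> euler_cone r cl" if "y \<in> euler_cone r cl" for c y
      using that closure_scale unfolding euler_R by (auto simp: vec.scale[symmetric])
    have "0 *s psi 0 \<in> model"
      unfolding model_def by blast
    then have "0 \<in> zariski_closure model"
      using zariski_closure_superset by auto
    then show "0 \<in> euler_cone r cl"
      unfolding euler_R by (auto intro: image_eqI[of _ _ 0])
  qed
  have dim_Z: "cmat.dim (aut_cone (affine_cone Z)) = cmat.dim (inf_aut ((*v) M ` affine_cone Z))"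
    by (simp add: aut_cone_eq_inf_aut frame.closed dim_inf_aut_matrix_image[OF MN])
  have dim_euler: "cmat.dim (aut_cone (euler_cone r cl)) = cmat.dim (inf_aut model)"
    using dim_inf_aut_matrix_image[OF Q(1,2), of "euler_cone r cl"]
    by (simp add: aut_cone_eq_inf_aut euler_closed Q_euler inf_aut_zariski_closure)
  have "projectively_equivalent Z (euler_variety r cl)"
    if eq: "cmat.dim (aut_cone (affine_cone Z)) = cmat.dim (aut_cone (euler_cone r cl))"
  proof -
    obtain M' N' :: "complex^'n^'n" where M': "M' ** N' = mat 1" "N' ** M' = mat 1"
      and sub: "model \<subseteq> (*v) M' ` (*v) M ` affine_cone Z"
      and orb: "\<And>y. y \<in> (*v) M' ` (*v) M ` affine_cone Z \<Longrightarrow> y $ i0 \<noteq> 0 \<Longrightarrow> y \<in> model"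
      and x0: "(M' *v (M *v \<phi> 0)) $ i0 \<noteq> 0"
      using equality_case[OF eq[unfolded dim_Z dim_euler]] by blast
    define G where "G = M' ** M"
    define H where "H = N ** N'"
    have GH: "G ** H = mat 1" "H ** G = mat 1"
    proof -
      have "G ** H = M' ** (M ** N) ** N'" "H ** G = N ** (N' ** M') ** M"
        by (simp_all add: G_def H_def matrix_mul_assoc)
      then show "G ** H = mat 1" "H ** G = mat 1"
        by (simp_all add: MN M')
    qed
    have G: "(*v) M' ` (*v) M ` A = (*v) G ` A" for A
      by (simp add: G_def image_image matrix_vector_mul_assoc)
    have x_mem: "\<phi> 0 \<in> x"
      using assms(4) by (simp add: local_frame_def)
    have "(*v) G ` affine_cone Z \<subseteq> zariski_closure model"
    proof (rule irreducible_cone_subset[OF assms(1) model_scale _ assms(3) x_mem])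
      show "G *v v \<in> model" if "v \<in> affine_cone Z" "(G *v v) $ i0 \<noteq> 0" for v
        using orb[of "G *v v"] that unfolding G by blast
      show "(G *v \<phi> 0) $ i0 \<noteq> 0"
        using x0 by (simp add: G_def matrix_vector_mul_assoc)
    qed
    moreover have "zariski_closure ((*v) G ` affine_cone Z) = (*v) G ` affine_cone Z"
      by (simp add: zariski_closure_matrix_image[OF GH] frame.closed)
    then have "zariski_closure model \<subseteq> (*v) G ` affine_cone Z"
      using sub zariski_closure_minimal[of model "(*v) G ` affine_cone Z"] unfolding G by simp
    ultimately have GZ: "(*v) G ` affine_cone Z = zariski_closure model"
      by blast
    \<comment> \<open>\<open>M\<close> adapts the coordinates, \<open>M'\<close> conjugates to the
      degree matrix, and \<open>R\<close> leads from model coordinates to the quotient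
      space.\<close>
    define F where "F = R ** G"
    define F' where "F' = H ** Q"
    have F: "F ** F' = mat 1" "F' ** F = mat 1"
    proof -
      have "F ** F' = R ** (G ** H) ** Q" "F' ** F = H ** (Q ** R) ** G"
        by (simp_all add: F_def F'_def matrix_mul_assoc)
      then show "F ** F' = mat 1" "F' ** F = mat 1"
        by (simp_all add: GH Q)
    qed
    have "(*v) F ` affine_cone Z = (*v) R ` (*v) G ` affine_cone Z"
      by (simp add: F_def image_image matrix_vector_mul_assoc)
    then have "(*v) F ` affine_cone Z = euler_cone r cl"
      by (simp add: GZ euler_R)
    then have "(\<lambda>L. (*v) F ` L) ` Z = euler_variety r cl"
      unfolding euler_variety_def by (rule variety_image_eq[OF F proj_closed_cone(3)[OF Z]])
    moreover have "bij ((*v) F)"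
      by (rule bij_betw_byWitness[of _ "(*v) F'"]) (simp_all add: matrix_vector_mul_assoc F)
    ultimately show ?thesis
      unfolding projectively_equivalent_def using matrix_vector_mul_linear_gen by blast
  qed
  moreover have "cmat.dim (aut_cone (affine_cone Z)) = cmat.dim (aut_cone (euler_cone r cl))"
    if equiv: "projectively_equivalent Z (euler_variety r cl)"
  proof -
    obtain f where f: "Vector_Spaces.linear (*s) (*s) f" "bij f" "(\<lambda>L. f ` L) ` Z = euler_variety r cl"
      using equiv unfolding projectively_equivalent_def by blast
    obtain F F' where F: "f = (*v) F" "F ** F' = mat 1" "F' ** F = mat 1"
      using bij_linear_matrix[OF f(1,2)] by blast
    \<comment> \<open>Projective equivalence concerns sets of lines; the cones are recovered from
      them, and conjugation by a linear isomorphism preserves the dimension.\<close>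
    have "euler_cone r cl = f ` affine_cone Z"
      unfolding euler_affine[symmetric] f(3)[symmetric]
      by (rule affine_cone_linear_image) (simp add: F(1))
    then have "euler_cone r cl = (*v) F ` affine_cone Z"
      by (simp only: F(1))
    then show ?thesis
      using dim_inf_aut_matrix_image[OF F(2,3), of "affine_cone Z"] euler_closed
      by (simp add: aut_cone_eq_inf_aut frame.closed)
  qed
  moreover have "cmat.dim (aut_cone (affine_cone Z)) \<le> cmat.dim (aut_cone (euler_cone r cl))"
    unfolding dim_Z dim_euler by (rule dim_inf_aut_le)
  ultimately show ?thesis
    by blast
qed

end
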